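(* Let $\mathbb{F}=\mathbb{R}$ or $\mathbb{F}=\mathbb{C}$, let $m,n,d$ be positive integers, and let $k'=\left\lceil\frac{md}{n}\right\rceil$ and $t=nk'-md$ (so $0\le t<n$). Then each of the following subsets of $\mathbb{F}[\lambda]^{m\times(m+n)}_d$ is generic in $\mathbb{F}[\lambda]^{m\times(m+n)}_d$: (a) The set of $m\times(m+n)$ polynomial matrices of degree at most $d$ whose complete eigenstructure consists only of the following right minimal indices: $\alpha_{k'-1}=t$, $\alpha_{k'}=n-t$, and $\alpha_j=0$ for $j\notin\{k'-1,k'\}$, where $\alpha_j$ denotes the number of right minimal indices equal to $j$. (b) The set of $m\times(m+n)$ polynomial matrices of degree at most $d$ that are minimal bases with degree-$d$ matrix coefficient of full row rank. (c) The set of $m\times(m+n)$ polynomial matrices of degree at most $d$ that are minimal bases and such that their dual minimal bases have degree equal to $k'$.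
   Context: $\mathbb{F}[\lambda]^{m\times(m+n)}_d$ is the $\mathbb{F}$-vector space of $m\times(m+n)$ polynomial matrices $M(\lambda)=M_0+M_1\lambda+\cdots+M_d\lambda^d$ of degree at most $d$ ($M_d=0$ allowed); $M_d$ is the degree-$d$ matrix coefficient. Minimal bases: a minimal basis of a subspace $\mathcal V\subseteq\mathbb{F}(\lambda)^{q}$ (over $\mathbb{F}(\lambda)$) is a basis of $\mathcal V$ consisting of polynomial vectors whose sum of degrees (degree of a vector = highest degree of its entries) is minimal among all polynomial bases of $\mathcal V$. The ordered list of degrees is the same for all minimal bases of $\mathcal V$; these degrees are the minimal indices of $\mathcal V$. A polynomial matrix with fewer rows than columns is called a minimal basis if its rows form a minimal basis of the subspace they span. Polynomial matrices $M(\lambda)\in\mathbb{F}[\lambda]^{m\times(m+n)}$ and $N(\lambda)\in\mathbb{F}[\lambda]^{n\times(m+n)}$ of full row rank are dual minimal bases if both are minimal bases and $M(\lambda)N(\lambda)^T=0$. The degree of a polynomial matrix is the highest degree of its entries. The right (resp. left) minimal indices of a polynomial matrix $M(\lambda)$ are the minimal indices of its right (resp. left) null space over $\mathbb{F}(\lambda)$, when nontrivial. The complete eigenstructure of $M(\lambda)$, regarded as of degree at most $d$, consists of its finite elementary divisors, its infinite elementary divisors (the elementary divisors associated with the eigenvalue $0$ of $\lambda^dM(1/\lambda)$), and its left and right minimal indices. That it "consists only of" certain right minimal indices means that these are all the right minimal indices and there are no finite or infinite elementary divisors and no left minimal indices. Genericity: an algebraic set in $\mathbb{R}^p$ is the set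 of common zeros of finitely many real polynomials in $p$ variables, proper if it is not all of $\mathbb{R}^p$; a generic set of $\mathbb{R}^p$ is a subset whose complement is contained in a proper algebraic set. This is transferred to $\mathbb{F}[\lambda]^{m\times(m+n)}_d$ by identifying it with $\mathbb{R}^{(d+1)m(m+n)}$ (entries of $M_0,\dots,M_d$) if $\mathbb{F}=\mathbb{R}$, or with $\mathbb{R}^{2(d+1)m(m+n)}$ (real and imaginary parts of the entries) if $\mathbb{F}=\mathbb{C}$. *)

theory Defs
  imports
    Complex_Main
    "HOL-Library.Multiset"
    "HOL-Library.Poly_Mapping"
    "HOL-Computational_Algebra.Computational_Algebra"
    "HOL-Computational_Algebra.Field_as_Ring"
    "Jordan_Normal_Form.Matrix_Kernel"
    "Jordan_Normal_Form.DL_Rank"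
begin

section \<open>Polynomial matrices\<close>

definition polymats :: "nat \<Rightarrow> nat \<Rightarrow> nat \<Rightarrow> 'a::zero poly mat set" where
  "polymats d r q = {M \<in> carrier_mat r q. \<forall>i<r. \<forall>j<q. Polynomial.degree (M $$ (i, j)) \<le> d}"

definition coeff_mat :: "'a::zero poly mat \<Rightarrow> nat \<Rightarrow> 'a mat" where
  "coeff_mat M k = map_mat (\<lambda>p. Polynomial.coeff p k) M"

definition polyvec_degree :: "'a::zero poly vec \<Rightarrow> nat" where
  "polyvec_degree v = Max (Polynomial.degree ` vec_set v)"

definition polymat_degree :: "'a::zero poly mat \<Rightarrow> nat" where
  "polymat_degree M = Max (Polynomial.degree ` elements_mat M)"

definition full_row_rank :: "'a::field mat \<Rightarrow> bool" where
  "full_row_rank A \<longleftrightarrow> vec_space.rank (dim_row A) A = dim_row A"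

abbreviation ratvec :: "'a::field poly vec \<Rightarrow> 'a poly fract vec" where
  "ratvec \<equiv> map_vec to_fract"

abbreviation ratmat :: "'a::field poly mat \<Rightarrow> 'a poly fract mat" where
  "ratmat \<equiv> map_mat to_fract"

section \<open>Minimal bases and minimal indices\<close>

definition polynomial_basis ::
    "nat \<Rightarrow> 'a::field poly fract vec set \<Rightarrow> 'a poly vec list \<Rightarrow> bool" where
  "polynomial_basis q V vs \<longleftrightarrow>
     set vs \<subseteq> carrier_vec q \<and> distinct vs \<and>
     \<not> LinearCombinations.module.lin_dep class_ring (module_vec TYPE('a poly fract) q)
         (ratvec ` set vs) \<and>
     LinearCombinations.module.span class_ring (module_vec TYPE('a poly fract) q)
         (ratvec ` set vs) = V"

definition minimal_basis ::
    "nat \<Rightarrow> 'a::field poly fract vec set \<Rightarrow> 'a poly vec list \<Rightarrow> bool" where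
  "minimal_basis q V vs \<longleftrightarrow>
     polynomial_basis q V vs \<and>
     (\<forall>ws. polynomial_basis q V ws \<longrightarrow>
        sum_list (map polyvec_degree vs) \<le> sum_list (map polyvec_degree ws))"

text \<open>All minimal bases of a subspace have the same degrees, up to order. For the zero subspace
  the only basis is the empty one, and there are no minimal indices.\<close>

definition minimal_indices :: "nat \<Rightarrow> 'a::field poly fract vec set \<Rightarrow> nat multiset" where
  "minimal_indices q V =
     (THE I. \<exists>vs. minimal_basis q V vs \<and> I = mset (map polyvec_degree vs))"

definition right_minimal_indices :: "'a::field poly mat \<Rightarrow> nat multiset" where
  "right_minimal_indices M = minimal_indices (dim_col M) (mat_kernel (ratmat M))"

definition left_minimal_indices :: "'a::field poly mat \<Rightarrow> nat multiset" where
  "left_minimal_indices M =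
     minimal_indices (dim_row M) (mat_kernel (transpose_mat (ratmat M)))"

definition minimal_basis_mat :: "'a::field poly mat \<Rightarrow> bool" where
  "minimal_basis_mat M \<longleftrightarrow>
     dim_row M < dim_col M \<and>
     minimal_basis (dim_col M) (vec_space.row_space (dim_col M) (ratmat M)) (rows M)"

definition dual_minimal_bases :: "'a::field poly mat \<Rightarrow> 'a poly mat \<Rightarrow> bool" where
  "dual_minimal_bases M N \<longleftrightarrow>
     dim_col N = dim_col M \<and> dim_row M + dim_row N = dim_col M \<and>
     full_row_rank (ratmat M) \<and> full_row_rank (ratmat N) \<and>
     minimal_basis_mat M \<and> minimal_basis_mat N \<and>
     M * transpose_mat N = 0\<^sub>m (dim_row M) (dim_row N)"

section \<open>Complete eigenstructure\<close>

text \<open>A matrix over a polynomial ring is unimodular iff it satisfies \<^const>\<open>invertible_mat\<close>: the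
  inverse is required to be a polynomial matrix.\<close>

definition is_smith_form :: "'a::field poly mat \<Rightarrow> 'a poly mat \<Rightarrow> bool" where
  "is_smith_form M D \<longleftrightarrow>
     D \<in> carrier_mat (dim_row M) (dim_col M) \<and>
     (\<forall>i<dim_row M. \<forall>j<dim_col M. i \<noteq> j \<longrightarrow> D $$ (i, j) = 0) \<and>
     (\<forall>i<min (dim_row M) (dim_col M). D $$ (i, i) = 0 \<or> lead_coeff (D $$ (i, i)) = 1) \<and>
     (\<forall>i. Suc i < min (dim_row M) (dim_col M) \<longrightarrow> D $$ (i, i) dvd D $$ (Suc i, Suc i)) \<and>
     (\<exists>U V. U \<in> carrier_mat (dim_row M) (dim_row M) \<and> invertible_mat U \<and>
            V \<in> carrier_mat (dim_col M) (dim_col M) \<and> invertible_mat V \<and>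
            D = U * M * V)"

definition invariant_polynomials :: "'a::field poly mat \<Rightarrow> 'a poly multiset" where
  "invariant_polynomials M =
     (let D = (THE D. is_smith_form M D)
      in filter_mset (\<lambda>p. p \<noteq> 0)
           (image_mset (\<lambda>i. D $$ (i, i)) (mset_set {..<min (dim_row M) (dim_col M)})))"

text \<open>Elementary divisors over the coefficient field: the powers of monic irreducible polynomials in
  the factorizations of the invariant polynomials, listed with repetitions.\<close>

definition finite_elementary_divisors :: "'a::field_gcd poly mat \<Rightarrow> 'a poly multiset" where
  "finite_elementary_divisors M =
     (\<Sum>p\<in>#invariant_polynomials M.
        image_mset (\<lambda>f. f ^ multiplicity f p) (mset_set (prime_factors p)))"

text \<open>For \<open>p\<close> of degree at most \<open>d\<close>, this is \<open>\<lambda>^d p(1/\<lambda>)\<close>.\<close>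

definition reversal :: "nat \<Rightarrow> 'a::comm_monoid_add poly \<Rightarrow> 'a poly" where
  "reversal d p = (\<Sum>k\<le>d. Polynomial.monom (Polynomial.coeff p (d - k)) k)"

definition infinite_elementary_divisors ::
    "nat \<Rightarrow> 'a::field_gcd poly mat \<Rightarrow> 'a poly multiset" where
  "infinite_elementary_divisors d M =
     filter_mset (\<lambda>e. \<exists>k. e = [:0, 1:] ^ k)
       (finite_elementary_divisors (map_mat (reversal d) M))"

definition complete_eigenstructure ::
    "nat \<Rightarrow> 'a::field_gcd poly mat \<Rightarrow>
       'a poly multiset \<times> 'a poly multiset \<times> nat multiset \<times> nat multiset" where
  "complete_eigenstructure d M =
     (finite_elementary_divisors M, infinite_elementary_divisors d M,
      left_minimal_indices M, right_minimal_indices M)"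

section \<open>Genericity\<close>

text \<open>Real multivariate polynomials: the outer \<^const>\<open>Poly_Mapping.lookup\<close> gives the coefficient of a
  monomial, the inner one the exponent of a variable. The variables of a polynomial in \<open>p\<close> variables
  are numbered \<open>0, \<dots>, p - 1\<close>.\<close>

type_synonym real_mpoly = "(nat \<Rightarrow>\<^sub>0 nat) \<Rightarrow>\<^sub>0 real"

definition mpolys :: "nat \<Rightarrow> real_mpoly set" where
  "mpolys p = {f. \<forall>e \<in> Poly_Mapping.keys f. Poly_Mapping.keys e \<subseteq> {..<p}}"

definition mpoly_eval :: "real_mpoly \<Rightarrow> real vec \<Rightarrow> real" where
  "mpoly_eval f x =
     (\<Sum>e\<in>Poly_Mapping.keys f.
        Poly_Mapping.lookup f e * (\<Prod>i\<in>Poly_Mapping.keys e. (x $ i) ^ Poly_Mapping.lookup e i))"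

definition algebraic_set :: "nat \<Rightarrow> real vec set \<Rightarrow> bool" where
  "algebraic_set p A \<longleftrightarrow>
     (\<exists>F. finite F \<and> F \<subseteq> mpolys p \<and> A = {x \<in> carrier_vec p. \<forall>f\<in>F. mpoly_eval f x = 0})"

definition generic_set :: "nat \<Rightarrow> real vec set \<Rightarrow> bool" where
  "generic_set p S \<longleftrightarrow>
     S \<subseteq> carrier_vec p \<and>
     (\<exists>A. algebraic_set p A \<and> A \<noteq> carrier_vec p \<and> carrier_vec p - S \<subseteq> A)"

text \<open>All entries of the coefficients \<open>M\<^sub>0, \<dots>, M\<^sub>d\<close>, each coefficient matrix listed row by row.\<close>

definition coeff_vec :: "nat \<Rightarrow> nat \<Rightarrow> nat \<Rightarrow> 'a::zero poly mat \<Rightarrow> 'a vec" where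
  "coeff_vec d r q M =
     vec ((d + 1) * r * q)
       (\<lambda>l. coeff_mat M (l div (r * q)) $$ (l mod (r * q) div q, l mod q))"

definition real_coords :: "nat \<Rightarrow> nat \<Rightarrow> nat \<Rightarrow> real poly mat \<Rightarrow> real vec" where
  "real_coords d r q M = coeff_vec d r q M"

definition complex_coords :: "nat \<Rightarrow> nat \<Rightarrow> nat \<Rightarrow> complex poly mat \<Rightarrow> real vec" where
  "complex_coords d r q M =
     map_vec Re (coeff_vec d r q M) @\<^sub>v map_vec Im (coeff_vec d r q M)"

lemma coeff_vec_index:
  assumes "k \<le> d" "i < r" "j < q" "M \<in> carrier_mat r q"
  shows "k * (r * q) + i * q + j < (d + 1) * r * q"
    and "coeff_vec d r q M $ (k * (r * q) + i * q + j) = Polynomial.coeff (M $$ (i, j)) k"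
proof -
  have "(i + 1) * q \<le> r * q" by (rule mult_le_mono1) (use assms in simp)
  then have b: "i * q + j < r * q" using assms(3) by simp
  have "(k + 1) * (r * q) \<le> (d + 1) * (r * q)" by (rule mult_le_mono1) (use assms in simp)
  then show l: "k * (r * q) + i * q + j < (d + 1) * r * q"
    using b unfolding distrib_right mult.assoc by linarith
  define l where "l = k * (r * q) + (i * q + j)"
  have "l div (r * q) = k" "l mod (r * q) = i * q + j"
    using b by (auto simp: l_def intro!: div_nat_eqI)
  moreover have "l mod q = j" using assms(3)
    by (simp add: l_def mult.assoc[symmetric] add.assoc[symmetric])
      (metis mod_less mod_mult_self3 add.commute distrib_right)
  moreover have "(i * q + j) div q = i" using assms(3) by simp
  ultimately show "coeff_vec d r q M $ (k * (r * q) + i * q + j) = Polynomial.coeff (M $$ (i, j)) k"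
    using l assms by (simp add: coeff_vec_def coeff_mat_def l_def add.assoc)
qed

lemma coeff_vec_bij:
  assumes "0 < r" "0 < q"
  shows "bij_betw (coeff_vec d r q :: 'a::comm_monoid_add poly mat \<Rightarrow> _)
           (polymats d r q) (carrier_vec ((d + 1) * r * q))"
proof (rule bij_betw_imageI)
  show "inj_on (coeff_vec d r q :: 'a poly mat \<Rightarrow> _) (polymats d r q)"
  proof (rule inj_onI)
    fix M N :: "'a poly mat"
    assume MN: "M \<in> polymats d r q" "N \<in> polymats d r q" "coeff_vec d r q M = coeff_vec d r q N"
    then have c: "M \<in> carrier_mat r q" "N \<in> carrier_mat r q" by (auto simp: polymats_def)
    have "M $$ (i, j) = N $$ (i, j)" if ij: "i < r" "j < q" for i j
    proof (rule poly_eqI)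
      fix k
      show "Polynomial.coeff (M $$ (i, j)) k = Polynomial.coeff (N $$ (i, j)) k"
      proof (cases "k \<le> d")
        case True
        then show ?thesis using coeff_vec_index(2)[OF _ ij] c MN(3) by metis
      next
        case False
        then have "Polynomial.degree (M $$ (i, j)) < k" "Polynomial.degree (N $$ (i, j)) < k"
          using MN(1,2) ij by (fastforce simp: polymats_def)+
        then show ?thesis by (simp add: coeff_eq_0)
      qed
    qed
    then show "M = N" using c by (intro eq_matI) auto
  qed
  show "coeff_vec d r q ` (polymats d r q :: 'a poly mat set) = carrier_vec ((d + 1) * r * q)"
  proof (intro equalityI subsetI)
    fix x :: "'a vec" assume x: "x \<in> carrier_vec ((d + 1) * r * q)"
    define M where "M = mat r q (\<lambda>(i, j).
      \<Sum>k\<le>d. Polynomial.monom (x $ (k * (r * q) + i * q + j)) k)"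
    have M: "M \<in> polymats d r q"
      by (auto simp: M_def polymats_def intro!: degree_sum_le
            intro: order_trans[OF degree_monom_le])
    have "coeff_vec d r q M = x"
    proof (rule eq_vecI)
      show "dim_vec (coeff_vec d r q M) = dim_vec x" using x by (simp add: coeff_vec_def)
      fix l assume "l < dim_vec x"
      then have l: "l < (d + 1) * (r * q)" using x by (simp only: carrier_vecD mult.assoc)
      define k i j where kij: "k = l div (r * q)" "i = l mod (r * q) div q" "j = l mod q"
      have k: "k \<le> d" using l assms by (simp add: kij less_mult_imp_div_less less_Suc_eq_le[symmetric])
      have ij: "i < r" "j < q" using assms by (auto simp: kij less_mult_imp_div_less)
      have "l mod q = (l mod (r * q)) mod q" by (simp add: mod_mod_cancel)
      then have "i * q + j = l mod (r * q)" by (simp add: kij)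
      then have le: "l = k * (r * q) + i * q + j" by (metis div_mult_mod_eq kij(1) add.assoc)
      have "coeff_vec d r q M $ l = Polynomial.coeff (M $$ (i, j)) k"
        using coeff_vec_index(2)[OF k ij] M le by (auto simp: polymats_def)
      also have "\<dots> = x $ l" using k ij le by (simp add: M_def coeff_sum)
      finally show "coeff_vec d r q M $ l = x $ l" .
    qed
    then show "x \<in> coeff_vec d r q ` polymats d r q" using M by blast
  qed (auto simp: coeff_vec_def)
qed

lemma real_coords_bij:
  assumes "0 < r" "0 < q"
  shows "bij_betw (real_coords d r q) (polymats d r q) (carrier_vec ((d + 1) * r * q))"
  using coeff_vec_bij[OF assms] by (simp add: real_coords_def[abs_def])

lemma complex_coords_bij:
  assumes "0 < r" "0 < q"
  shows "bij_betw (complex_coords d r q) (polymats d r q) (carrier_vec (2 * (d + 1) * r * q))"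
proof -
  define N where "N = (d + 1) * r * q"
  define h :: "complex vec \<Rightarrow> real vec" where "h v = map_vec Re v @\<^sub>v map_vec Im v" for v
  have "bij_betw h (carrier_vec N) (carrier_vec (N + N))"
  proof (rule bij_betw_byWitness[where f' = "\<lambda>x::real vec. vec N (\<lambda>i. Complex (x $ i) (x $ (N + i)))"])
    show "\<forall>v\<in>carrier_vec N. vec N (\<lambda>i. Complex (h v $ i) (h v $ (N + i))) = v"
      by (auto simp: h_def intro!: eq_vecI)
    show "\<forall>x\<in>carrier_vec (N + N). h (vec N (\<lambda>i. Complex (x $ i) (x $ (N + i)))) = x"
      by (auto simp: h_def intro!: eq_vecI)
  qed (auto simp: h_def)
  moreover have "complex_coords d r q = h \<circ> coeff_vec d r q"
    by (auto simp: complex_coords_def h_def)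
  moreover have "N + N = 2 * (d + 1) * r * q" unfolding N_def by (simp only: mult_2 distrib_right)
  ultimately show ?thesis
    using bij_betw_trans[OF coeff_vec_bij[OF assms, of d, folded N_def]] by simp
qed

definition generic_real :: "nat \<Rightarrow> nat \<Rightarrow> nat \<Rightarrow> real poly mat set \<Rightarrow> bool" where
  "generic_real d r q S \<longleftrightarrow>
     S \<subseteq> polymats d r q \<and> generic_set ((d + 1) * r * q) (real_coords d r q ` S)"

definition generic_complex :: "nat \<Rightarrow> nat \<Rightarrow> nat \<Rightarrow> complex poly mat set \<Rightarrow> bool" where
  "generic_complex d r q S \<longleftrightarrow>
     S \<subseteq> polymats d r q \<and> generic_set (2 * (d + 1) * r * q) (complex_coords d r q ` S)"

definition eigenstructure_only_right ::
    "nat \<Rightarrow> nat \<Rightarrow> nat \<Rightarrow> (nat \<Rightarrow> nat) \<Rightarrow> 'a::field_gcd poly mat set" where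
  "eigenstructure_only_right d r q \<alpha> =
     {M \<in> polymats d r q.
        \<exists>R. complete_eigenstructure d M = ({#}, {#}, {#}, R) \<and> (\<forall>j. count R j = \<alpha> j)}"

definition minimal_bases_full_leading ::
    "nat \<Rightarrow> nat \<Rightarrow> nat \<Rightarrow> 'a::field poly mat set" where
  "minimal_bases_full_leading d r q =
     {M \<in> polymats d r q. minimal_basis_mat M \<and> full_row_rank (coeff_mat M d)}"

text \<open>Every minimal basis matrix has dual minimal bases, so the existence conjunct only makes explicit
  that the condition on the duals is not vacuous.\<close>

definition minimal_bases_dual_degree ::
    "nat \<Rightarrow> nat \<Rightarrow> nat \<Rightarrow> nat \<Rightarrow> 'a::field poly mat set" where
  "minimal_bases_dual_degree d r q k =
     {M \<in> polymats d r q.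
        minimal_basis_mat M \<and> (\<exists>N. dual_minimal_bases M N) \<and>
        (\<forall>N. dual_minimal_bases M N \<longrightarrow> polymat_degree N = k)}"

end

(* Write q = m + n and k = k'. For A of degree at most d, multiplication x |-> A x sends polynomial
   vectors of degree less than K to vectors of degree less than d + K. All three properties
   follow from two conditions on A: multiplication is surjective for K = k and injective for
   K = k - 1. Each condition is the non-vanishing of a determinant in the coefficients of A, so
   it remains to exhibit one matrix that satisfies both; a sparse zigzag-like matrix with monomial
   entries does.

   Given the conditions, A has a polynomial right inverse X and a leading coefficient of full row
   rank. Rank-nullity gives t kernel vectors of degree k - 1, and completing them and their
   shifts to a basis of the kernel vectors of degree at most k gives n - t further vectors; comparing
   leading coefficients shows that these n vectors N generate all polynomial kernel vectors, so
   [X, N^T] is unimodular and its inverse is [A; Y] for some Y. Every polynomial basis of the kernel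
   has n elements of degree at least k - 1, at most t of them of degree exactly k - 1, which forces
   the minimal indices. The conditions are invariant under reversal, which handles the infinite
   elementary divisors. *)
theory Submission
  imports Defs "HOL-Library.Function_Algebras"
begin

section \<open>Polynomial vectors of bounded degree\<close>

text \<open>With K coefficients the domain has dimension (m + n) K and the target m (d + K). The
  difference n K - m d is t at K = k and t - n < 0 at K = k - 1, which is why surjectivity is asked
  at k and injectivity at k - 1. Only the implication from these conditions to the three properties
  is proved: a generic set may be larger than the complement of the algebraic set. No polynomial
  equations for minimal indices, which are defined by minimising over all bases, are ever needed.
  The determinants are not minors picked from the rectangular matrix of the multiplication map:
  preimages, or a linear left inverse, fixed once at the explicit matrix give a square matrix that
  equals the identity there. All algebra is done over an arbitrary field, so one argument serves
  both fields; a complex determinant vanishes exactly where its real and imaginary parts do.\<close>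

lemma sum_fun_apply: "(\<Sum>a\<in>A. f a) x = (\<Sum>a\<in>A. f a x)"
  for f :: "'a \<Rightarrow> 'b \<Rightarrow> 'c::comm_monoid_add"
  by (induction A rule: infinite_finite_induct) auto

text \<open>Exchange argument for indexed families, where \<open>g\<close> may repeat. Independence
  is stated on coefficients, so it forces \<open>f\<close> to be injective: two equal members would
  satisfy the relation with coefficients 1 and -1.\<close>

lemma (in vector_space) family_card_le:
  assumes "finite I" "finite J"
    and indep: "\<And>a i. (\<Sum>i\<in>I. a i *s f i) = 0 \<Longrightarrow> i \<in> I \<Longrightarrow> a i = 0"
    and sp: "\<And>i. i \<in> I \<Longrightarrow> f i \<in> span (g ` J)"
  shows "card I \<le> card J"
proof -
  have inj: "inj_on f I"
  proof (rule inj_onI, rule ccontr)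
    fix i j assume ij: "i \<in> I" "j \<in> I" "f i = f j" "i \<noteq> j"
    define a where "a = (\<lambda>l. if l = i then 1 else if l = j then -1 else (0::'a))"
    have "(\<Sum>l\<in>I. a l *s f l) = (\<Sum>l\<in>{i,j}. a l *s f l)"
      using ij assms(1) by (intro sum.mono_neutral_right) (auto simp: a_def)
    also have "\<dots> = 0" using ij by (simp add: a_def)
    finally have "a i = 0" using indep ij(1) by blast
    then show False by (simp add: a_def)
  qed
  have "independent (f ` I)"
  proof (rule independent_if_scalars_zero)
    show "finite (f ` I)" using assms by simp
    fix u x assume "(\<Sum>x\<in>f ` I. u x *s x) = 0" and x: "x \<in> f ` I"
    then have "(\<Sum>i\<in>I. u (f i) *s f i) = 0" by (simp add: sum.reindex[OF inj])
    then show "u x = 0" using indep[of "\<lambda>i. u (f i)"] x by blast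
  qed
  then have "card (f ` I) \<le> card (g ` J)"
    using independent_span_bound[of "g ` J" "f ` I"] assms by blast
  also have "\<dots> \<le> card J" using assms card_image_le by blast
  finally show ?thesis using inj by (simp add: card_image)
qed

lemma (in vector_space) independent_scalars_zero:
  assumes "independent A" "finite A" "(\<Sum>x\<in>A. u x *s x) = 0" "x \<in> A"
  shows "u x = 0"
  using assms independent_explicit_finite_subsets by blast

text \<open>Rank-nullity inside the finitely spanned subspace \<open>vs1.span B\<close>, because the
  ambient space of functions is infinite dimensional. A basis \<open>A\<close> of the kernel is
  extended to a basis \<open>E\<close>; the added vectors \<open>D\<close> map to a basis of the
  image.\<close>

lemma (in vector_space_pair) kernel_basis_exists:
  assumes lin: "Vector_Spaces.linear s1 s2 f"
    and B: "vs1.independent B" "finite B" and C: "vs2.independent C" "finite C"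
    and img: "f ` vs1.span B = vs2.span C"
  obtains A where "finite A" "vs1.independent A" "card A + card C = card B"
    "vs1.span A = {x \<in> vs1.span B. f x = 0}"
proof -
  interpret f: Vector_Spaces.linear s1 s2 f by (rule lin)
  define P where "P = {x \<in> vs1.span B. f x = 0}"
  have sP: "vs1.subspace P"
    by (auto simp: P_def vs1.subspace_def f.add f.scale vs1.span_zero vs1.span_add vs1.span_scale)
  obtain A where A: "A \<subseteq> P" "vs1.independent A" "P \<subseteq> vs1.span A"
    using vs1.maximal_independent_subset .
  have spA: "vs1.span A = P" using A sP by (simp add: subset_antisym vs1.span_minimal)
  obtain E where E: "A \<subseteq> E" "E \<subseteq> vs1.span B" "vs1.independent E" "vs1.span B \<subseteq> vs1.span E"
    using vs1.maximal_independent_subset_extend[of A "vs1.span B"] A P_def by auto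
  have finE: "finite E" and cE: "card E \<le> card B"
    using vs1.independent_span_bound[OF B(2) E(3,2)] by auto
  have "card B \<le> card E"
    using vs1.independent_span_bound[OF finE B(1)] E(4) vs1.span_superset by blast
  then have cE: "card E = card B" using cE by simp
  define D where "D = E - A"
  have finD: "finite D" "finite A" using finE E(1) finite_subset by (auto simp: D_def)
  have fD: "f v \<in> vs2.span C" if "v \<in> E" for v using that E(2) img by blast
  have le1: "card D \<le> card C"
  proof (rule vs2.family_card_le[where f = f and g = id])
    fix u i assume u: "(\<Sum>i\<in>D. s2 (u i) (f i)) = 0" and i: "i \<in> D"
    have "f (\<Sum>i\<in>D. s1 (u i) i) = 0" using u by (simp add: f.sum f.scale)
    moreover have "(\<Sum>i\<in>D. s1 (u i) i) \<in> vs1.span B"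
      using E(2) by (auto simp: D_def intro!: vs1.span_sum vs1.span_scale)
    ultimately have "(\<Sum>i\<in>D. s1 (u i) i) \<in> vs1.span A" by (simp add: spA P_def)
    then obtain w where w: "(\<Sum>i\<in>D. s1 (u i) i) = (\<Sum>i\<in>A. s1 (w i) i)"
      using vs1.span_finite[OF finD(2)] by auto
    \<comment> \<open>A relation among the images of \<open>D\<close> makes a combination of
      \<open>D\<close> equal to one of \<open>A\<close>; brought to one side it is a relation in the
      independent set \<open>E\<close>.\<close>
    define z where "z = (\<lambda>i. if i \<in> A then - w i else u i)"
    have "(\<Sum>i\<in>E. s1 (z i) i) = (\<Sum>i\<in>D. s1 (z i) i) + (\<Sum>i\<in>A. s1 (z i) i)"
      unfolding D_def by (rule sum.subset_diff[OF E(1) finE])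
    also have "(\<Sum>i\<in>D. s1 (z i) i) = (\<Sum>i\<in>D. s1 (u i) i)"
      by (intro sum.cong) (auto simp: z_def D_def)
    also have "(\<Sum>i\<in>A. s1 (z i) i) = - (\<Sum>i\<in>A. s1 (w i) i)"
      by (simp add: z_def sum_negf)
    finally have "(\<Sum>i\<in>E. s1 (z i) i) = 0" using w by simp
    then have "z i = 0" using vs1.independent_scalars_zero[OF E(3) finE] i by (auto simp: D_def)
    then show "u i = 0" using i by (auto simp: z_def D_def)
  qed (use finD C fD in \<open>auto simp: D_def\<close>)
  have "C \<subseteq> vs2.span (f ` D)"
  proof -
    have "vs2.span C = f ` vs1.span E"
      using img E(2,4) vs1.span_mono vs1.span_span by (metis subset_antisym)
    also have "\<dots> = vs2.span (f ` E)" by (rule f.span_image[symmetric])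
    also have "\<dots> \<subseteq> vs2.span (f ` D)"
    proof (rule vs2.span_minimal)
      show "f ` E \<subseteq> vs2.span (f ` D)"
        using A(1) by (auto simp: D_def P_def) (metis (mono_tags, lifting) Diff_iff image_eqI mem_Collect_eq subsetD vs2.span_base vs2.span_zero)
    qed simp
    finally show ?thesis using vs2.span_superset by blast
  qed
  then have "card C \<le> card (f ` D)"
    using vs2.independent_span_bound[of "f ` D" C] C finD by blast
  also have "\<dots> \<le> card D" using finD card_image_le by blast
  finally have "card D = card C" using le1 by simp
  moreover have "card E = card A + card D"
    unfolding D_def using E(1) finE by (simp add: card_Diff_subset finD card_mono)
  ultimately have "card A + card C = card B" using cE by simp
  then show ?thesis using that[of A] A finD spA by (simp add: P_def)
qed

section \<open>Polynomial vectors as a vector space over the coefficient field\<close>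

definition pscale :: "'a::field \<Rightarrow> (nat \<Rightarrow> 'a poly) \<Rightarrow> nat \<Rightarrow> 'a poly" where
  "pscale a x = (\<lambda>c. Polynomial.smult a (x c))"

lemma pscale_apply [simp]: "pscale a x c = Polynomial.smult a (x c)" by (simp add: pscale_def)

interpretation pvs: vector_space pscale
  by unfold_locales (auto simp: pscale_def fun_eq_iff smult_add_right smult_add_left)

interpretation pvs2: vector_space_pair pscale pscale ..

text \<open>Bounding the number \<open>K\<close> of coefficients instead of the degree makes \<open>K = 0\<close> the zero space and gives
  dimension \<open>q K\<close> in all cases.\<close>

definition pvecs :: "nat \<Rightarrow> nat \<Rightarrow> (nat \<Rightarrow> 'a::field poly) set" where
  "pvecs q K = {x. (\<forall>c\<ge>q. x c = 0) \<and> (\<forall>c. \<forall>i\<ge>K. Polynomial.coeff (x c) i = 0)}"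

text \<open>Vectors of every length share one type of functions on the naturals; setting the rows
  from m on to 0 puts products into \<open>pvecs\<close> for length m.\<close>

definition pmul :: "nat \<Rightarrow> nat \<Rightarrow> (nat \<Rightarrow> nat \<Rightarrow> 'a::field poly) \<Rightarrow> (nat \<Rightarrow> 'a poly) \<Rightarrow> nat \<Rightarrow> 'a poly" where
  "pmul m q M x = (\<lambda>r. if r < m then \<Sum>c<q. M r c * x c else 0)"

definition monvec :: "nat \<Rightarrow> nat \<Rightarrow> nat \<Rightarrow> 'a::field poly" where
  "monvec c i = (\<lambda>c'. if c' = c then Polynomial.monom 1 i else 0)"

lemma subspace_pvecs: "pvs.subspace (pvecs q K)"
  by (auto simp: pvs.subspace_def pvecs_def)

lemma pvecs_mono: "K \<le> L \<Longrightarrow> pvecs q K \<subseteq> pvecs q L"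
  by (auto simp: pvecs_def)

lemma monvec_pvecs: "c < q \<Longrightarrow> i < K \<Longrightarrow> monvec c i \<in> pvecs q K"
  by (auto simp: pvecs_def monvec_def)

lemma pvecs_expand:
  assumes "x \<in> pvecs q K"
  shows "x = (\<Sum>(c,i)\<in>{..<q}\<times>{..<K}. pscale (Polynomial.coeff (x c) i) (monvec c i))"
proof (rule ext, rule poly_eqI)
  fix c i
  have "Polynomial.coeff ((\<Sum>(c,i)\<in>{..<q}\<times>{..<K}. pscale (Polynomial.coeff (x c) i) (monvec c i)) c) i
    = (\<Sum>p\<in>{..<q}\<times>{..<K}. if p = (c,i) then Polynomial.coeff (x c) i else 0)"
    unfolding sum_fun_apply coeff_sum by (intro sum.cong) (auto simp: monvec_def split: if_splits)
  also have "\<dots> = (if c < q \<and> i < K then Polynomial.coeff (x c) i else 0)" by simp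
  also have "\<dots> = Polynomial.coeff (x c) i" using assms by (auto simp: pvecs_def)
  finally show "Polynomial.coeff (x c) i = Polynomial.coeff ((\<Sum>(c,i)\<in>{..<q}\<times>{..<K}. pscale (Polynomial.coeff (x c) i) (monvec c i)) c) i" ..
qed

lemma pvecs_basis:
  obtains B :: "(nat \<Rightarrow> 'a::field poly) set" where "finite B" "card B = q * K"
    "pvs.independent B" "pvs.span B = pvecs q K"
proof -
  let ?I = "{..<q}\<times>{..<K}"
  define f :: "nat \<times> nat \<Rightarrow> nat \<Rightarrow> 'a poly" where "f = (\<lambda>(c,i). monvec c i)"
  have inj: "inj_on f ?I"
    by (auto simp: inj_on_def f_def monvec_def fun_eq_iff monom_eq_iff' split: if_splits)
  have co: "Polynomial.coeff ((\<Sum>p\<in>?I. pscale (u p) (f p)) c) i = u (c, i)" if "c < q" "i < K" for u c i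
  proof -
    have "Polynomial.coeff ((\<Sum>p\<in>?I. pscale (u p) (f p)) c) i = (\<Sum>p\<in>?I. if p = (c,i) then u (c,i) else 0)"
      unfolding sum_fun_apply coeff_sum by (intro sum.cong) (auto simp: monvec_def f_def split: if_splits)
    then show ?thesis using that by simp
  qed
  have "pvs.independent (f ` ?I)"
  proof (rule pvs.independent_if_scalars_zero)
    fix u x assume s: "(\<Sum>x\<in>f ` ?I. pscale (u x) x) = 0" and x: "x \<in> f ` ?I"
    then have "(\<Sum>p\<in>?I. pscale (u (f p)) (f p)) = 0" by (simp add: sum.reindex[OF inj])
    then show "u x = 0" using x co[of _ _ "\<lambda>p. u (f p)"] by fastforce
  qed simp
  moreover have "pvs.span (f ` ?I) = pvecs q K"
  proof (rule antisym)
    show "pvs.span (f ` ?I) \<subseteq> pvecs q K"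
      by (rule pvs.span_minimal[OF _ subspace_pvecs]) (auto simp: f_def monvec_pvecs)
    show "pvecs q K \<subseteq> pvs.span (f ` ?I)"
    proof
      fix x :: "nat \<Rightarrow> 'a poly" assume "x \<in> pvecs q K"
      then have "x = (\<Sum>p\<in>?I. pscale (Polynomial.coeff (x (fst p)) (snd p)) (f p))"
        by (subst pvecs_expand) (auto simp: f_def case_prod_beta intro!: sum.cong)
      also have "\<dots> \<in> pvs.span (f ` ?I)" by (intro pvs.span_sum pvs.span_scale pvs.span_base) auto
      finally show "x \<in> pvs.span (f ` ?I)" .
    qed
  qed
  ultimately show ?thesis using that[of "f ` ?I"] by (simp add: card_image[OF inj])
qed

lemma smult_sum2: "Polynomial.smult a (\<Sum>i\<in>S. f i) = (\<Sum>i\<in>S. Polynomial.smult a (f i))"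
  by (induction S rule: infinite_finite_induct) (auto simp: smult_add_right)

lemma linear_pmul: "Vector_Spaces.linear pscale pscale (pmul m q M)"
  by unfold_locales
    (auto simp: pmul_def fun_eq_iff sum.distrib distrib_left smult_sum2 pscale_def smult_add_right smult_add_left)

definition shift :: "nat \<Rightarrow> (nat \<Rightarrow> 'a::field poly) \<Rightarrow> nat \<Rightarrow> 'a poly" where
  "shift j x = (\<lambda>c. Polynomial.monom 1 j * x c)"

lemma coeff_shift: "Polynomial.coeff (shift j x c) i = (if j \<le> i then Polynomial.coeff (x c) (i - j) else 0)"
  by (simp add: shift_def coeff_monom_mult)

lemma shift_pvecs: "x \<in> pvecs q K \<Longrightarrow> shift j x \<in> pvecs q (K + j)"
  unfolding pvecs_def by (auto simp: coeff_shift) (auto simp: shift_def)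

lemma shift_zero [simp]: "shift j 0 = 0"
  by (auto simp: shift_def fun_eq_iff)

lemma linear_shift: "Vector_Spaces.linear pscale pscale (shift j)"
  by unfold_locales (auto simp: shift_def fun_eq_iff distrib_left pscale_def smult_add_right smult_add_left)

lemma shift_eq_0_iff [simp]: "shift j x = 0 \<longleftrightarrow> x = 0"
  by (auto simp: shift_def fun_eq_iff monom_eq_0_iff)

lemma pmul_shift: "pmul m q M (shift j x) = shift j (pmul m q M x)"
  by (auto simp: pmul_def shift_def fun_eq_iff sum_distrib_left algebra_simps intro!: sum.cong)

lemma pmul_zero [simp]: "pmul m q M 0 = 0"
  by (auto simp: pmul_def fun_eq_iff)

lemma pmul_add: "pmul m q M (x + y) = pmul m q M x + pmul m q M y"
  by (auto simp: pmul_def fun_eq_iff distrib_left sum.distrib)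

lemma pmul_diff: "pmul m q M (x - y) = pmul m q M x - pmul m q M y"
  by (auto simp: pmul_def fun_eq_iff right_diff_distrib sum_subtractf)

lemma coeff_mult_top:
  fixes p x :: "'a::comm_semiring_0 poly"
  assumes "\<And>i. i > d \<Longrightarrow> Polynomial.coeff p i = 0" "\<And>i. i > K \<Longrightarrow> Polynomial.coeff x i = 0"
  shows "Polynomial.coeff (p * x) (d + K) = Polynomial.coeff p d * Polynomial.coeff x K"
    and "i > d + K \<Longrightarrow> Polynomial.coeff (p * x) i = 0"
proof -
  have "Polynomial.coeff (p * x) (d + K) = (\<Sum>i\<le>d + K. if i = d then Polynomial.coeff p d * Polynomial.coeff x K else 0)"
    unfolding coeff_mult
  proof (intro sum.cong refl)
    fix i assume "i \<in> {..d + K}"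
    then show "Polynomial.coeff p i * Polynomial.coeff x (d + K - i) = (if i = d then Polynomial.coeff p d * Polynomial.coeff x K else 0)"
      using assms(1)[of i] assms(2)[of "d + K - i"] by (cases "i < d"; cases "i = d") auto
  qed
  then show "Polynomial.coeff (p * x) (d + K) = Polynomial.coeff p d * Polynomial.coeff x K" by simp
  show "Polynomial.coeff (p * x) i = 0" if "i > d + K"
    unfolding coeff_mult
  proof (intro sum.neutral ballI)
    fix j assume "j \<in> {..i}"
    then show "Polynomial.coeff p j * Polynomial.coeff x (i - j) = 0"
      using assms(1)[of j] assms(2)[of "i - j"] that by (cases "j > d") auto
  qed
qed

lemma pmul_pvecs:
  assumes M: "\<And>r c. r < m \<Longrightarrow> c < q \<Longrightarrow> Polynomial.degree (M r c) \<le> d" and x: "x \<in> pvecs q K"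
  shows "pmul m q M x \<in> pvecs m (d + K)"
\<comment> \<open>The degree bound K - 1 makes sense only for K > 0; for K = 0 the vector is
  0.\<close>
proof (cases K)
  case 0
  then have "x = 0" using x by (auto simp: pvecs_def fun_eq_iff poly_eq_iff)
  then show ?thesis by (simp add: pvs.subspace_0 subspace_pvecs)
next
  case (Suc K')
  have "Polynomial.coeff (M r c * x c) i = 0" if "r < m" "c < q" "i \<ge> d + K" for r c i
    by (rule coeff_mult_top(2)[where d = d and K = K'])
      (use M[of r c] x that Suc in \<open>auto simp: pvecs_def intro!: coeff_eq_0\<close>)
  then show ?thesis by (auto simp: pvecs_def pmul_def coeff_sum)
qed

section \<open>Matrices with surjective and injective multiplication maps\<close>

definition surjective_mult :: "nat \<Rightarrow> nat \<Rightarrow> nat \<Rightarrow> (nat \<Rightarrow> nat \<Rightarrow> 'a::field poly) \<Rightarrow> nat \<Rightarrow> bool" where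
  "surjective_mult m q d M K \<longleftrightarrow> (\<forall>y\<in>pvecs m (d + K). \<exists>x\<in>pvecs q K. pmul m q M x = y)"

definition injective_mult :: "nat \<Rightarrow> nat \<Rightarrow> (nat \<Rightarrow> nat \<Rightarrow> 'a::field poly) \<Rightarrow> nat \<Rightarrow> bool" where
  "injective_mult m q M K \<longleftrightarrow> (\<forall>x\<in>pvecs q K. pmul m q M x = 0 \<longrightarrow> x = 0)"

text \<open>Together with \<open>tn\<close>, the equation \<open>nk\<close> says without division
  that k is the ceiling of m d / n and t the excess.\<close>

locale balanced =
  fixes M :: "nat \<Rightarrow> nat \<Rightarrow> 'a::field poly" and m n d k t :: nat
  assumes degM: "\<And>r c. r < m \<Longrightarrow> c < m + n \<Longrightarrow> Polynomial.degree (M r c) \<le> d"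
    and m0: "0 < m" and k0: "0 < k" and tn: "t < n" and nk: "n * k = m * d + t"
    and surj: "surjective_mult m (m + n) d M k"
    and inj: "injective_mult m (m + n) M (k - 1)"
begin

abbreviation "q \<equiv> m + n"
abbreviation "F \<equiv> pmul m q M"

text \<open>Split the target as its constant term plus \<lambda> times the rest. Both parts fit into
  d + k coefficients, the constant one since k > 0, and a preimage of the rest is shifted by
  one.\<close>

lemma surj_Suc: "surjective_mult m q d M (Suc k)"
  unfolding surjective_mult_def
proof
  fix y :: "nat \<Rightarrow> 'a poly" assume y: "y \<in> pvecs m (d + Suc k)"
  define y1 where "y1 = (\<lambda>r. poly_shift 1 (y r))"
  define y0 where "y0 = (\<lambda>r. [:Polynomial.coeff (y r) 0:])"
  have y01: "y = y0 + shift 1 y1"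
  proof (rule ext, rule poly_eqI)
    fix r i show "Polynomial.coeff (y r) i = Polynomial.coeff ((y0 + shift 1 y1) r) i"
      by (cases i) (simp_all add: y0_def y1_def coeff_shift coeff_poly_shift)
  qed
  have "Polynomial.coeff (y0 r) i = 0" if "i \<ge> d + k" for r i
    using that k0 by (cases i) (simp_all add: y0_def)
  moreover have "y0 r = 0" "y1 r = 0" if "r \<ge> m" for r
  proof -
    have "y r = 0" using that y by (simp add: pvecs_def)
    then show "y0 r = 0" "y1 r = 0" by (simp_all add: y0_def y1_def)
  qed
  moreover have "Polynomial.coeff (y1 r) i = 0" if "i \<ge> d + k" for r i
    using that y by (simp add: y1_def coeff_poly_shift pvecs_def)
  ultimately have "y1 \<in> pvecs m (d + k)" "y0 \<in> pvecs m (d + k)"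
    by (simp_all add: pvecs_def)
  then obtain x0 x1 where x: "x0 \<in> pvecs q k" "F x0 = y0" "x1 \<in> pvecs q k" "F x1 = y1"
    using surj unfolding surjective_mult_def by metis
  have "x0 + shift 1 x1 \<in> pvecs q (Suc k)"
    using shift_pvecs[OF x(3), of 1] pvecs_mono[of k "Suc k" q] x(1)
    by (auto intro!: pvs.subspace_add[OF subspace_pvecs])
  moreover have "F (x0 + shift 1 x1) = y" using x y01 by (simp add: pmul_add pmul_shift)
  ultimately show "\<exists>x\<in>pvecs q (Suc k). F x = y" by blast
qed

lemma image_pvecs: "surjective_mult m q d M K \<Longrightarrow> F ` pvecs q K = pvecs m (d + K)"
proof (intro equalityI subsetI)
  fix y :: "nat \<Rightarrow> 'a poly" assume "surjective_mult m q d M K" "y \<in> pvecs m (d + K)"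
  then obtain x where "x \<in> pvecs q K" "F x = y" unfolding surjective_mult_def by blast
  then show "y \<in> F ` pvecs q K" by (simp only: image_iff) blast
next
  fix y assume "y \<in> F ` pvecs q K"
  then show "y \<in> pvecs m (d + K)" using pmul_pvecs[OF degM] by (force simp only: image_iff)
qed

lemma kernel_basis:
  assumes "surjective_mult m q d M K"
  obtains A where "finite A" "pvs.independent A" "card A + m * (d + K) = q * K"
    "pvs.span A = {x \<in> pvecs q K. F x = 0}"
proof -
  obtain B :: "(nat \<Rightarrow> 'a poly) set" where B: "finite B" "card B = q * K" "pvs.independent B" "pvs.span B = pvecs q K"
    using pvecs_basis .
  obtain C :: "(nat \<Rightarrow> 'a poly) set" where C: "finite C" "card C = m * (d + K)" "pvs.independent C" "pvs.span C = pvecs m (d + K)"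
    using pvecs_basis .
  have "F ` pvs.span B = pvs.span C" using image_pvecs[OF assms] B(4) C(4) by simp
  from pvs2.kernel_basis_exists[OF linear_pmul B(3,1) C(3,1) this] obtain A where
    "finite A" "pvs.independent A" "card A + card C = card B" "pvs.span A = {x \<in> pvs.span B. F x = 0}" .
  then show ?thesis using that B C by simp
qed

text \<open>The leading coefficient of any kernel vector lies in the kernel of the coefficient \<open>M\<^sub>d\<close>, and
  surjectivity lifts it back to a kernel vector with \<open>k + 1\<close> coefficients.\<close>

lemma lift_leading:
  assumes x: "x \<in> pvecs q (Suc K)" "F x = 0"
  obtains w where "w \<in> pvecs q (Suc k)" "F w = 0"
    "\<And>c. Polynomial.coeff (w c) k = Polynomial.coeff (x c) K"
proof -
  define z where "z = (\<lambda>c. Polynomial.monom (Polynomial.coeff (x c) K) k)"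
  have z: "z \<in> pvecs q (Suc k)" using x by (auto simp: z_def pvecs_def)
  have "(\<Sum>c<q. Polynomial.coeff (M r c) d * Polynomial.coeff (x c) K) = 0" if r: "r < m" for r
  proof -
    have "(\<Sum>c<q. Polynomial.coeff (M r c) d * Polynomial.coeff (x c) K)
      = (\<Sum>c<q. Polynomial.coeff (M r c * x c) (d + K))"
      by (intro sum.cong refl coeff_mult_top(1)[symmetric])
        (use x degM[OF r] in \<open>auto simp: pvecs_def Suc_le_eq intro: coeff_eq_0 le_less_trans\<close>)
    also have "\<dots> = Polynomial.coeff (F x r) (d + K)" using r by (simp add: pmul_def coeff_sum)
    finally show ?thesis using x by simp
  qed
  then have "Polynomial.coeff (F z r) (d + k) = 0" if "r < m" for r
    using that by (simp add: pmul_def coeff_sum z_def mult.commute[of _ "Polynomial.monom _ _"] coeff_monom_mult mult.commute[of "Polynomial.coeff (x _) K"])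
  moreover have "F z \<in> pvecs m (d + Suc k)" by (rule pmul_pvecs[OF degM z])
  ultimately have "F z \<in> pvecs m (d + k)"
    unfolding pvecs_def mem_Collect_eq
  proof (intro conjI allI impI)
    fix r i assume *: "(\<forall>c\<ge>m. F z c = 0) \<and> (\<forall>c i. d + Suc k \<le> i \<longrightarrow> Polynomial.coeff (F z c) i = 0)"
      "\<And>r. r < m \<Longrightarrow> Polynomial.coeff (F z r) (d + k) = 0"
    show "F z r = 0" if "m \<le> r" using * that by blast
    assume "d + k \<le> i"
    then show "Polynomial.coeff (F z r) i = 0" using *
      by (cases "i = d + k"; cases "r < m") (auto simp: not_less)
  qed
  \<comment> \<open>\<open>u\<close> has only k coefficients, so subtracting it from
    \<open>z\<close> does not disturb the coefficient at k.\<close>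
  then obtain u where u: "u \<in> pvecs q k" "F u = F z" using surj by (auto simp: surjective_mult_def)
  show ?thesis
  proof (rule that[of "z - u"])
    show "z - u \<in> pvecs q (Suc k)"
      using z u pvecs_mono[of k "Suc k" q] by (auto intro!: pvs.subspace_diff[OF subspace_pvecs])
    show "F (z - u) = 0" using u by (simp add: pmul_diff)
    show "Polynomial.coeff ((z - u) c) k = Polynomial.coeff (x c) K" for c
      using u by (simp add: z_def pvecs_def)
  qed
qed

text \<open>The kernel has dimension t in \<open>pvecs q k\<close> and t + n in
  \<open>pvecs q (Suc k)\<close>. A basis \<open>A\<close> of the first and its shift account for 2
  t of the t + n dimensions, so n - t further vectors \<open>C\<close> complete the basis, and
  \<open>A\<close> with \<open>C\<close> gives n generators.\<close>

lemma kernel_module_basis: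
  obtains N :: "nat \<Rightarrow> nat \<Rightarrow> 'a poly" where
    "\<And>j. j < n \<Longrightarrow> N j \<in> pvecs q (Suc k)" "\<And>j. j < n \<Longrightarrow> F (N j) = 0"
    "\<And>j. j < t \<Longrightarrow> N j \<in> pvecs q k"
    "{x \<in> pvecs q k. F x = 0} \<subseteq> pvs.span (N ` {..<t})"
    "\<And>x K. x \<in> pvecs q K \<Longrightarrow> F x = 0 \<Longrightarrow> \<exists>p. \<forall>c. x c = (\<Sum>j<n. p j * N j c)"
proof -
  interpret sh: Vector_Spaces.linear pscale pscale "shift 1 :: (nat \<Rightarrow> 'a poly) \<Rightarrow> _" by (rule linear_shift)
  obtain A where A: "finite A" "pvs.independent A" "card A + m * (d + k) = q * k"
    "pvs.span A = {x \<in> pvecs q k. F x = 0}" using kernel_basis[OF surj] .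
  have cA: "card A = t" using A(3) nk by (simp add: algebra_simps)
  obtain A' where A': "finite A'" "pvs.independent A'" "card A' + m * (d + Suc k) = q * Suc k"
    "pvs.span A' = {x \<in> pvecs q (Suc k). F x = 0}" using kernel_basis[OF surj_Suc] .
  have cA': "card A' = t + n" using A'(3) nk by (simp add: algebra_simps)
  have inj1: "inj_on (shift 1) A"
    using sh.inj_iff_eq_0 by (meson inj_on_subset shift_eq_0_iff subset_UNIV)
  \<comment> \<open>If \<open>u\<close> and its shift both have at most k coefficients, then
    \<open>u\<close> has at most k - 1 and injectivity makes it 0. This keeps the span of
    \<open>A\<close> apart from its shift.\<close>
  have zero: "u = 0" if "u \<in> pvs.span A" "shift 1 u \<in> pvs.span A" for u
  proof -
    have "u \<in> pvecs q (k - 1)"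
      unfolding pvecs_def
    proof (safe)
      fix c i show "c \<ge> q \<Longrightarrow> u c = 0" using that A by (simp add: pvecs_def)
      assume "k - 1 \<le> i"
      then have "Polynomial.coeff (shift 1 u c) (Suc i) = 0" using that A by (simp add: pvecs_def)
      then show "Polynomial.coeff (u c) i = 0" by (simp add: coeff_shift)
    qed
    then show ?thesis using inj that(1) A(4) by (simp add: injective_mult_def)
  qed
  have disj: "A \<inter> shift 1 ` A = {}"
  proof (rule ccontr)
    assume "A \<inter> shift 1 ` A \<noteq> {}"
    then obtain a where a: "a \<in> A" "shift 1 a \<in> A" by auto
    then have "a = 0" using zero pvs.span_base by blast
    then show False using A(2) a(1) pvs.dependent_zero by blast
  qed
  have ind: "pvs.independent (A \<union> shift 1 ` A)"
  proof (rule pvs.independent_if_scalars_zero)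
    fix f x assume s: "(\<Sum>x\<in>A \<union> shift 1 ` A. pscale (f x) x) = 0" and x: "x \<in> A \<union> shift 1 ` A"
    define u where "u = (\<Sum>x\<in>A. pscale (f x) x)"
    define v where "v = (\<Sum>x\<in>A. pscale (f (shift 1 x)) x)"
    have uv: "u \<in> pvs.span A" "v \<in> pvs.span A"
      unfolding u_def v_def by (intro pvs.span_sum pvs.span_scale pvs.span_base; assumption)+
    have "(\<Sum>x\<in>A \<union> shift 1 ` A. pscale (f x) x) = u + (\<Sum>x\<in>shift 1 ` A. pscale (f x) x)"
      unfolding u_def by (rule sum.union_disjoint) (use A disj in auto)
    also have "(\<Sum>x\<in>shift 1 ` A. pscale (f x) x) = shift 1 v"
      unfolding v_def by (subst sum.reindex[OF inj1]) (simp add: sh.sum sh.scale del: One_nat_def)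
    finally have e: "u + shift 1 v = 0" unfolding s by (rule sym)
    then have "shift 1 v = - u" by (simp add: eq_neg_iff_add_eq_0 add.commute)
    then have "shift 1 v \<in> pvs.span A" using uv pvs.span_neg by metis
    then have "v = 0" using zero uv by blast
    with e have "u = 0" by simp
    have "f a = 0" if "a \<in> A" for a
      using pvs.independent_scalars_zero[OF A(2,1)] \<open>u = 0\<close> that unfolding u_def by blast
    moreover have "f (shift 1 a) = 0" if "a \<in> A" for a
      using pvs.independent_scalars_zero[OF A(2,1), of "\<lambda>a. f (shift 1 a)"] \<open>v = 0\<close> that unfolding v_def by blast
    ultimately show "f x = 0" using x by auto
  qed (use A in auto)
  have sub: "A \<union> shift 1 ` A \<subseteq> pvs.span A'"
  proof -
    have "a \<in> pvecs q k" "F a = 0" if "a \<in> A" for a using A(4) pvs.span_base[OF that] by auto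
    then show ?thesis unfolding A'(4) using pvecs_mono[of k "Suc k" q] shift_pvecs[of _ q k 1]
      by (auto simp: pmul_shift)
  qed
  obtain E where E: "A \<union> shift 1 ` A \<subseteq> E" "E \<subseteq> pvs.span A'" "pvs.independent E" "pvs.span A' \<subseteq> pvs.span E"
    using pvs.maximal_independent_subset_extend[OF sub ind] .
  have finE: "finite E" and "card E \<le> card A'"
    using pvs.independent_span_bound[OF A'(1) E(3,2)] by auto
  moreover have "card A' \<le> card E"
    using pvs.independent_span_bound[OF finE A'(2)] E(4) pvs.span_superset by blast
  ultimately have cE: "card E = t + n" using cA' by simp
  define C where "C = E - (A \<union> shift 1 ` A)"
  have "card (A \<union> shift 1 ` A) = t + t"
    using A disj by (simp add: card_Un_disjoint card_image[OF inj1] cA del: One_nat_def)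
  then have cC: "card C = n - t"
    unfolding C_def using E(1) finE finite_subset[OF E(1) finE] by (simp add: card_Diff_subset cE del: One_nat_def)
  have finC: "finite C" using finE by (simp add: C_def)
  \<comment> \<open>\<open>A\<close> is listed before \<open>C\<close>, so that the indices below t
    carry the vectors with only k coefficients.\<close>
  obtain xs where xs: "set xs = A" "distinct xs" "length xs = t"
    using finite_distinct_list[OF A(1)] cA distinct_card by metis
  obtain ys where ys: "set ys = C" "distinct ys" "length ys = n - t"
    using finite_distinct_list[OF finC] cC distinct_card by metis
  define N where "N j = (xs @ ys) ! j" for j
  have NA: "N j \<in> A" if "j < t" for j using that xs by (auto simp: N_def nth_append)
  have NC: "N j \<in> A \<union> C" if "j < n" for j using that xs ys
    by (metis N_def Un_iff length_append nth_mem set_append le_add_diff_inverse less_imp_le tn)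
  have imA: "N ` {..<t} = A" using xs by (auto simp: N_def nth_append in_set_conv_nth image_iff)
  have imAC: "A \<union> C \<subseteq> N ` {..<n}"
  proof
    fix a assume "a \<in> A \<union> C"
    then have "a \<in> set (xs @ ys)" using xs ys by simp
    then show "a \<in> N ` {..<n}" unfolding in_set_conv_nth N_def using xs ys tn by force
  qed
  define G where "G p = (\<lambda>c. \<Sum>j<n. p j * N j c)" for p
  \<comment> \<open>The module generated over the polynomials. Closed under shifts, it contains the
    shifted part of \<open>E\<close> although those vectors are not among the generators.\<close>
  define Z where "Z = range G"
  have Zadd: "x + y \<in> Z" if xyZ: "x \<in> Z" "y \<in> Z" for x y
  proof -
    obtain p p' where xy: "x = G p" "y = G p'" using xyZ unfolding Z_def by (elim rangeE)
    have "x + y = G (\<lambda>j. p j + p' j)"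
      by (simp add: xy G_def fun_eq_iff distrib_right sum.distrib)
    then show ?thesis unfolding Z_def by (simp only: rangeI)
  qed
  have Zmul: "(\<lambda>c. r * x c) \<in> Z" if x: "x \<in> Z" for x r
  proof -
    obtain p where x: "x = G p" using x unfolding Z_def by (rule rangeE)
    have "(\<lambda>c. r * x c) = G (\<lambda>j. r * p j)"
      by (simp add: x G_def fun_eq_iff sum_distrib_left mult.assoc)
    then show ?thesis unfolding Z_def by (simp only: rangeI)
  qed
  have Zshift: "shift i x \<in> Z" if "x \<in> Z" for x i using Zmul[OF that] by (simp add: shift_def)
  have Zsub: "pvs.subspace Z"
  proof -
    have "G (\<lambda>_. 0) = 0" by (simp add: G_def fun_eq_iff)
    moreover have "G (\<lambda>_. 0) \<in> Z" unfolding Z_def by (rule rangeI)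
    ultimately have "0 \<in> Z" by (simp only:)
    moreover have "pscale a x \<in> Z" if "x \<in> Z" for a x
      using Zmul[OF that, of "[:a:]"] by (simp add: pscale_def)
    ultimately show ?thesis using Zadd by (simp add: pvs.subspace_def)
  qed
  have NZ: "N j \<in> Z" if "j < n" for j
  proof -
    have "N j = G (\<lambda>i. if i = j then 1 else 0)"
      using that by (simp add: G_def fun_eq_iff if_distrib[of "\<lambda>x. x * _"] cong: if_cong)
    then show ?thesis unfolding Z_def by (simp only: rangeI)
  qed
  have "E \<subseteq> Z"
  proof -
    have "A \<union> C \<subseteq> Z" using imAC NZ by auto
    then have "A \<subseteq> Z" "C \<subseteq> Z" "shift 1 ` A \<subseteq> Z" using Zshift by blast+
    then show ?thesis unfolding C_def by blast
  qed
  then have kZ: "pvs.span A' \<subseteq> Z" using E(4) pvs.span_minimal[OF _ Zsub] by blast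
  have kerZ: "x \<in> Z" if "x \<in> pvecs q K" "F x = 0" "K \<le> Suc k" for x K
  proof -
    have "x \<in> pvs.span A'" unfolding A'(4) using that pvecs_mono[of K "Suc k" q] by blast
    then show ?thesis using kZ by blast
  qed
  have Zall: "x \<in> pvecs q K \<Longrightarrow> F x = 0 \<Longrightarrow> x \<in> Z" for x K
  proof (induction K arbitrary: x)
    case 0
    then show ?case using kerZ le0 by blast
  next
    case (Suc K)
    show ?case
    proof (cases "Suc K \<le> Suc k")
      case True
      then show ?thesis using kerZ Suc.prems by blast
    next
      case False
      obtain w where w: "w \<in> pvecs q (Suc k)" "F w = 0"
        "\<And>c. Polynomial.coeff (w c) k = Polynomial.coeff (x c) K" using lift_leading[OF Suc.prems] by blast
      have wZ: "w \<in> Z" using w kerZ by blast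
      have s: "shift (K - k) w \<in> pvecs q (Suc K)" using shift_pvecs[OF w(1), of "K - k"] False by simp
      \<comment> \<open>The shifted \<open>w\<close> agrees with \<open>x\<close> in coefficient K,
        so the difference has one coefficient less and induction applies.\<close>
      define x' where "x' = x - shift (K - k) w"
      have "x' \<in> pvecs q (Suc K)" unfolding x'_def
        by (rule pvs.subspace_diff[OF subspace_pvecs Suc.prems(1) s])
      moreover have "Polynomial.coeff (x' c) K = 0" for c
        using False w(3)[of c] by (simp add: x'_def coeff_shift)
      ultimately have "x' \<in> pvecs q K" unfolding pvecs_def mem_Collect_eq
        by (metis le_antisym not_less_eq_eq)
      moreover have "F x' = 0" using w(2) Suc.prems(2) by (simp only: x'_def pmul_diff pmul_shift shift_zero diff_self)
      ultimately have "x' \<in> Z" by (rule Suc.IH)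
      moreover have "x = x' + shift (K - k) w" by (simp add: x'_def)
      ultimately show ?thesis using Zadd[OF _ Zshift[OF wZ]] by metis
    qed
  qed
  show ?thesis
  proof (rule that[of N])
    show "N j \<in> pvecs q (Suc k)" "F (N j) = 0" if "j < n" for j
    proof -
      have "N j \<in> E" using NC[OF that] E(1) by (auto simp: C_def)
      then show "N j \<in> pvecs q (Suc k)" "F (N j) = 0" using E(2) A'(4) by blast+
    qed
    show "N j \<in> pvecs q k" if "j < t" for j using pvs.span_base[OF NA[OF that]] A(4) by blast
    show "{x \<in> pvecs q k. F x = 0} \<subseteq> pvs.span (N ` {..<t})" using imA A(4) by simp
    show "\<exists>p. \<forall>c. x c = (\<Sum>j<n. p j * N j c)" if xK: "x \<in> pvecs q K" "F x = 0" for x K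
    proof -
      obtain p where "x = G p" using Zall[OF xK] unfolding Z_def by (rule rangeE)
      then show ?thesis by (intro exI[of _ p]) (simp add: G_def)
    qed
  qed
qed

end

section \<open>Polynomial bases in coordinates\<close>

text \<open>If \<open>x\<close> were outside the span of \<open>f\<close>, adding it under the index
  \<open>None\<close> would keep the family independent and make it larger than the generating
  family \<open>g\<close>.\<close>

lemma (in vector_space) family_span_eq:
  assumes "finite I" "finite J" "card J \<le> card I"
    and indep: "\<And>a i. (\<Sum>i\<in>I. a i *s f i) = 0 \<Longrightarrow> i \<in> I \<Longrightarrow> a i = 0"
    and sp: "\<And>i. i \<in> I \<Longrightarrow> f i \<in> span (g ` J)" and x: "x \<in> span (g ` J)"
  shows "x \<in> span (f ` I)"
proof (rule ccontr)
  assume nx: "x \<notin> span (f ` I)"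
  have "card (insert None (Some ` I)) \<le> card J"
  proof (rule family_card_le[where f = "\<lambda>i. case i of None \<Rightarrow> x | Some i \<Rightarrow> f i" and g = g])
    fix a i assume s: "(\<Sum>i\<in>insert None (Some ` I). a i *s (case i of None \<Rightarrow> x | Some i \<Rightarrow> f i)) = 0"
      and i: "i \<in> insert None (Some ` I)"
    have e: "a None *s x + (\<Sum>i\<in>I. a (Some i) *s f i) = 0"
      using s assms(1) by (subst (asm) sum.insert) (auto simp: sum.reindex)
    have "a None = 0"
    proof (rule ccontr)
      assume n0: "a None \<noteq> 0"
      have "a None *s x = - (\<Sum>i\<in>I. a (Some i) *s f i)" using e by (simp add: eq_neg_iff_add_eq_0)
      also have "\<dots> \<in> span (f ` I)" by (intro span_neg span_sum span_scale span_base) auto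
      finally have "inverse (a None) *s (a None *s x) \<in> span (f ` I)" by (rule span_scale)
      then show False using n0 nx by simp
    qed
    moreover have "a (Some i) = 0" if "i \<in> I" for i
      by (rule indep[of "\<lambda>i. a (Some i)", OF _ that]) (use e \<open>a None = 0\<close> in simp)
    ultimately show "a i = 0" using i by auto
  next
    fix i assume "i \<in> insert None (Some ` I)"
    then show "(case i of None \<Rightarrow> x | Some i \<Rightarrow> f i) \<in> span (g ` J)" using sp x by auto
  qed (use assms(1,2) in auto)
  then show False using assms(1,3) by (simp add: card_image)
qed

definition fscale :: "'a::field \<Rightarrow> (nat \<Rightarrow> 'a) \<Rightarrow> nat \<Rightarrow> 'a" where
  "fscale a x = (\<lambda>i. a * x i)"

lemma fscale_apply [simp]: "fscale a x i = a * x i" by (simp add: fscale_def)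

interpretation fvs: vector_space fscale
  by unfold_locales (auto simp: fscale_def fun_eq_iff distrib_left distrib_right)

definition independent_family :: "nat \<Rightarrow> nat \<Rightarrow> (nat \<Rightarrow> nat \<Rightarrow> 'a::field) \<Rightarrow> bool" where
  "independent_family q l u \<longleftrightarrow> (\<forall>a. (\<forall>i<q. (\<Sum>j<l. a j * u j i) = 0) \<longrightarrow> (\<forall>j<l. a j = 0))"

definition combination :: "nat \<Rightarrow> nat \<Rightarrow> (nat \<Rightarrow> nat \<Rightarrow> 'a::field) \<Rightarrow> (nat \<Rightarrow> 'a) \<Rightarrow> bool" where
  "combination q l u x \<longleftrightarrow> (\<exists>a. \<forall>i<q. x i = (\<Sum>j<l. a j * u j i))"

text \<open>\<open>independent_family\<close> and \<open>combination\<close> look at the first q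
  coordinates only; with the others set to 0 their statements become statements about vectors, to
  which the exchange lemmas apply.\<close>

definition truncate :: "nat \<Rightarrow> (nat \<Rightarrow> 'a::field) \<Rightarrow> nat \<Rightarrow> 'a" where
  "truncate q x = (\<lambda>i. if i < q then x i else 0)"

lemma independent_family_truncate:
  assumes "independent_family q l u" "(\<Sum>j<l. fscale (a j) (truncate q (u j))) = 0" "j < l"
  shows "a j = 0"
proof -
  have "(\<Sum>j<l. a j * u j i) = 0" if "i < q" for i
    using fun_cong[OF assms(2), of i] that by (simp add: sum_fun_apply truncate_def)
  then show ?thesis using assms(1,3) unfolding independent_family_def by blast
qed

lemma combination_truncate:
  "combination q l u x \<longleftrightarrow> truncate q x \<in> fvs.span ((\<lambda>j. truncate q (u j)) ` {..<l})"
proof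
  assume "combination q l u x"
  then obtain a where a: "\<forall>i<q. x i = (\<Sum>j<l. a j * u j i)" unfolding combination_def by (elim exE)
  have "truncate q x = (\<Sum>j<l. fscale (a j) (truncate q (u j)))"
    using a by (simp add: fun_eq_iff sum_fun_apply truncate_def)
  also have "\<dots> \<in> fvs.span ((\<lambda>j. truncate q (u j)) ` {..<l})"
    by (intro fvs.span_sum fvs.span_scale fvs.span_base) auto
  finally show "truncate q x \<in> fvs.span ((\<lambda>j. truncate q (u j)) ` {..<l})" .
next
  let ?C = "{y. combination q l u y}"
  have sub: "fvs.subspace ?C"
  proof -
    have "combination q l u 0"
      unfolding combination_def by (rule exI[of _ "\<lambda>_. 0"]) simp
    moreover have "combination q l u (x + y)" if xy: "combination q l u x" "combination q l u y" for x y
    proof -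
      obtain a where a: "\<forall>i<q. x i = (\<Sum>j<l. a j * u j i)" using xy(1) unfolding combination_def by (elim exE)
      obtain b where b: "\<forall>i<q. y i = (\<Sum>j<l. b j * u j i)" using xy(2) unfolding combination_def by (elim exE)
      show ?thesis unfolding combination_def
        by (rule exI[of _ "\<lambda>j. a j + b j"]) (simp add: a b distrib_right sum.distrib)
    qed
    moreover have "combination q l u (fscale c x)" if x: "combination q l u x" for c x
    proof -
      obtain a where a: "\<forall>i<q. x i = (\<Sum>j<l. a j * u j i)" using x unfolding combination_def by (elim exE)
      show ?thesis unfolding combination_def
        by (rule exI[of _ "\<lambda>j. c * a j"]) (simp add: a sum_distrib_left mult.assoc)
    qed
    ultimately show ?thesis unfolding fvs.subspace_def mem_Collect_eq by blast
  qed
  have "truncate q (u j) \<in> ?C" if "j < l" for j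
    unfolding mem_Collect_eq combination_def
    by (rule exI[of _ "\<lambda>i. if i = j then 1 else 0"])
      (use that in \<open>simp add: truncate_def if_distrib[of "\<lambda>x. x * _"] cong: if_cong\<close>)
  then have "fvs.span ((\<lambda>j. truncate q (u j)) ` {..<l}) \<subseteq> ?C"
    by (intro fvs.span_minimal[OF _ sub]) auto
  moreover assume "truncate q x \<in> fvs.span ((\<lambda>j. truncate q (u j)) ` {..<l})"
  ultimately have "combination q l u (truncate q x)" by blast
  then show "combination q l u x" by (simp add: combination_def truncate_def)
qed

lemma independent_family_le:
  assumes "independent_family q l u" "\<And>j. j < l \<Longrightarrow> combination q l' u' (u j)"
  shows "l \<le> l'"
proof -
  have "card {..<l} \<le> card {..<l'}"
  proof (rule fvs.family_card_le[where f = "\<lambda>j. truncate q (u j)" and g = "\<lambda>j. truncate q (u' j)"])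
    show "a j = 0" if "(\<Sum>j<l. fscale (a j) (truncate q (u j))) = 0" "j \<in> {..<l}" for a j
      using independent_family_truncate[OF assms(1) that(1)] that(2) by simp
    show "truncate q (u j) \<in> fvs.span ((\<lambda>j. truncate q (u' j)) ` {..<l'})" if "j \<in> {..<l}" for j
      using assms(2)[of j] that unfolding combination_truncate by simp
  qed simp_all
  then show ?thesis by simp
qed

lemma independent_family_spans:
  assumes "independent_family q l u" "\<And>j. j < l \<Longrightarrow> combination q l u' (u j)" "combination q l u' x"
  shows "combination q l u x"
  unfolding combination_truncate
proof (rule fvs.family_span_eq[where g = "\<lambda>j. truncate q (u' j)" and J = "{..<l}"])
  show "a j = 0" if "(\<Sum>j<l. fscale (a j) (truncate q (u j))) = 0" "j \<in> {..<l}" for a j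
    using independent_family_truncate[OF assms(1) that(1)] that(2) by simp
  show "truncate q (u j) \<in> fvs.span ((\<lambda>j. truncate q (u' j)) ` {..<l})" if "j \<in> {..<l}" for j
    using assms(2)[of j] that unfolding combination_truncate by simp
  show "truncate q x \<in> fvs.span ((\<lambda>j. truncate q (u' j)) ` {..<l})"
    using assms(3) unfolding combination_truncate .
qed simp_all

context vec_space
begin

lemma span_family:
  assumes u: "\<And>j. j < l \<Longrightarrow> u j \<in> carrier_vec n"
  shows "span (u ` {..<l}) = {v \<in> carrier_vec n. combination n l (\<lambda>j i. u j $ i) (\<lambda>i. v $ i)}"
proof (intro equalityI subsetI)
  have U: "u ` {..<l} \<subseteq> carrier_vec n" using u by auto
  {
    fix v assume "v \<in> span (u ` {..<l})"
    then obtain a where v: "v = lincomb a (u ` {..<l})" using finite_span[OF _ U] by auto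
    \<comment> \<open>\<open>lincomb\<close> sums over a set, so each vector's coefficient is given
      to its first index and repetitions receive 0.\<close>
    define b where "b j = (if \<exists>j'<j. u j' = u j then 0 else a (u j))" for j
    have "(\<Sum>x\<in>u ` {..<l}. a x * x $ i) = (\<Sum>j<l. b j * u j $ i)" for i
    proof (induction l)
      case (Suc l)
      show ?case
      proof (cases "u l \<in> u ` {..<l}")
        case True
        then have "u ` {..<Suc l} = u ` {..<l}" "b l = 0" by (auto simp: lessThan_Suc b_def)
        then show ?thesis using Suc by simp
      next
        case False
        then have "\<not> (\<exists>j'<l. u j' = u l)" by (metis imageI lessThan_iff)
        then have "b l = a (u l)" unfolding b_def by (rule if_not_P)
        then show ?thesis using Suc False by (simp add: lessThan_Suc)
      qed
    qed simp
    then have "combination n l (\<lambda>j i. u j $ i) (\<lambda>i. v $ i)"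
      unfolding combination_def by (intro exI[of _ b]) (simp add: v lincomb_index[OF _ U])
    moreover have "v \<in> carrier_vec n" unfolding v using U by (intro carrier_vecI lincomb_dim) auto
    ultimately show "v \<in> {v \<in> carrier_vec n. combination n l (\<lambda>j i. u j $ i) (\<lambda>i. v $ i)}" by blast
  next
    fix v assume "v \<in> {v \<in> carrier_vec n. combination n l (\<lambda>j i. u j $ i) (\<lambda>i. v $ i)}"
    then obtain a where v: "v \<in> carrier_vec n" "\<forall>i<n. v $ i = (\<Sum>j<l. a j * u j $ i)"
      unfolding combination_def by blast
    \<comment> \<open>Conversely, the coefficients of all indices with the same vector are
      pooled.\<close>
    define b where "b x = (\<Sum>j | j < l \<and> u j = x. a j)" for x
    have "v = lincomb b (u ` {..<l})"
    proof (rule eq_vecI)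
      show "dim_vec v = dim_vec (lincomb b (u ` {..<l}))" using v(1) lincomb_dim[OF _ U] by simp
      fix i assume "i < dim_vec (lincomb b (u ` {..<l}))"
      then have i: "i < n" using lincomb_dim[OF _ U] by simp
      have "lincomb b (u ` {..<l}) $ i = (\<Sum>x\<in>u ` {..<l}. \<Sum>j | j < l \<and> u j = x. a j * x $ i)"
        by (simp add: lincomb_index[OF i U] b_def sum_distrib_right)
      also have "\<dots> = (\<Sum>x\<in>u ` {..<l}. \<Sum>j | j \<in> {..<l} \<and> u j = x. a j * u j $ i)"
        by (intro sum.cong refl) auto
      also have "\<dots> = (\<Sum>j<l. a j * u j $ i)" by (rule sum.group) auto
      finally show "v $ i = lincomb b (u ` {..<l}) $ i" using v(2) i by simp
    qed
    then show "v \<in> span (u ` {..<l})" using finite_span[OF _ U] by auto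
  }
qed

lemma lin_indpt_family:
  assumes u: "\<And>j. j < l \<Longrightarrow> u j \<in> carrier_vec n" and inj: "inj_on u {..<l}"
  shows "lin_indpt (u ` {..<l}) \<longleftrightarrow> independent_family n l (\<lambda>j i. u j $ i)"
proof -
  have U: "u ` {..<l} \<subseteq> carrier_vec n" using u by auto
  have idx: "lincomb a (u ` {..<l}) = 0\<^sub>v n \<longleftrightarrow> (\<forall>i<n. (\<Sum>j<l. a (u j) * u j $ i) = 0)" for a
  proof -
    have "lincomb a (u ` {..<l}) = 0\<^sub>v n \<longleftrightarrow> (\<forall>i<n. lincomb a (u ` {..<l}) $ i = 0)"
      using lincomb_dim[OF _ U, of a] by (auto simp: vec_eq_iff)
    also have "\<dots> \<longleftrightarrow> (\<forall>i<n. (\<Sum>j<l. a (u j) * u j $ i) = 0)"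
      by (simp add: lincomb_index[OF _ U] sum.reindex[OF inj])
    finally show ?thesis .
  qed
  show ?thesis
  proof
    assume ind: "lin_indpt (u ` {..<l})"
    show "independent_family n l (\<lambda>j i. u j $ i)"
      unfolding independent_family_def
    proof (intro allI impI)
      fix a j assume a: "\<forall>i<n. (\<Sum>j<l. a j * u j $ i) = 0" and j: "j < l"
      define b where "b = (\<lambda>x. a (inv_into {..<l} u x))"
      have b: "b (u j) = a j" if "j < l" for j using inj that by (simp add: b_def)
      have "lincomb b (u ` {..<l}) = 0\<^sub>v n" unfolding idx using a b by simp
      note lc = this
      have "lin_dep (u ` {..<l})" if "b (u j) \<noteq> 0"
        by (rule lin_dep_crit[where A = "u ` {..<l}" and v = "u j" and a = b])
          (use j that lc in auto)
      then show "a j = 0" using b[OF j] ind by auto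
    qed
  next
    assume ind: "independent_family n l (\<lambda>j i. u j $ i)"
    show "lin_indpt (u ` {..<l})"
    proof (rule finite_lin_indpt2)
      fix a assume "lincomb a (u ` {..<l}) = 0\<^sub>v n"
      then have "\<forall>j<l. a (u j) = 0" using ind[unfolded independent_family_def, THEN spec, of "\<lambda>j. a (u j)"]
        unfolding idx by blast
      then show "\<forall>v\<in>u ` {..<l}. a v = 0" by auto
    qed (use U in auto)
  qed
qed

end

lemma full_row_rankI:
  assumes A: "A \<in> carrier_mat m q" and B: "B \<in> carrier_mat q m" and AB: "A * B = 1\<^sub>m m"
  shows "full_row_rank (A :: 'a::field mat)"
proof -
  interpret V: vec_space "TYPE('a)" m .
  have "V.col_space A = carrier_vec m"
  proof -
    have "v \<in> V.col_space A" if v: "v \<in> carrier_vec m" for v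
    proof -
      have "A *\<^sub>v (B *\<^sub>v v) = (A * B) *\<^sub>v v" by (rule assoc_mult_mat_vec[symmetric, OF A B v])
      then have "A *\<^sub>v (B *\<^sub>v v) = v" using AB v by simp
      then show ?thesis unfolding V.col_space_eq[OF A] using A B v by (auto intro!: bexI[of _ "B *\<^sub>v v"])
    qed
    then show ?thesis unfolding V.col_space_eq[OF A] using A by auto
  qed
  then have "V.span_vs (set (cols A)) = module_vec TYPE('a) m"
    unfolding V.col_space_def by (simp add: module_vec_def)
  then have "V.rank A = m" unfolding V.rank_def by (simp add: V.dim_is_n)
  then show ?thesis using A by (simp add: full_row_rank_def)
qed

text \<open>Translation of the set-based definition into coordinates. Distinctness is absorbed by
  the independence of the family, since a repeated vector gives a relation with coefficients 1 and
  -1.\<close>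

lemma polynomial_basis_iff:
  "polynomial_basis q V vs \<longleftrightarrow> set vs \<subseteq> carrier_vec q \<and>
    independent_family q (length vs) (\<lambda>j i. to_fract (vs ! j $ i)) \<and>
    V = {v \<in> carrier_vec q. combination q (length vs) (\<lambda>j i. to_fract (vs ! j $ i)) (\<lambda>i. v $ i)}"
    (is "_ \<longleftrightarrow> ?C \<and> ?I \<and> ?V")
proof (cases ?C)
  case True
  interpret W: vec_space "TYPE('a poly fract)" q .
  define u where "u j = ratvec (vs ! j)" for j
  have c: "vs ! j \<in> carrier_vec q" if "j < length vs" for j
    using True nth_mem[OF that] by blast
  have u: "u j \<in> carrier_vec q" "i < q \<Longrightarrow> u j $ i = to_fract (vs ! j $ i)" if "j < length vs" for i j
    using carrier_vecD[OF c[OF that]] by (auto simp: u_def)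
  have U: "ratvec ` set vs = u ` {..<length vs}" by (auto simp: u_def set_conv_nth)
  have comb: "combination q (length vs) (\<lambda>j i. u j $ i) = combination q (length vs) (\<lambda>j i. to_fract (vs ! j $ i))"
    using u(2) by (auto simp: combination_def fun_eq_iff)
  have ind: "independent_family q (length vs) (\<lambda>j i. u j $ i) = independent_family q (length vs) (\<lambda>j i. to_fract (vs ! j $ i))"
    using u(2) by (auto simp: independent_family_def)
  have sp: "W.span (ratvec ` set vs) = {v \<in> carrier_vec q. combination q (length vs) (\<lambda>j i. to_fract (vs ! j $ i)) (\<lambda>i. v $ i)}"
    unfolding U using W.span_family[of "length vs" u] u(1) comb by simp
  have injfr: "ratvec v = ratvec w \<Longrightarrow> v = w" for v w :: "'a poly vec"
    by (auto simp: vec_eq_iff)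
  have inj: "inj_on u {..<length vs}" if "distinct vs"
  proof (rule inj_onI)
    fix i j assume ij: "i \<in> {..<length vs}" "j \<in> {..<length vs}" "u i = u j"
    then have "vs ! i = vs ! j" unfolding u_def by (intro injfr)
    then show "i = j" using ij that by (simp add: nth_eq_iff_index_eq)
  qed
  have "?I \<Longrightarrow> distinct vs"
    unfolding distinct_conv_nth
  proof (intro allI impI notI)
    fix i j assume I: ?I and ij: "i < length vs" "j < length vs" "i \<noteq> j" "vs ! i = vs ! j"
    define a where "a = (\<lambda>l. if l = i then 1 else if l = j then -1 else (0 :: 'a poly fract))"
    have "(\<Sum>l<length vs. a l * to_fract (vs ! l $ c)) = (\<Sum>l\<in>{i,j}. a l * to_fract (vs ! l $ c))" for c
      using ij by (intro sum.mono_neutral_right) (auto simp: a_def)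
    then have "\<forall>c<q. (\<Sum>l<length vs. a l * to_fract (vs ! l $ c)) = 0" using ij by (simp add: a_def)
    then have "a i = 0" using I ij(1) unfolding independent_family_def by blast
    then show False by (simp add: a_def)
  qed
  moreover have "distinct vs \<Longrightarrow> W.lin_indpt (ratvec ` set vs) \<longleftrightarrow> ?I"
    unfolding U ind[symmetric] by (rule W.lin_indpt_family[OF u(1) inj])
  ultimately show ?thesis unfolding polynomial_basis_def sp using True by blast
qed (simp add: polynomial_basis_def)

lemma polynomial_basis_length:
  assumes "polynomial_basis q V vs" "polynomial_basis q V ws"
  shows "length vs = length ws"
proof -
  have le: "length vs \<le> length ws" if "polynomial_basis q V vs" "polynomial_basis q V ws" for vs ws :: "'a poly vec list"
  proof (rule independent_family_le)
    show "independent_family q (length vs) (\<lambda>j i. to_fract (vs ! j $ i))"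
      using that(1) by (simp add: polynomial_basis_iff)
    fix j assume j: "j < length vs"
    have "vs ! j \<in> carrier_vec q" using that(1) j nth_mem[OF j] by (auto simp: polynomial_basis_iff)
    have "ratvec (vs ! j) \<in> V"
    proof -
      have "combination q (length vs) (\<lambda>j i. to_fract (vs ! j $ i)) (\<lambda>i. ratvec (vs ! j) $ i)"
        unfolding combination_def
        by (rule exI[of _ "\<lambda>i. if i = j then 1 else 0"])
          (use j \<open>vs ! j \<in> carrier_vec q\<close> in \<open>simp add: if_distrib[of "\<lambda>x. x * _"] cong: if_cong\<close>)
      then show ?thesis using that(1) \<open>vs ! j \<in> carrier_vec q\<close> by (simp add: polynomial_basis_iff)
    qed
    then have "combination q (length ws) (\<lambda>j i. to_fract (ws ! j $ i)) (\<lambda>i. ratvec (vs ! j) $ i)"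
      using that(2) by (simp add: polynomial_basis_iff)
    then show "combination q (length ws) (\<lambda>j i. to_fract (ws ! j $ i)) (\<lambda>i. to_fract (vs ! j $ i))"
      using \<open>vs ! j \<in> carrier_vec q\<close> by (simp add: combination_def)
  qed
  show ?thesis using le assms by (meson le_antisym)
qed

section \<open>Completion to a unimodular matrix and minimal indices\<close>

lemma ratmat_mult:
  fixes A B :: "'a::field poly mat"
  assumes "A \<in> carrier_mat a b" "B \<in> carrier_mat b c"
  shows "ratmat (A * B) = ratmat A * ratmat B"
  by (rule eq_matI) (use assms in \<open>auto simp: scalar_prod_def\<close>)

text \<open>Holds over the field of fractions, and \<open>to_fract\<close> is injective and respects
  products.\<close>

lemma poly_mat_left_right_inverse:
  fixes A B :: "'a::field poly mat"
  assumes A: "A \<in> carrier_mat l l" and B: "B \<in> carrier_mat l l" and AB: "A * B = 1\<^sub>m l"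
  shows "B * A = 1\<^sub>m l"
proof -
  have one: "ratmat (1\<^sub>m l) = (1\<^sub>m l :: 'a poly fract mat)" by (rule eq_matI) auto
  have "ratmat B * ratmat A = 1\<^sub>m l"
    by (rule mat_mult_left_right_inverse) (use A B ratmat_mult[OF A B] AB one in auto)
  then have e: "ratmat (B * A) = ratmat (1\<^sub>m l)" using ratmat_mult[OF B A] one by simp
  show ?thesis
  proof (rule eq_matI)
    fix i j assume ij: "i < dim_row (1\<^sub>m l :: 'a poly mat)" "j < dim_col (1\<^sub>m l :: 'a poly mat)"
    then have "to_fract ((B * A) $$ (i, j)) = to_fract ((1\<^sub>m l) $$ (i, j))"
      using arg_cong[OF e, of "\<lambda>C. C $$ (i, j)"] A B by simp
    then show "(B * A) $$ (i, j) = 1\<^sub>m l $$ (i, j)" by simp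
  qed (use A B in auto)
qed

lemma pvecs_exhaust:
  assumes "\<And>c. q \<le> c \<Longrightarrow> x c = 0"
  obtains K where "x \<in> pvecs q K"
proof
  show "x \<in> pvecs q (Suc (\<Sum>c<q. Polynomial.degree (x c)))"
    unfolding pvecs_def mem_Collect_eq
  proof (intro conjI allI impI)
    fix c i assume i: "Suc (\<Sum>c<q. Polynomial.degree (x c)) \<le> i"
    show "Polynomial.coeff (x c) i = 0"
    proof (cases "c < q")
      case True
      then have "Polynomial.degree (x c) \<le> (\<Sum>c<q. Polynomial.degree (x c))" by (intro member_le_sum) auto
      then show ?thesis using i by (intro coeff_eq_0) simp
    qed (use assms in simp)
  qed (rule assms)
qed

text \<open>With the rows of \<open>N\<close> and \<open>X\<close> as columns, \<open>[X, N]\<close> and \<open>[M; Y]\<close> are inverse to each other.\<close>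

locale completion = balanced +
  fixes N X Y :: "nat \<Rightarrow> nat \<Rightarrow> 'a poly"
  assumes N_deg: "\<And>j. j < n \<Longrightarrow> N j \<in> pvecs (m + n) (Suc k)" "\<And>j. j < t \<Longrightarrow> N j \<in> pvecs (m + n) k"
    and N_span: "{x \<in> pvecs (m + n) k. pmul m (m + n) M x = 0} \<subseteq> pvs.span (N ` {..<t})"
    and MN: "\<And>r j. r < m \<Longrightarrow> j < n \<Longrightarrow> (\<Sum>c<m + n. M r c * N j c) = 0"
    and MX: "\<And>r r'. r < m \<Longrightarrow> r' < m \<Longrightarrow> (\<Sum>c<m + n. M r c * X r' c) = (if r = r' then 1 else 0)"
    and YN: "\<And>i j. i < n \<Longrightarrow> j < n \<Longrightarrow> (\<Sum>c<m + n. Y i c * N j c) = (if i = j then 1 else 0)"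
    and YX: "\<And>j r. j < n \<Longrightarrow> r < m \<Longrightarrow> (\<Sum>c<m + n. Y j c * X r c) = 0"
    and XM_NY: "\<And>c c'. c < m + n \<Longrightarrow> c' < m + n \<Longrightarrow>
      (\<Sum>r<m. X r c' * M r c) + (\<Sum>j<n. N j c' * Y j c) = (if c' = c then 1 else 0)"

lemma sum_split_add: "(\<Sum>l<m + n. f l) = (\<Sum>l<m. f l) + (\<Sum>j<n. f (m + j))"
  for f :: "nat \<Rightarrow> 'b::comm_monoid_add"
  by (induction n) (auto simp: add.assoc)

text \<open>Surjectivity gives \<open>X\<close> with A X = 1. Each column of 1 - X A is then in the
  kernel, hence a polynomial combination of the rows of \<open>N\<close>; the coefficients form
  \<open>Y\<close>. This yields the product of [X, N^T] and [A; Y] in one order, and the other order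
  follows for square matrices.\<close>

lemma (in balanced) completion_exists: "\<exists>N X Y. completion M m n d k t N X Y"
proof -
  obtain N where N: "\<And>j. j < n \<Longrightarrow> N j \<in> pvecs q (Suc k)" "\<And>j. j < n \<Longrightarrow> F (N j) = 0"
    "\<And>j. j < t \<Longrightarrow> N j \<in> pvecs q k"
    "{x \<in> pvecs q k. F x = 0} \<subseteq> pvs.span (N ` {..<t})"
    "\<And>x K. x \<in> pvecs q K \<Longrightarrow> F x = 0 \<Longrightarrow> \<exists>p. \<forall>c. x c = (\<Sum>j<n. p j * N j c)"
    using kernel_module_basis by blast
  have "\<exists>x\<in>pvecs q k. F x = monvec r 0" if "r < m" for r
  proof -
    have "(monvec r 0 :: nat \<Rightarrow> 'a poly) \<in> pvecs m (d + k)" using that k0 by (intro monvec_pvecs) auto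
    then show ?thesis using surj unfolding surjective_mult_def by blast
  qed
  then obtain X where X: "\<And>r. r < m \<Longrightarrow> X r \<in> pvecs q k" "\<And>r. r < m \<Longrightarrow> F (X r) = monvec r 0" by metis
  have MX: "(\<Sum>c<q. M r c * X r' c) = (if r = r' then 1 else 0)" if "r < m" "r' < m" for r r'
    using fun_cong[OF X(2)[OF that(2)], of r] that by (simp add: pmul_def monvec_def)
  have MN: "(\<Sum>c<q. M r c * N j c) = 0" if "r < m" "j < n" for r j
    using fun_cong[OF N(2)[OF that(2)], of r] that by (simp add: pmul_def)
  have "\<exists>p. \<forall>c'. monvec c 0 c' - (\<Sum>r<m. X r c' * M r c) = (\<Sum>j<n. p j * N j c')" if c: "c < q" for c
  proof -
    define x where "x = (\<lambda>c'. monvec c 0 c' - (\<Sum>r<m. X r c' * M r c))"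
    have "x c' = 0" if "q \<le> c'" for c'
      using that c X(1) by (auto simp: x_def monvec_def pvecs_def)
    then obtain K where K: "x \<in> pvecs q K" using pvecs_exhaust by blast
    have "F x r = 0" for r
    proof (cases "r < m")
      case True
      have "F x r = (\<Sum>c'<q. M r c' * monvec c 0 c') - (\<Sum>c'<q. \<Sum>r'<m. M r c' * X r' c' * M r' c)"
        using True by (simp add: pmul_def x_def right_diff_distrib sum_subtractf sum_distrib_left mult.assoc)
      also have "(\<Sum>c'<q. M r c' * monvec c 0 c') = M r c"
        using c by (simp add: monvec_def if_distrib[of "\<lambda>x. _ * x"] cong: if_cong)
      also have "(\<Sum>c'<q. \<Sum>r'<m. M r c' * X r' c' * M r' c) = (\<Sum>r'<m. (\<Sum>c'<q. M r c' * X r' c') * M r' c)"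
        by (subst sum.swap) (simp add: sum_distrib_right)
      also have "\<dots> = (\<Sum>r'<m. if r = r' then M r' c else 0)"
        by (intro sum.cong refl) (use True in \<open>simp add: MX\<close>)
      also have "\<dots> = M r c" using True by simp
      finally show ?thesis by simp
    qed (simp add: pmul_def)
    then have "F x = 0" by (simp add: fun_eq_iff)
    then show ?thesis using N(5)[OF K] unfolding x_def by blast
  qed
  note ex = this
  define P where "P c = (SOME p. \<forall>c'. monvec c 0 c' - (\<Sum>r<m. X r c' * M r c) = (\<Sum>j<n. p j * N j c'))" for c
  have P: "monvec c 0 c' - (\<Sum>r<m. X r c' * M r c) = (\<Sum>j<n. P c j * N j c')" if "c < q" for c c'
    using someI_ex[OF ex[OF that]] unfolding P_def by (rule spec)
  define Y where "Y = (\<lambda>j c. P c j)"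
  have XM_NY: "(\<Sum>r<m. X r c' * M r c) + (\<Sum>j<n. N j c' * Y j c) = (if c' = c then 1 else 0)"
    if "c < q" "c' < q" for c c'
  proof -
    have "(\<Sum>r<m. X r c' * M r c) + (\<Sum>j<n. N j c' * Y j c) = monvec c 0 c'"
      using P[OF that(1), of c'] by (simp add: Y_def mult.commute[of "N _ _"] diff_eq_eq add.commute)
    also have "\<dots> = (if c' = c then 1 else 0)" by (simp add: monvec_def monom_0 one_pCons)
    finally show ?thesis .
  qed
  define V where "V = mat q q (\<lambda>(c, l). if l < m then X l c else N (l - m) c)"
  define W where "W = mat q q (\<lambda>(l, c). if l < m then M l c else Y (l - m) c)"
  have VW: "V \<in> carrier_mat q q" "W \<in> carrier_mat q q" by (auto simp: V_def W_def)
  have "V * W = 1\<^sub>m q"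
    by (rule eq_matI) (auto simp: V_def W_def scalar_prod_def lessThan_atLeast0[symmetric] sum_split_add XM_NY)
  then have WV: "W * V = 1\<^sub>m q" using poly_mat_left_right_inverse VW by blast
  have WVi: "(\<Sum>c<q. (if i < m then M i c else Y (i - m) c) * (if j < m then X j c else N (j - m) c)) = (if i = j then 1 else 0)"
    if "i < q" "j < q" for i j
  proof -
    have "(W * V) $$ (i, j) = (\<Sum>c<q. (if i < m then M i c else Y (i - m) c) * (if j < m then X j c else N (j - m) c))"
      using that by (auto simp: V_def W_def scalar_prod_def lessThan_atLeast0)
    then show ?thesis using WV that by simp
  qed
  have "(\<Sum>c<q. Y i c * N j c) = (if i = j then 1 else 0)" if "i < n" "j < n" for i j
    using WVi[of "m + i" "m + j"] that by simp
  moreover have "(\<Sum>c<q. Y j c * X r c) = 0" if "j < n" "r < m" for j r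
    using WVi[of "m + j" r] that by simp
  ultimately have "completion M m n d k t N X Y"
    by unfold_locales (use N MN MX XM_NY in auto)
  then show ?thesis by blast
qed

section \<open>Degrees of kernel bases and the right minimal indices\<close>

lemma polyvec_degree_le_iff:
  assumes "v \<in> carrier_vec q" "0 < q"
  shows "polyvec_degree v \<le> D \<longleftrightarrow> (\<forall>i<q. Polynomial.degree (v $ i) \<le> D)"
proof -
  have v: "vec_set v = (\<lambda>i. v $ i) ` {..<q}" using assms by (auto simp: vec_set_def)
  show ?thesis unfolding polyvec_degree_def v using assms(2)
    by (subst Max_le_iff) auto
qed

definition vec_fun :: "'a::zero poly vec \<Rightarrow> nat \<Rightarrow> 'a poly" where
  "vec_fun v = (\<lambda>c. if c < dim_vec v then v $ c else 0)"

lemma vec_fun_pvecs: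
  assumes v: "v \<in> carrier_vec q" "0 < q" and "polyvec_degree v < K"
  shows "vec_fun v \<in> pvecs q K"
proof -
  have "\<forall>i<q. Polynomial.degree (v $ i) \<le> polyvec_degree v" using polyvec_degree_le_iff[OF v] by blast
  then show ?thesis using assms by (auto simp: pvecs_def vec_fun_def intro!: coeff_eq_0)
qed

lemma independent_family_combination_zero:
  fixes ws :: "'a::field poly vec list"
  assumes "independent_family q l (\<lambda>j i. to_fract (ws ! j $ i))"
    and "\<And>i. i < q \<Longrightarrow> (\<Sum>j<l. p j * ws ! j $ i) = 0" "j < l"
  shows "p j = 0"
proof -
  have "(\<Sum>j<l. to_fract (p j) * to_fract (ws ! j $ i)) = 0" if "i < q" for i
    using assms(2)[OF that] by (metis (no_types, lifting) to_fract_0 to_fract_mult to_fract_sum sum.cong)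
  then have "to_fract (p j) = 0"
    using assms(1)[unfolded independent_family_def, THEN spec, of "\<lambda>j. to_fract (p j)"] assms(3) by blast
  then show ?thesis by simp
qed

text \<open>Raise the values equal to k - 1 by one: all become at least k, and the sum grows by at
  most t. In the extremal case every raised value is k and exactly t values were raised.\<close>

lemma gap_degrees:
  fixes f :: "nat \<Rightarrow> nat"
  assumes lo: "\<And>j. j < n \<Longrightarrow> k - 1 \<le> f j" and c: "card {j. j < n \<and> f j = k - 1} \<le> t" and k: "0 < k"
  shows "n * k \<le> (\<Sum>j<n. f j) + t"
    and "(\<Sum>j<n. f j) + t \<le> n * k \<Longrightarrow> t \<le> n \<Longrightarrow>
      image_mset f (mset_set {..<n}) = replicate_mset t (k - 1) + replicate_mset (n - t) k"
proof -
  define J where "J = {j. j < n \<and> f j = k - 1}"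
  define g where "g j = f j + (if f j = k - 1 then 1 else 0)" for j
  have g: "k \<le> g j" if "j < n" for j using lo[OF that] k by (auto simp: g_def)
  have J: "finite J" "J \<subseteq> {..<n}" by (auto simp: J_def)
  have "(\<Sum>j<n. g j) = (\<Sum>j<n. f j) + (\<Sum>j<n. if f j = k - 1 then 1 else 0)"
    by (simp add: g_def sum.distrib)
  also have "(\<Sum>j<n. if f j = k - 1 then 1 else 0) = card J"
    by (simp add: J_def sum.If_cases Collect_conj_eq lessThan_def)
  finally have sg: "(\<Sum>j<n. g j) = (\<Sum>j<n. f j) + card J" .
  have ge: "n * k \<le> (\<Sum>j<n. g j)" using sum_mono[of "{..<n}" "\<lambda>_. k" g] g by simp
  then show "n * k \<le> (\<Sum>j<n. f j) + t" using sg c by (simp add: J_def)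
  assume le: "(\<Sum>j<n. f j) + t \<le> n * k" and "t \<le> n"
  then have cJ: "card J = t" and eq: "(\<Sum>j<n. g j) = n * k" using sg ge c by (simp_all add: J_def)
  have "g j = k" if "j < n" for j
  proof (rule ccontr)
    assume "g j \<noteq> k"
    then have "k < g j" using g[OF that] by simp
    then have "(\<Sum>j<n. k) < (\<Sum>j<n. g j)" using g that by (intro sum_strict_mono_ex1) auto
    then show False using eq by simp
  qed
  then have fk: "f j = k" if "j < n" "j \<notin> J" for j using that by (fastforce simp: g_def J_def split: if_splits)
  have "mset_set {..<n} = mset_set J + mset_set ({..<n} - J)"
    using J by (metis finite_lessThan mset_set_Union Diff_disjoint Un_Diff_cancel sup.absorb2 finite_Diff)
  then have "image_mset f (mset_set {..<n}) = image_mset f (mset_set J) + image_mset f (mset_set ({..<n} - J))" by simp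
  also have "image_mset f (mset_set J) = image_mset (\<lambda>_. k - 1) (mset_set J)"
    by (rule image_mset_cong) (auto simp: J_def)
  also have "image_mset f (mset_set ({..<n} - J)) = image_mset (\<lambda>_. k) (mset_set ({..<n} - J))"
    by (rule image_mset_cong) (use fk in auto)
  finally show "image_mset f (mset_set {..<n}) = replicate_mset t (k - 1) + replicate_mset (n - t) k"
    using J cJ by (simp add: image_mset_const_eq card_Diff_subset)
qed

lemma independent_family_right_inverse:
  assumes "\<And>j j'. j < l \<Longrightarrow> j' < l \<Longrightarrow> (\<Sum>c<q. u j c * z j' c) = (if j = j' then 1 else 0)"
  shows "independent_family q l u"
  unfolding independent_family_def
proof (intro allI impI)
  fix a i assume a: "\<forall>c<q. (\<Sum>j<l. a j * u j c) = 0" and i: "i < l"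
  have "a i = (\<Sum>j<l. if j = i then a j else 0)" using i by simp
  also have "\<dots> = (\<Sum>j<l. a j * (\<Sum>c<q. u j c * z i c))"
    by (intro sum.cong refl) (use i assms in simp)
  also have "\<dots> = (\<Sum>c<q. (\<Sum>j<l. a j * u j c) * z i c)"
    unfolding sum_distrib_left sum_distrib_right by (subst sum.swap) (simp add: mult_ac)
  also have "\<dots> = 0" using a by (intro sum.neutral) simp
  finally show "a i = 0" .
qed

locale completed_mat = completion "\<lambda>r c. A $$ (r, c)" m n d k t N X Y
  for A :: "'a::field poly mat" and m n d k t N X Y +
  assumes A_carrier: "A \<in> carrier_mat m (m + n)"
begin

lemma q0: "0 < m + n" using m0 by simp

lemma mat_kernel_rat:
  "mat_kernel (ratmat A) = {v \<in> carrier_vec q. \<forall>r<m. (\<Sum>c<q. to_fract (A $$ (r, c)) * v $ c) = 0}"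
proof -
  have "(ratmat A *\<^sub>v v = 0\<^sub>v m) \<longleftrightarrow> (\<forall>r<m. (\<Sum>c<q. to_fract (A $$ (r, c)) * v $ c) = 0)" if "v \<in> carrier_vec q" for v
    using that A_carrier by (auto simp: vec_eq_iff scalar_prod_def lessThan_atLeast0)
  moreover have "ratmat A \<in> carrier_mat m q" using A_carrier by simp
  ultimately show ?thesis by (subst mat_kernel) auto
qed

definition kernel_list :: "'a poly vec list" where
  "kernel_list = map (\<lambda>j. vec q (N j)) [0..<n]"

lemma kernel_list [simp]: "length kernel_list = n" "j < n \<Longrightarrow> kernel_list ! j = vec q (N j)"
  by (auto simp: kernel_list_def)

lemma frac_delta:
  assumes "(\<Sum>c\<in>C. a c * b c) = (if P then 1 else (0 :: 'a poly))"
  shows "(\<Sum>c\<in>C. to_fract (a c) * to_fract (b c)) = (if P then 1 else 0)"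
  using arg_cong[OF assms, of to_fract] by (auto split: if_splits)

text \<open>For v in the kernel, X A + N^T Y = 1 gives v = N^T (Y v), so the coefficients of v are
  the entries of Y v. The same \<open>Y\<close> witnesses independence.\<close>

lemma kernel_list_basis: "polynomial_basis q (mat_kernel (ratmat A)) kernel_list"
  unfolding polynomial_basis_iff
proof (intro conjI)
  show "set kernel_list \<subseteq> carrier_vec q" by (auto simp: kernel_list_def)
  show "independent_family q (length kernel_list) (\<lambda>j i. to_fract (kernel_list ! j $ i))"
  proof (rule independent_family_right_inverse[where z = "\<lambda>j c. to_fract (Y j c)"])
    fix i j assume "i < length kernel_list" "j < length kernel_list"
    then have ij: "i < n" "j < n" by simp_all
    have "(\<Sum>c<q. N i c * Y j c) = (if i = j then 1 else 0)" using YN[OF ij(2,1)] by (simp add: mult.commute)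
    from frac_delta[OF this]
    show "(\<Sum>c<q. to_fract (kernel_list ! i $ c) * to_fract (Y j c)) = (if i = j then 1 else 0)"
      using ij by simp
  qed
  show "mat_kernel (ratmat A) = {v \<in> carrier_vec q. combination q (length kernel_list) (\<lambda>j i. to_fract (kernel_list ! j $ i)) (\<lambda>i. v $ i)}"
    unfolding mat_kernel_rat
  proof (intro Collect_cong conj_cong refl iffI)
    fix v :: "'a poly fract vec" assume v: "\<forall>r<m. (\<Sum>c<q. to_fract (A $$ (r, c)) * v $ c) = 0"
    define a where "a j = (\<Sum>c<q. to_fract (Y j c) * v $ c)" for j
    have "v $ i = (\<Sum>j<n. a j * to_fract (N j i))" if i: "i < q" for i
    proof -
      have d: "(\<Sum>r<m. to_fract (X r i) * to_fract (A $$ (r, c))) + (\<Sum>j<n. to_fract (N j i) * to_fract (Y j c)) = (if i = c then 1 else 0)"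
        if "c < q" for c
        using arg_cong[OF XM_NY[OF that i], of to_fract] by (simp split: if_splits)
      have "v $ i = (\<Sum>c<q. (if i = c then 1 else 0) * v $ c)"
        using i by (simp add: if_distrib[of "\<lambda>x. x * _"] cong: if_cong)
      also have "\<dots> = (\<Sum>c<q. ((\<Sum>r<m. to_fract (X r i) * to_fract (A $$ (r, c))) + (\<Sum>j<n. to_fract (N j i) * to_fract (Y j c))) * v $ c)"
        by (intro sum.cong refl) (simp add: d)
      also have "\<dots> = (\<Sum>c<q. \<Sum>r<m. to_fract (X r i) * (to_fract (A $$ (r, c)) * v $ c))
          + (\<Sum>c<q. \<Sum>j<n. to_fract (N j i) * (to_fract (Y j c) * v $ c))"
        by (simp add: distrib_right sum.distrib sum_distrib_right mult.assoc)
      also have "(\<Sum>c<q. \<Sum>r<m. to_fract (X r i) * (to_fract (A $$ (r, c)) * v $ c)) =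
          (\<Sum>r<m. to_fract (X r i) * (\<Sum>c<q. to_fract (A $$ (r, c)) * v $ c))"
        by (subst sum.swap) (simp add: sum_distrib_left)
      also have "\<dots> = 0" using v by (intro sum.neutral) simp
      also have "(\<Sum>c<q. \<Sum>j<n. to_fract (N j i) * (to_fract (Y j c) * v $ c)) = (\<Sum>j<n. a j * to_fract (N j i))"
        by (subst sum.swap) (simp add: a_def sum_distrib_left mult.commute)
      finally show ?thesis by simp
    qed
    then show "combination q (length kernel_list) (\<lambda>j i. to_fract (kernel_list ! j $ i)) (\<lambda>i. v $ i)"
      unfolding combination_def by (intro exI[of _ a]) simp
  next
    fix v :: "'a poly fract vec"
    assume "combination q (length kernel_list) (\<lambda>j i. to_fract (kernel_list ! j $ i)) (\<lambda>i. v $ i)"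
    then obtain a where a: "\<forall>i<q. v $ i = (\<Sum>j<length kernel_list. a j * to_fract (kernel_list ! j $ i))"
      unfolding combination_def by (elim exE)
    show "\<forall>r<m. (\<Sum>c<q. to_fract (A $$ (r, c)) * v $ c) = 0"
    proof (intro allI impI)
      fix r assume r: "r < m"
      have "(\<Sum>c<q. to_fract (A $$ (r, c)) * v $ c) = (\<Sum>c<q. \<Sum>j<n. a j * (to_fract (A $$ (r, c)) * to_fract (N j c)))"
        using a by (intro sum.cong refl) (simp add: sum_distrib_left mult_ac)
      also have "\<dots> = (\<Sum>j<n. a j * (\<Sum>c<q. to_fract (A $$ (r, c)) * to_fract (N j c)))"
        by (subst sum.swap) (simp add: sum_distrib_left)
      also have "\<dots> = 0"
      proof (intro sum.neutral ballI)
        fix j assume "j \<in> {..<n}"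
        then have "(\<Sum>c<q. A $$ (r, c) * N j c) = (if False then 1 else 0)" using MN[OF r] by simp
        then show "a j * (\<Sum>c<q. to_fract (A $$ (r, c)) * to_fract (N j c)) = 0"
          using frac_delta[where a = "\<lambda>c. A $$ (r, c)" and b = "N j" and P = False] by simp
      qed
      finally show "(\<Sum>c<q. to_fract (A $$ (r, c)) * v $ c) = 0" .
    qed
  qed
qed

text \<open>A member of degree below k - 1 has at most k - 1 coefficients and would be 0 by
  injectivity. Members of degree k - 1 lie in the span over the coefficient field of the first t
  rows of \<open>N\<close>, and they are independent over that field, so there are at most t of
  them.\<close>

lemma kernel_basis_degrees:
  assumes ws: "polynomial_basis q (mat_kernel (ratmat A)) ws"
  shows "length ws = n" and "\<And>j. j < n \<Longrightarrow> k - 1 \<le> polyvec_degree (ws ! j)"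
    and "card {j. j < n \<and> polyvec_degree (ws ! j) = k - 1} \<le> t"
proof -
  show len: "length ws = n" using polynomial_basis_length[OF ws kernel_list_basis] by simp
  have ind: "independent_family q n (\<lambda>j i. to_fract (ws ! j $ i))"
    and ker: "mat_kernel (ratmat A) = {v \<in> carrier_vec q. combination q n (\<lambda>j i. to_fract (ws ! j $ i)) (\<lambda>i. v $ i)}"
    using ws unfolding polynomial_basis_iff len by blast+
  have car: "ws ! j \<in> carrier_vec q" if "j < n" for j
    using ws nth_mem[of j ws] that unfolding polynomial_basis_iff len by blast
  have F0: "F (vec_fun (ws ! j)) = 0" if j: "j < n" for j
  proof -
    have dimj: "dim_vec (ws ! j) = q" using car[OF j] by simp
    have "combination q n (\<lambda>j i. to_fract (ws ! j $ i)) (\<lambda>i. ratvec (ws ! j) $ i)"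
      unfolding combination_def
      by (rule exI[of _ "\<lambda>i. if i = j then 1 else 0"])
        (use j dimj in \<open>simp add: if_distrib[of "\<lambda>x. x * _"] cong: if_cong\<close>)
    then have "ratvec (ws ! j) \<in> mat_kernel (ratmat A)" unfolding ker using car[OF j] by simp
    then have "\<forall>r<m. (\<Sum>c<q. to_fract (A $$ (r, c)) * to_fract (ws ! j $ c)) = 0"
      unfolding mat_kernel_rat using dimj by simp
    then have "\<forall>r<m. to_fract (\<Sum>c<q. A $$ (r, c) * ws ! j $ c) = 0" by simp
    then have "\<forall>r<m. (\<Sum>c<q. A $$ (r, c) * ws ! j $ c) = 0" unfolding to_fract_eq_0_iff .
    then show ?thesis using dimj by (simp add: fun_eq_iff pmul_def vec_fun_def)
  qed
  have comb0: "p j = 0" if "\<And>i. i < q \<Longrightarrow> (\<Sum>j<n. p j * ws ! j $ i) = 0" "j < n" for p j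
    using independent_family_combination_zero[OF ind] that by blast
  show "k - 1 \<le> polyvec_degree (ws ! j)" if j: "j < n" for j
  proof (rule ccontr)
    assume "\<not> k - 1 \<le> polyvec_degree (ws ! j)"
    then have "vec_fun (ws ! j) \<in> pvecs q (k - 1)" by (intro vec_fun_pvecs car j q0) simp
    then have z: "vec_fun (ws ! j) = 0" using inj F0[OF j] by (simp add: injective_mult_def)
    have "ws ! j $ i = 0" if "i < q" for i
      using fun_cong[OF z, of i] that car[OF j] by (simp add: vec_fun_def)
    then have "(\<Sum>l<n. (if l = j then 1 else 0) * ws ! l $ i) = 0" if "i < q" for i
      using that j by (simp add: if_distrib[of "\<lambda>x. x * _"] cong: if_cong)
    from comb0[OF this j] show False by simp
  qed
  have "card {j. j < n \<and> polyvec_degree (ws ! j) = k - 1} \<le> card {..<t}"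
  proof (rule pvs.family_card_le[where f = "\<lambda>j. vec_fun (ws ! j)" and g = N])
    fix a i assume s: "(\<Sum>i | i < n \<and> polyvec_degree (ws ! i) = k - 1. pscale (a i) (vec_fun (ws ! i))) = 0"
      and i: "i \<in> {j. j < n \<and> polyvec_degree (ws ! j) = k - 1}"
    \<comment> \<open>Constant polynomials turn a relation over the coefficient field into one over
      the polynomials.\<close>
    define p where "p j = (if polyvec_degree (ws ! j) = k - 1 then [:a j:] else 0)" for j
    have "(\<Sum>j<n. p j * ws ! j $ c) = 0" if "c < q" for c
    proof -
      have "(\<Sum>j<n. p j * ws ! j $ c) = (\<Sum>j | j < n \<and> polyvec_degree (ws ! j) = k - 1. p j * ws ! j $ c)"
        by (intro sum.mono_neutral_right) (auto simp: p_def)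
      also have "\<dots> = (\<Sum>j | j < n \<and> polyvec_degree (ws ! j) = k - 1. pscale (a j) (vec_fun (ws ! j))) c"
        unfolding sum_fun_apply using carrier_vecD[OF car] that
        by (intro sum.cong refl) (auto simp: p_def vec_fun_def)
      also have "\<dots> = 0" unfolding s by simp
      finally show ?thesis .
    qed
    then have "p i = 0" using comb0 i by blast
    then show "a i = 0" using i by (simp add: p_def)
  next
    fix j assume "j \<in> {j. j < n \<and> polyvec_degree (ws ! j) = k - 1}"
    then have j: "j < n" "polyvec_degree (ws ! j) < k" using k0 by auto
    then have "vec_fun (ws ! j) \<in> {x \<in> pvecs q k. F x = 0}" using vec_fun_pvecs[OF car q0] F0 by blast
    then show "vec_fun (ws ! j) \<in> pvs.span (N ` {..<t})" using N_span by blast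
  qed simp_all
  then show "card {j. j < n \<and> polyvec_degree (ws ! j) = k - 1} \<le> t" by simp
qed

lemma mset_degrees: "length ws = n \<Longrightarrow>
    mset (map polyvec_degree ws) = image_mset (\<lambda>j. polyvec_degree (ws ! j)) (mset_set {..<n})"
  by (metis (no_types, lifting) atLeast0LessThan image_mset.compositionality map_nth mset_map mset_upt o_def image_mset_cong)

lemma sum_list_degrees: "length ws = n \<Longrightarrow>
    sum_list (map polyvec_degree ws) = (\<Sum>j<n. polyvec_degree (ws ! j))"
  by (simp add: sum_list_sum_nth atLeast0LessThan)

text \<open>\<open>N_deg\<close> bounds the degrees from above only; the matching lower bound is the
  one that holds for every polynomial basis of the kernel.\<close>

lemma kernel_list_degrees: "(\<Sum>j<n. polyvec_degree (kernel_list ! j)) + t \<le> n * k"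
proof -
  have "polyvec_degree (kernel_list ! j) + (if j < t then 1 else 0) \<le> k" if j: "j < n" for j
  proof -
    have c: "kernel_list ! j \<in> carrier_vec q" using j by simp
    have "polyvec_degree (kernel_list ! j) \<le> (if j < t then k - 1 else k)"
      unfolding polyvec_degree_le_iff[OF c q0]
    proof (intro allI impI degree_le)
      fix i l assume "i < q" "(if j < t then k - 1 else k) < l"
      then show "Polynomial.coeff (kernel_list ! j $ i) l = 0"
        using N_deg(1)[OF j] N_deg(2)[of j] j by (auto simp: pvecs_def split: if_splits)
    qed
    then show ?thesis using k0 by (auto split: if_splits)
  qed
  then have "(\<Sum>j<n. polyvec_degree (kernel_list ! j) + (if j < t then 1 else 0)) \<le> (\<Sum>j<n. k)"
    by (intro sum_mono) simp
  moreover have "(\<Sum>j<n. if j < t then 1 else 0) = t"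
  proof -
    have "{..<n} \<inter> {j. j < t} = {..<t}" using tn by auto
    then show ?thesis by (simp add: sum.If_cases)
  qed
  ultimately show ?thesis by (simp add: sum.distrib)
qed

lemma minimal_basis_kernel_list: "minimal_basis q (mat_kernel (ratmat A)) kernel_list"
  unfolding minimal_basis_def
proof (intro conjI allI impI kernel_list_basis)
  fix ws :: "'a poly vec list" assume ws: "polynomial_basis q (mat_kernel (ratmat A)) ws"
  have "n * k \<le> (\<Sum>j<n. polyvec_degree (ws ! j)) + t"
    by (rule gap_degrees(1)) (use kernel_basis_degrees[OF ws] k0 in blast)+
  then show "sum_list (map polyvec_degree kernel_list) \<le> sum_list (map polyvec_degree ws)"
    using kernel_list_degrees kernel_basis_degrees(1)[OF ws] by (simp add: sum_list_degrees)
qed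

lemma minimal_basis_kernel_degrees:
  assumes "minimal_basis q (mat_kernel (ratmat A)) ws"
  shows "mset (map polyvec_degree ws) = replicate_mset t (k - 1) + replicate_mset (n - t) k"
proof -
  have ws: "polynomial_basis q (mat_kernel (ratmat A)) ws" using assms by (simp add: minimal_basis_def)
  note d = kernel_basis_degrees[OF ws]
  have "sum_list (map polyvec_degree ws) \<le> sum_list (map polyvec_degree kernel_list)"
    using assms kernel_list_basis by (simp add: minimal_basis_def)
  then have "(\<Sum>j<n. polyvec_degree (ws ! j)) + t \<le> n * k"
    using kernel_list_degrees d(1) by (simp add: sum_list_degrees)
  then show ?thesis unfolding mset_degrees[OF d(1)]
    using gap_degrees(2)[of n k "\<lambda>j. polyvec_degree (ws ! j)" t] d k0 tn by simp
qed

lemma right_minimal_indices_eq: "right_minimal_indices A = replicate_mset t (k - 1) + replicate_mset (n - t) k"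
  unfolding right_minimal_indices_def minimal_indices_def
proof (rule the_equality)
  have q: "dim_col A = q" using A_carrier by simp
  show "\<exists>vs. minimal_basis (dim_col A) (mat_kernel (ratmat A)) vs \<and>
      replicate_mset t (k - 1) + replicate_mset (n - t) k = mset (map polyvec_degree vs)"
    unfolding q using minimal_basis_kernel_list minimal_basis_kernel_degrees by metis
  fix I assume "\<exists>vs. minimal_basis (dim_col A) (mat_kernel (ratmat A)) vs \<and> I = mset (map polyvec_degree vs)"
  then show "I = replicate_mset t (k - 1) + replicate_mset (n - t) k"
    unfolding q using minimal_basis_kernel_degrees by metis
qed

end

section \<open>Row space, left minimal indices and dual bases\<close>

lemma combination_cong:
  "(\<And>j i. j < l \<Longrightarrow> i < q \<Longrightarrow> u j i = u' j i) \<Longrightarrow> combination q l u x \<longleftrightarrow> combination q l u' x"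
  unfolding combination_def by (intro arg_cong[where f = Ex] ext all_cong sum.cong) auto

lemma independent_family_cong:
  "(\<And>j i. j < l \<Longrightarrow> i < q \<Longrightarrow> u j i = u' j i) \<Longrightarrow> independent_family q l u \<longleftrightarrow> independent_family q l u'"
  unfolding independent_family_def by (intro arg_cong[where f = All] ext imp_cong all_cong) auto

lemma full_row_rank_right_inverse:
  assumes A: "A \<in> carrier_mat m q"
    and z: "\<And>r r'. r < m \<Longrightarrow> r' < m \<Longrightarrow> (\<Sum>c<q. A $$ (r, c) * z r' c) = (if r = r' then 1 else (0 :: 'a::field))"
  shows "full_row_rank A"
proof (rule full_row_rankI[OF A])
  show "mat q m (\<lambda>(c, r). z r c) \<in> carrier_mat q m" by simp
  show "A * mat q m (\<lambda>(c, r). z r c) = 1\<^sub>m m"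
    by (rule eq_matI) (use A z in \<open>auto simp: scalar_prod_def lessThan_atLeast0[symmetric]\<close>)
qed

lemma row_space_rat:
  assumes B: "B \<in> carrier_mat l q"
  shows "vec_space.row_space q (ratmat B) =
    {v \<in> carrier_vec q. combination q l (\<lambda>j i. to_fract (B $$ (j, i))) (\<lambda>i. v $ i)}"
proof -
  interpret W: vec_space "TYPE('a poly fract)" q .
  define u where "u j = row (ratmat B) j" for j
  have "set (rows (ratmat B)) = u ` {..<l}" using B by (auto simp: rows_def u_def lessThan_atLeast0)
  then have "W.row_space (ratmat B) = {v \<in> carrier_vec q. combination q l (\<lambda>j i. u j $ i) (\<lambda>i. v $ i)}"
    unfolding W.row_space_def using W.span_family[of l u] B by (simp add: u_def)
  moreover have "combination q l (\<lambda>j i. u j $ i) = combination q l (\<lambda>j i. to_fract (B $$ (j, i)))"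
    by (intro ext combination_cong) (use B in \<open>simp add: u_def\<close>)
  ultimately show ?thesis by simp
qed

lemma polynomial_basis_rows:
  assumes B: "B \<in> carrier_mat l q"
  shows "polynomial_basis q V (rows B) \<longleftrightarrow>
    independent_family q l (\<lambda>j i. to_fract (B $$ (j, i))) \<and> V = vec_space.row_space q (ratmat B)"
proof -
  have "length (rows B) = l" "set (rows B) \<subseteq> carrier_vec q" using B by (auto simp: rows_def)
  moreover have "combination q l (\<lambda>j i. to_fract (rows B ! j $ i)) = combination q l (\<lambda>j i. to_fract (B $$ (j, i)))"
    by (intro ext combination_cong) (use B in simp)
  moreover have "independent_family q l (\<lambda>j i. to_fract (rows B ! j $ i)) = independent_family q l (\<lambda>j i. to_fract (B $$ (j, i)))"
    by (intro independent_family_cong) (use B in simp)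
  ultimately show ?thesis unfolding polynomial_basis_iff row_space_rat[OF B] by simp
qed

lemma polynomial_basis_zero_iff: "polynomial_basis q {0\<^sub>v q} vs \<longleftrightarrow> vs = []"
proof
  assume b: "polynomial_basis q {0\<^sub>v q} vs"
  show "vs = []"
  proof (rule ccontr)
    assume "vs \<noteq> []"
    then have l: "0 < length vs" by simp
    have c: "vs ! 0 \<in> carrier_vec q" using b l nth_mem[OF l] by (auto simp: polynomial_basis_iff)
    have "combination q (length vs) (\<lambda>j i. to_fract (vs ! j $ i)) (\<lambda>i. ratvec (vs ! 0) $ i)"
      unfolding combination_def
      by (rule exI[of _ "\<lambda>j. if j = 0 then 1 else 0"])
        (use l carrier_vecD[OF c] in \<open>simp add: if_distrib[of "\<lambda>x. x * _"] cong: if_cong\<close>)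
    then have "ratvec (vs ! 0) \<in> {0\<^sub>v q}" using b c unfolding polynomial_basis_iff by auto
    then have z: "ratvec (vs ! 0) = 0\<^sub>v q" by simp
    have zero: "to_fract (vs ! 0 $ i) = 0" if "i < q" for i
      using arg_cong[OF z, of "\<lambda>v. vec_index v i"] that carrier_vecD[OF c] by simp
    have "\<forall>i<q. (\<Sum>j<length vs. (if j = 0 then 1 else 0) * to_fract (vs ! j $ i)) = 0"
      using zero l by (simp add: if_distrib[of "\<lambda>x. x * _"] cong: if_cong)
    moreover have "independent_family q (length vs) (\<lambda>j i. to_fract (vs ! j $ i))"
      using b unfolding polynomial_basis_iff by blast
    ultimately have "\<forall>j<length vs. (if j = 0 then 1 else (0 :: 'a poly fract)) = 0"
      unfolding independent_family_def by (elim allE[of _ "\<lambda>j. if j = 0 then 1 else 0"] mp)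
    then have "(if (0::nat) = 0 then 1 else (0 :: 'a poly fract)) = 0" using l by (elim allE[of _ 0] mp)
    then show False by simp
  qed
next
  assume "vs = []"
  then show "polynomial_basis q {0\<^sub>v q} vs"
    by (auto simp: polynomial_basis_iff independent_family_def combination_def vec_eq_iff)
qed

lemma minimal_indices_zero: "minimal_indices q {0\<^sub>v q :: 'a::field poly fract vec} = {#}"
  unfolding minimal_indices_def minimal_basis_def polynomial_basis_zero_iff by (rule the_equality) auto

lemma polymat_degree_eq:
  assumes B: "B \<in> carrier_mat l q" "0 < q"
    and le: "\<And>j. j < l \<Longrightarrow> polyvec_degree (row B j) \<le> K"
    and ex: "j < l" "polyvec_degree (row B j) = K"
  shows "polymat_degree B = K"
  unfolding polymat_degree_def
proof (rule Max_eqI)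
  have el: "elements_mat B = {B $$ (i, c) | i c. i < l \<and> c < q}" using B(1) elements_matI[OF B(1)] by (auto dest!: elements_matD)
  have "elements_mat B = (\<lambda>(i, c). B $$ (i, c)) ` ({..<l} \<times> {..<q})" unfolding el by auto
  then show "finite (Polynomial.degree ` elements_mat B)" by simp
  have car: "row B i \<in> carrier_vec q" for i using row_carrier[of B i] carrier_matD(2)[OF B(1)] by simp
  show "y \<le> K" if "y \<in> Polynomial.degree ` elements_mat B" for y
  proof -
    obtain i c where ic: "i < l" "c < q" "y = Polynomial.degree (B $$ (i, c))" using \<open>y \<in> _\<close> unfolding el by blast
    then show ?thesis using polyvec_degree_le_iff[OF car B(2), of i K] le[of i] B(1) by auto
  qed
  have "vec_set (row B j) = (\<lambda>c. B $$ (j, c)) ` {..<q}" using B ex by (auto simp: vec_set_def)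
  then have "K \<in> Polynomial.degree ` (\<lambda>c. B $$ (j, c)) ` {..<q}"
    using ex(2) B(2) unfolding polyvec_degree_def by (metis Max_in finite_imageI finite_lessThan image_is_empty lessThan_empty_iff not_gr0)
  then show "K \<in> Polynomial.degree ` elements_mat B" unfolding el using ex(1) by blast
qed

context completed_mat
begin

lemma AX: "r < m \<Longrightarrow> r' < m \<Longrightarrow> (\<Sum>c<q. to_fract (A $$ (r, c)) * to_fract (X r' c)) = (if r = r' then 1 else 0)"
  by (rule frac_delta[OF MX])

text \<open>Surjectivity at k reaches the monomials of the highest admissible exponent d + k - 1. In
  that coefficient of the product only the degree-d coefficient of \<open>A\<close> and the
  coefficient k - 1 of the preimage meet.\<close>

lemma leading_right_inverse:
  obtains z where "\<And>r r'. r < m \<Longrightarrow> r' < m \<Longrightarrow>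
    (\<Sum>c<q. Polynomial.coeff (A $$ (r, c)) d * z r' c) = (if r = r' then 1 else 0)"
proof -
  have "\<exists>x\<in>pvecs q k. F x = monvec r (d + (k - 1))" if "r < m" for r
  proof -
    have "(monvec r (d + (k - 1)) :: nat \<Rightarrow> 'a poly) \<in> pvecs m (d + k)" using that k0 by (intro monvec_pvecs) auto
    then show ?thesis using surj unfolding surjective_mult_def by blast
  qed
  then obtain x where x: "\<And>r. r < m \<Longrightarrow> x r \<in> pvecs q k" "\<And>r. r < m \<Longrightarrow> F (x r) = monvec r (d + (k - 1))" by metis
  show ?thesis
  proof (rule that[of "\<lambda>r c. Polynomial.coeff (x r c) (k - 1)"])
    fix r r' assume r: "r < m" "r' < m"
    have "(\<Sum>c<q. Polynomial.coeff (A $$ (r, c)) d * Polynomial.coeff (x r' c) (k - 1)) =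
      (\<Sum>c<q. Polynomial.coeff (A $$ (r, c) * x r' c) (d + (k - 1)))"
    proof (intro sum.cong refl coeff_mult_top(1)[symmetric])
      fix c i assume "c \<in> {..<q}" "d < i"
      then show "Polynomial.coeff (A $$ (r, c)) i = 0" using degM[OF r(1), of c] by (intro coeff_eq_0) auto
    next
      fix c i assume "k - 1 < i"
      then show "Polynomial.coeff (x r' c) i = 0" using x(1)[OF r(2)] by (simp add: pvecs_def)
    qed
    also have "\<dots> = Polynomial.coeff (F (x r') r) (d + (k - 1))" using r by (simp add: pmul_def coeff_sum)
    also have "\<dots> = (if r = r' then 1 else 0)" using x(2)[OF r(2)] by (simp add: monvec_def)
    finally show "(\<Sum>c<q. Polynomial.coeff (A $$ (r, c)) d * Polynomial.coeff (x r' c) (k - 1)) = (if r = r' then 1 else 0)" .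
  qed
qed

lemma full_row_rank_leading: "full_row_rank (coeff_mat A d)"
proof -
  obtain z where z: "\<And>r r'. r < m \<Longrightarrow> r' < m \<Longrightarrow>
    (\<Sum>c<q. Polynomial.coeff (A $$ (r, c)) d * z r' c) = (if r = r' then 1 else 0)"
    using leading_right_inverse by blast
  show ?thesis
    by (rule full_row_rank_right_inverse[where z = z and m = m and q = q])
      (use A_carrier z in \<open>auto simp: coeff_mat_def\<close>)
qed

lemma full_row_rank_rat: "full_row_rank (ratmat A)"
  by (rule full_row_rank_right_inverse[where z = "\<lambda>r c. to_fract (X r c)" and m = m and q = q])
    (use A_carrier AX in auto)

lemma rows_basis: "polynomial_basis q (vec_space.row_space q (ratmat A)) (rows A)"
  unfolding polynomial_basis_rows[OF A_carrier]
  by (intro conjI refl independent_family_right_inverse[where z = "\<lambda>r c. to_fract (X r c)"] AX)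

text \<open>Predictable degree property: w = b A with polynomial \<open>b\<close>, and since the
  degree-d coefficient of \<open>A\<close> has a right inverse, the top coefficient of
  \<open>b\<close> survives multiplication. So w has a nonzero coefficient at e + d, where e is the
  degree of \<open>b\<close>.\<close>

lemma row_space_degree:
  assumes w: "w \<in> carrier_vec q" "ratvec w \<in> vec_space.row_space q (ratmat A)" and nz: "w \<noteq> 0\<^sub>v q"
  shows "d \<le> polyvec_degree w"
proof (rule ccontr)
  assume "\<not> d \<le> polyvec_degree w"
  then have lt: "polyvec_degree w < d" by simp
  have "combination q m (\<lambda>j i. to_fract (A $$ (j, i))) (\<lambda>i. ratvec w $ i)"
    using w(2) unfolding row_space_rat[OF A_carrier] by blast
  then obtain a where "\<forall>i<q. ratvec w $ i = (\<Sum>r<m. a r * to_fract (A $$ (r, i)))"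
    unfolding combination_def by (elim exE)
  then have a: "to_fract (w $ i) = (\<Sum>r<m. a r * to_fract (A $$ (r, i)))" if "i < q" for i
    using that carrier_vecD[OF w(1)] by simp
  \<comment> \<open>Multiplying w = a A by the polynomial right inverse \<open>X\<close> shows that
    the fractional coefficients \<open>a\<close> are polynomials.\<close>
  define b where "b r = (\<Sum>c<q. w $ c * X r c)" for r
  have ab: "a r = to_fract (b r)" if r: "r < m" for r
  proof -
    have "to_fract (b r) = (\<Sum>c<q. (\<Sum>r'<m. a r' * to_fract (A $$ (r', c))) * to_fract (X r c))"
      by (simp add: b_def a)
    also have "\<dots> = (\<Sum>r'<m. a r' * (\<Sum>c<q. to_fract (A $$ (r', c)) * to_fract (X r c)))"
      unfolding sum_distrib_left sum_distrib_right by (subst sum.swap) (simp add: mult_ac)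
    also have "\<dots> = (\<Sum>r'<m. if r' = r then a r' else 0)"
      by (intro sum.cong refl) (use r AX in simp)
    finally show ?thesis using r by simp
  qed
  have wb: "w $ i = (\<Sum>r<m. b r * A $$ (r, i))" if "i < q" for i
  proof -
    have "to_fract (w $ i) = to_fract (\<Sum>r<m. b r * A $$ (r, i))" using a[OF that] ab by simp
    then show ?thesis by (simp only: to_fract_eq_iff)
  qed
  have "\<exists>r<m. b r \<noteq> 0"
  proof (rule ccontr)
    assume "\<not> (\<exists>r<m. b r \<noteq> 0)"
    then have "w $ i = 0" if "i < q" for i using wb[OF that] by simp
    then show False using nz w(1) by (auto simp: vec_eq_iff)
  qed
  then obtain r1 where r1: "r1 < m" "b r1 \<noteq> 0" by blast
  define e where "e = Max (Polynomial.degree ` b ` {..<m})"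
  have le: "Polynomial.degree (b r) \<le> e" if "r < m" for r
    unfolding e_def using that by (intro Max_ge) auto
  have "e \<in> Polynomial.degree ` b ` {..<m}" unfolding e_def using m0 by (intro Max_in) auto
  then obtain r2 where r2: "r2 < m" "Polynomial.degree (b r2) = e" by auto
  \<comment> \<open>The zero polynomial has degree 0. If the maximum e is attained by a zero entry,
    then e = 0 and the nonzero entry \<open>b r1\<close> is a constant that can take its
    place.\<close>
  define r0 where "r0 = (if b r2 = 0 then r1 else r2)"
  have r0: "r0 < m" "Polynomial.coeff (b r0) e \<noteq> 0"
  proof -
    show "r0 < m" using r1 r2 by (simp add: r0_def)
    show "Polynomial.coeff (b r0) e \<noteq> 0"
    proof (cases "b r2 = 0")
      case True
      then have "e = 0" using r2 by simp
      then have "Polynomial.degree (b r1) = 0" using le[OF r1(1)] by simp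
      then show ?thesis using True r1 \<open>e = 0\<close> by (metis r0_def leading_coeff_0_iff)
    next
      case False
      then show ?thesis using r2 by (simp add: r0_def) (metis leading_coeff_0_iff)
    qed
  qed
  obtain z where z: "\<And>r r'. r < m \<Longrightarrow> r' < m \<Longrightarrow>
    (\<Sum>c<q. Polynomial.coeff (A $$ (r, c)) d * z r' c) = (if r = r' then 1 else 0)"
    using leading_right_inverse by blast
  have top: "(\<Sum>r<m. Polynomial.coeff (b r) e * Polynomial.coeff (A $$ (r, i)) d) = 0" if i: "i < q" for i
  proof -
    have "Polynomial.degree (w $ i) \<le> polyvec_degree w"
      using polyvec_degree_le_iff[OF w(1) q0, of "polyvec_degree w"] i by blast
    then have "Polynomial.coeff (w $ i) (e + d) = 0" using lt by (intro coeff_eq_0) simp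
    then have "(\<Sum>r<m. Polynomial.coeff (b r * A $$ (r, i)) (e + d)) = 0"
      unfolding wb[OF i] coeff_sum .
    moreover have "Polynomial.coeff (b r * A $$ (r, i)) (e + d) = Polynomial.coeff (b r) e * Polynomial.coeff (A $$ (r, i)) d"
      if r: "r < m" for r
    proof (rule coeff_mult_top(1))
      show "Polynomial.coeff (b r) l = 0" if "e < l" for l using le[OF r] that by (intro coeff_eq_0) simp
      show "Polynomial.coeff (A $$ (r, i)) l = 0" if "d < l" for l using degM[OF r i] that by (intro coeff_eq_0) simp
    qed
    ultimately show ?thesis by simp
  qed
  have "Polynomial.coeff (b r0) e = (\<Sum>r<m. if r = r0 then Polynomial.coeff (b r) e else 0)" using r0 by simp
  also have "\<dots> = (\<Sum>r<m. Polynomial.coeff (b r) e * (\<Sum>c<q. Polynomial.coeff (A $$ (r, c)) d * z r0 c))"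
    by (intro sum.cong refl) (use r0 z in simp)
  also have "\<dots> = (\<Sum>c<q. (\<Sum>r<m. Polynomial.coeff (b r) e * Polynomial.coeff (A $$ (r, c)) d) * z r0 c)"
    unfolding sum_distrib_left sum_distrib_right by (subst sum.swap) (simp add: mult_ac)
  also have "\<dots> = 0" by (intro sum.neutral ballI) (simp add: top)
  finally show False using r0 by simp
qed

text \<open>Every member of a polynomial basis of the row space has degree at least d, while the
  rows of \<open>A\<close> have degree at most d; the sums compare term by term.\<close>

lemma minimal_basis_mat_A: "minimal_basis_mat A"
proof -
  have dims: "dim_row A = m" "dim_col A = q" using A_carrier by auto
  have "minimal_basis q (vec_space.row_space q (ratmat A)) (rows A)"
    unfolding minimal_basis_def
  proof (intro conjI allI impI rows_basis)
    fix ws :: "'a poly vec list" assume ws: "polynomial_basis q (vec_space.row_space q (ratmat A)) ws"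
    have len: "length ws = m" using polynomial_basis_length[OF ws rows_basis] dims by simp
    have ind: "independent_family q m (\<lambda>j i. to_fract (ws ! j $ i))"
      and car: "set ws \<subseteq> carrier_vec q"
      and sp: "vec_space.row_space q (ratmat A) = {v \<in> carrier_vec q. combination q m (\<lambda>j i. to_fract (ws ! j $ i)) (\<lambda>i. v $ i)}"
      using ws unfolding polynomial_basis_iff len by blast+
    have "d \<le> polyvec_degree (ws ! j)" if j: "j < m" for j
    proof (rule row_space_degree)
      show c: "ws ! j \<in> carrier_vec q" using car nth_mem[of j ws] j len by auto
      have "combination q m (\<lambda>j i. to_fract (ws ! j $ i)) (\<lambda>i. ratvec (ws ! j) $ i)"
        unfolding combination_def
        by (rule exI[of _ "\<lambda>i. if i = j then 1 else 0"])
          (use j carrier_vecD[OF c] in \<open>simp add: if_distrib[of "\<lambda>x. x * _"] cong: if_cong\<close>)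
      then show "ratvec (ws ! j) \<in> vec_space.row_space q (ratmat A)" unfolding sp using c by simp
      show "ws ! j \<noteq> 0\<^sub>v q"
      proof
        assume z: "ws ! j = 0\<^sub>v q"
        have "(\<Sum>l<m. (if l = j then 1 else 0) * ws ! l $ i) = 0" if "i < q" for i
          using that j z by (simp add: if_distrib[of "\<lambda>x. x * _"] cong: if_cong)
        from independent_family_combination_zero[OF ind this j] show False by simp
      qed
    qed
    then have "(\<Sum>j<m. d) \<le> (\<Sum>j<m. polyvec_degree (ws ! j))" by (intro sum_mono) simp
    moreover have "(\<Sum>j<m. polyvec_degree (rows A ! j)) \<le> (\<Sum>j<m. d)"
    proof (intro sum_mono)
      fix j assume "j \<in> {..<m}"
      then have j: "j < m" by simp
      have "row A j \<in> carrier_vec q" using row_carrier_vec[OF j A_carrier] .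
      then show "polyvec_degree (rows A ! j) \<le> d"
        using polyvec_degree_le_iff[OF _ q0, of "row A j" d] degM[OF j] j dims by simp
    qed
    ultimately show "sum_list (map polyvec_degree (rows A)) \<le> sum_list (map polyvec_degree ws)"
      using len dims by (simp add: sum_list_sum_nth lessThan_atLeast0)
  qed
  then show ?thesis unfolding minimal_basis_mat_def using dims tn by simp
qed

lemma left_minimal_indices_eq: "left_minimal_indices A = {#}"
proof -
  have "mat_kernel (transpose_mat (ratmat A)) = {0\<^sub>v m}"
  proof (intro equalityI subsetI)
    fix v assume "v \<in> mat_kernel (transpose_mat (ratmat A))"
    then have v: "v \<in> carrier_vec m" and k: "transpose_mat (ratmat A) *\<^sub>v v = 0\<^sub>v q"
      using A_carrier by (auto simp: mat_kernel_def)
    have "\<forall>c<q. (\<Sum>r<m. v $ r * to_fract (A $$ (r, c))) = 0"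
    proof (intro allI impI)
      fix c assume "c < q"
      then show "(\<Sum>r<m. v $ r * to_fract (A $$ (r, c))) = 0"
        using arg_cong[OF k, of "\<lambda>w. vec_index w c"] v A_carrier by (simp add: scalar_prod_def lessThan_atLeast0 mult.commute)
    qed
    moreover have "independent_family q m (\<lambda>j i. to_fract (A $$ (j, i)))"
      using rows_basis unfolding polynomial_basis_rows[OF A_carrier] by blast
    ultimately have "\<forall>r<m. v $ r = 0" unfolding independent_family_def by blast
    then show "v \<in> {0\<^sub>v m}" using v by (auto simp: vec_eq_iff)
  qed (use A_carrier in \<open>auto simp: mat_kernel_def\<close>)
  then show ?thesis using A_carrier unfolding left_minimal_indices_def by (simp add: minimal_indices_zero)
qed

text \<open>The n rows of \<open>B\<close> are independent and lie in the kernel, which is spanned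
  by n vectors, so they span it. Hence they are a minimal basis of the kernel and their degrees are
  the right minimal indices.\<close>

lemma dual_minimal_bases_degree:
  assumes "dual_minimal_bases A B"
  shows "polymat_degree B = k"
proof -
  have B: "B \<in> carrier_mat n q" and mb: "minimal_basis q (vec_space.row_space q (ratmat B)) (rows B)"
    and AB: "A * transpose_mat B = 0\<^sub>m m n"
    using assms A_carrier by (auto simp: dual_minimal_bases_def minimal_basis_mat_def)
  have ind: "independent_family q n (\<lambda>j i. to_fract (B $$ (j, i)))"
    using mb unfolding minimal_basis_def polynomial_basis_rows[OF B] by blast
  have ABz: "(\<Sum>c<q. to_fract (A $$ (r, c)) * to_fract (B $$ (j, c))) = 0" if "r < m" "j < n" for r j
  proof -
    have "(\<Sum>c<q. A $$ (r, c) * B $$ (j, c)) = (A * transpose_mat B) $$ (r, j)"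
      using that A_carrier B by (simp add: scalar_prod_def lessThan_atLeast0)
    then have "(\<Sum>c<q. A $$ (r, c) * B $$ (j, c)) = 0" unfolding AB using that by simp
    then have "to_fract (\<Sum>c<q. A $$ (r, c) * B $$ (j, c)) = 0" by simp
    then show ?thesis by simp
  qed
  have kl: "mat_kernel (ratmat A) = {v \<in> carrier_vec q. combination q n (\<lambda>j i. to_fract (kernel_list ! j $ i)) (\<lambda>i. v $ i)}"
    using kernel_list_basis unfolding polynomial_basis_iff by simp
  have rowker: "combination q n (\<lambda>j i. to_fract (kernel_list ! j $ i)) (\<lambda>i. to_fract (B $$ (j, i)))" if j: "j < n" for j
  proof -
    have "vec q (\<lambda>i. to_fract (B $$ (j, i))) \<in> mat_kernel (ratmat A)"
      unfolding mat_kernel_rat using ABz j by simp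
    then have "combination q n (\<lambda>j i. to_fract (kernel_list ! j $ i)) (\<lambda>i. vec q (\<lambda>i. to_fract (B $$ (j, i))) $ i)"
      unfolding kl by blast
    then show ?thesis by (simp add: combination_def)
  qed
  have "vec_space.row_space q (ratmat B) = mat_kernel (ratmat A)"
  proof (intro equalityI subsetI)
    fix v assume "v \<in> mat_kernel (ratmat A)"
    then show "v \<in> vec_space.row_space q (ratmat B)"
      unfolding kl row_space_rat[OF B] using independent_family_spans[OF ind rowker] by blast
  next
    fix v assume "v \<in> vec_space.row_space q (ratmat B)"
    then have v: "v \<in> carrier_vec q" and c: "combination q n (\<lambda>j i. to_fract (B $$ (j, i))) (\<lambda>i. v $ i)"
      unfolding row_space_rat[OF B] by blast+
    obtain a where a: "\<forall>i<q. v $ i = (\<Sum>j<n. a j * to_fract (B $$ (j, i)))"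
      using c unfolding combination_def by (elim exE)
    have "(\<Sum>c<q. to_fract (A $$ (r, c)) * v $ c) = 0" if r: "r < m" for r
    proof -
      have "(\<Sum>c<q. to_fract (A $$ (r, c)) * v $ c) = (\<Sum>j<n. a j * (\<Sum>c<q. to_fract (A $$ (r, c)) * to_fract (B $$ (j, c))))"
        using a by (simp add: sum_distrib_left) (subst sum.swap, simp add: mult_ac)
      also have "\<dots> = 0" using ABz r by (intro sum.neutral) simp
      finally show ?thesis .
    qed
    then show "v \<in> mat_kernel (ratmat A)" unfolding mat_kernel_rat using v by blast
  qed
  then have ms: "mset (map polyvec_degree (rows B)) = replicate_mset t (k - 1) + replicate_mset (n - t) k"
    using minimal_basis_kernel_degrees mb by metis
  have mem: "x \<in># mset (map polyvec_degree (rows B)) \<longleftrightarrow> (\<exists>j<n. x = polyvec_degree (row B j))" for x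
    using B by (auto simp: rows_def)
  show ?thesis
  proof -
    \<comment> \<open>t < n guarantees that the larger index k occurs.\<close>
    have "k \<in># mset (map polyvec_degree (rows B))" unfolding ms using tn by simp
    then obtain j where j: "j < n" "polyvec_degree (row B j) = k" unfolding mem by metis
    have le: "polyvec_degree (row B i) \<le> k" if "i < n" for i
    proof -
      have "polyvec_degree (row B i) \<in># mset (map polyvec_degree (rows B))" unfolding mem using that by blast
      then show ?thesis unfolding ms by (auto split: if_splits)
    qed
    show ?thesis by (rule polymat_degree_eq[OF B q0 le j])
  qed
qed

lemma dual_minimal_bases_exists: "\<exists>B. dual_minimal_bases A B"
proof
  define B where "B = mat n q (\<lambda>(j, c). N j c)"
  have B: "B \<in> carrier_mat n q" by (simp add: B_def)
  have rB: "rows B = kernel_list"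
    by (rule nth_equalityI) (auto simp: B_def row_def)
  have "full_row_rank (ratmat B)"
  proof (rule full_row_rank_right_inverse[where z = "\<lambda>j c. to_fract (Y j c)" and m = n and q = q])
    fix j j' assume j: "j < n" "j' < n"
    have "(\<Sum>c<q. N j c * Y j' c) = (if j = j' then 1 else 0)" using YN[OF j(2,1)] by (simp add: mult.commute)
    from frac_delta[OF this] show "(\<Sum>c<q. ratmat B $$ (j, c) * to_fract (Y j' c)) = (if j = j' then 1 else 0)"
      using j by (simp add: B_def)
  qed (use B in simp)
  moreover have "minimal_basis_mat B"
  proof -
    have "vec_space.row_space q (ratmat B) = mat_kernel (ratmat A)"
      using kernel_list_basis polynomial_basis_rows[OF B] unfolding rB by metis
    then have "minimal_basis q (vec_space.row_space q (ratmat B)) (rows B)"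
      using minimal_basis_kernel_list unfolding rB by simp
    then show ?thesis unfolding minimal_basis_mat_def using B m0 by simp
  qed
  moreover have "A * transpose_mat B = 0\<^sub>m m n"
    by (rule eq_matI) (use A_carrier B MN in \<open>auto simp: B_def scalar_prod_def lessThan_atLeast0\<close>)
  ultimately show "dual_minimal_bases A B"
    unfolding dual_minimal_bases_def using A_carrier B full_row_rank_rat minimal_basis_mat_A by auto
qed

end

section \<open>Smith form and reversal\<close>

context completed_mat
begin

definition "completion_mat = mat q q (\<lambda>(c, l). if l < m then X l c else N (l - m) c)"
definition "completion_inv = mat q q (\<lambda>(l, c). if l < m then A $$ (l, c) else Y (l - m) c)"

lemma completion_carrier: "completion_mat \<in> carrier_mat q q" "completion_inv \<in> carrier_mat q q"
  by (auto simp: completion_mat_def completion_inv_def)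

lemma completion_left: "completion_mat * completion_inv = 1\<^sub>m q"
  by (rule eq_matI)
    (auto simp: completion_mat_def completion_inv_def scalar_prod_def lessThan_atLeast0[symmetric] sum_split_add XM_NY)

lemma completion_invertible: "invertible_mat completion_mat"
  unfolding invertible_mat_def inverts_mat_def
  using completion_carrier completion_left poly_mat_left_right_inverse[OF completion_carrier completion_left]
  by (auto intro!: exI[of _ completion_inv])

definition "trivial_smith = mat m q (\<lambda>(i, j). if i = j then 1 else (0 :: 'a poly))"

lemma A_completion: "A * completion_mat = trivial_smith"
proof (rule eq_matI)
  fix i l assume "i < dim_row trivial_smith" "l < dim_col trivial_smith"
  then have il: "i < m" "l < q" by (auto simp: trivial_smith_def)
  have "(A * completion_mat) $$ (i, l) = (\<Sum>c<q. A $$ (i, c) * (if l < m then X l c else N (l - m) c))"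
    using il A_carrier by (auto simp: completion_mat_def scalar_prod_def lessThan_atLeast0)
  also have "\<dots> = (if i = l then 1 else 0)"
    using il MX[of i l] MN[of i "l - m"] by (cases "l < m") auto
  finally show "(A * completion_mat) $$ (i, l) = trivial_smith $$ (i, l)" using il by (simp add: trivial_smith_def)
qed (use A_carrier in \<open>auto simp: trivial_smith_def completion_mat_def\<close>)

lemma is_smith_form_trivial: "is_smith_form A trivial_smith"
proof -
  have dims: "dim_row A = m" "dim_col A = q" using A_carrier by auto
  have "trivial_smith = 1\<^sub>m m * A * completion_mat" using A_completion A_carrier by simp
  moreover have "invertible_mat (1\<^sub>m m :: 'a poly mat)"
    unfolding invertible_mat_def inverts_mat_def by (auto intro!: exI[of _ "1\<^sub>m m"])
  ultimately have "\<exists>U V. U \<in> carrier_mat m m \<and> invertible_mat U \<and> V \<in> carrier_mat q q \<and> invertible_mat V \<and> trivial_smith = U * A * V"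
    using completion_carrier completion_invertible by (intro exI[of _ "1\<^sub>m m"] exI[of _ completion_mat]) auto
  then show ?thesis unfolding is_smith_form_def dims by (auto simp: trivial_smith_def)
qed

text \<open>Required by the definite description in \<open>invariant_polynomials\<close>. A Smith
  form D = U A V inherits a polynomial right inverse from \<open>A\<close>. As D is diagonal, each
  diagonal entry divides 1; being monic, it is 1.\<close>

lemma is_smith_form_unique:
  assumes "is_smith_form A D"
  shows "D = trivial_smith"
proof -
  have dims: "dim_row A = m" "dim_col A = q" using A_carrier by auto
  have mn: "min m q = m" by simp
  obtain U V where D: "D \<in> carrier_mat m q" "\<And>i j. i < m \<Longrightarrow> j < q \<Longrightarrow> i \<noteq> j \<Longrightarrow> D $$ (i, j) = 0"
    "\<And>i. i < m \<Longrightarrow> D $$ (i, i) = 0 \<or> lead_coeff (D $$ (i, i)) = 1"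
    and U: "U \<in> carrier_mat m m" "invertible_mat U" and V: "V \<in> carrier_mat q q" "invertible_mat V" and DU: "D = U * A * V"
    using assms unfolding is_smith_form_def dims mn by blast
  obtain U' where U': "U * U' = 1\<^sub>m m" "U' \<in> carrier_mat m m"
    using U unfolding invertible_mat_def inverts_mat_def
    by (metis carrier_matD carrier_matI index_mult_mat(2,3) index_one_mat(2,3))
  obtain V' where V': "V * V' = 1\<^sub>m q" "V' \<in> carrier_mat q q"
    using V unfolding invertible_mat_def inverts_mat_def
    by (metis carrier_matD carrier_matI index_mult_mat(2,3) index_one_mat(2,3))
  define X' where "X' = mat q m (\<lambda>(c, r). X r c)"
  have X': "X' \<in> carrier_mat q m" by (simp add: X'_def)
  have AX': "A * X' = 1\<^sub>m m"
    by (rule eq_matI) (use A_carrier MX in \<open>auto simp: X'_def scalar_prod_def lessThan_atLeast0[symmetric]\<close>)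
  have UA: "U * A \<in> carrier_mat m q" using U A_carrier by simp
  have XU: "X' * U' \<in> carrier_mat q m" using X' U' by simp
  have "D * V' = U * A * (V * V')" unfolding DU by (rule assoc_mult_mat[OF UA V(1) V'(2)])
  also have "\<dots> = U * A" unfolding V'(1) by (rule right_mult_one_mat[OF UA])
  finally have DV: "D * V' = U * A" .
  have "D * (V' * (X' * U')) = U * A * (X' * U')"
    unfolding DV[symmetric] by (rule assoc_mult_mat[symmetric, OF D(1) V'(2) XU])
  also have "\<dots> = U * A * X' * U'" by (rule assoc_mult_mat[symmetric, OF UA X' U'(2)])
  also have "U * A * X' = U * (A * X')" by (rule assoc_mult_mat[OF U(1) A_carrier X'])
  also have "U * (A * X') * U' = 1\<^sub>m m" using AX' U U' by simp
  finally have right: "D * (V' * (X' * U')) = 1\<^sub>m m" .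
  define Z where "Z = V' * (X' * U')"
  have Z: "Z \<in> carrier_mat q m" unfolding Z_def using V' X' U' by auto
  have "D $$ (i, i) = 1" if i: "i < m" for i
  proof -
    have "(D * Z) $$ (i, i) = (\<Sum>j<q. D $$ (i, j) * Z $$ (j, i))"
      using i D Z by (simp add: scalar_prod_def lessThan_atLeast0)
    also have "\<dots> = (\<Sum>j<q. if j = i then D $$ (i, i) * Z $$ (i, i) else 0)"
      by (intro sum.cong refl) (use D(2)[OF i] in auto)
    also have "\<dots> = D $$ (i, i) * Z $$ (i, i)" using i by simp
    finally have "D $$ (i, i) * Z $$ (i, i) = 1" using right i by (simp add: Z_def)
    then have u: "D $$ (i, i) dvd 1" by (metis dvd_triv_left)
    then have "D $$ (i, i) \<noteq> 0" by auto
    then have lc: "lead_coeff (D $$ (i, i)) = 1" using D(3)[OF i] by simp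
    obtain c where "D $$ (i, i) = [:c:]" using u unfolding is_unit_poly_iff by blast
    then show ?thesis using lc by (simp add: one_pCons)
  qed
  then show ?thesis
    by (intro eq_matI) (use D in \<open>auto simp: trivial_smith_def\<close>)
qed

lemma invariant_polynomials_eq: "invariant_polynomials A = replicate_mset m 1"
proof -
  have "(THE D. is_smith_form A D) = trivial_smith"
    using is_smith_form_trivial is_smith_form_unique by (rule the_equality)
  moreover have "image_mset (\<lambda>i. trivial_smith $$ (i, i)) (mset_set {..<m}) = image_mset (\<lambda>_. 1) (mset_set {..<m})"
    by (rule image_mset_cong) (simp add: trivial_smith_def)
  moreover have "dim_row A = m" "dim_col A = q" using A_carrier by auto
  moreover have "filter_mset (\<lambda>p. p \<noteq> 0) (replicate_mset l (1 :: 'a poly)) = replicate_mset l 1" for l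
    by (induction l) auto
  ultimately show ?thesis unfolding invariant_polynomials_def Let_def by (simp add: image_mset_const_eq)
qed

end

lemma finite_elementary_divisors_empty:
  fixes A :: "'a::field_gcd poly mat"
  assumes "completed_mat A m n d k t N X Y"
  shows "finite_elementary_divisors A = {#}"
proof -
  have "(\<Sum>p\<in>#replicate_mset l (1 :: 'a poly). image_mset (\<lambda>f. f ^ multiplicity f p) (mset_set (prime_factors p))) = {#}" for l
    by (induction l) auto
  then show ?thesis unfolding finite_elementary_divisors_def completed_mat.invariant_polynomials_eq[OF assms] by simp
qed

section \<open>Reversal of polynomials and of the multiplication map\<close>

lemma coeff_reversal: "Polynomial.coeff (reversal d p) i = (if i \<le> d then Polynomial.coeff p (d - i) else 0)"
  by (simp add: reversal_def coeff_sum)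

lemma reversal_0 [simp]: "reversal d 0 = 0"
  by (rule poly_eqI) (simp add: coeff_reversal)

lemma degree_reversal: "Polynomial.degree (reversal d p) \<le> d"
  by (rule degree_le) (simp add: coeff_reversal)

lemma reversal_reflect:
  "Polynomial.degree p \<le> d \<Longrightarrow> reversal d p = Polynomial.monom 1 (d - Polynomial.degree p) * reflect_poly (p :: 'a::field poly)"
  by (rule poly_eqI) (auto simp: coeff_reversal coeff_monom_mult coeff_reflect_poly coeff_eq_0)

text \<open>\<open>reflect_poly\<close> is multiplicative and reverses at the true degree. The
  missing powers of \<lambda>, the gaps between true degrees and the bounds d and e, add up under
  multiplication.\<close>

lemma reversal_mult:
  fixes p x :: "'a::field poly"
  assumes "Polynomial.degree p \<le> d" "Polynomial.degree x \<le> e"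
  shows "reversal (d + e) (p * x) = reversal d p * reversal e x"
proof (cases "p = 0 \<or> x = 0")
  case True
  then show ?thesis by auto
next
  case False
  then have dg: "Polynomial.degree (p * x) = Polynomial.degree p + Polynomial.degree x" by (simp add: degree_mult_eq)
  then have "reversal (d + e) (p * x) = Polynomial.monom 1 ((d - Polynomial.degree p) + (e - Polynomial.degree x)) * (reflect_poly p * reflect_poly x)"
    using assms by (subst reversal_reflect) (simp_all add: reflect_poly_mult)
  also have "Polynomial.monom 1 ((d - Polynomial.degree p) + (e - Polynomial.degree x)) =
      Polynomial.monom 1 (d - Polynomial.degree p) * (Polynomial.monom 1 (e - Polynomial.degree x) :: 'a poly)"
    by (simp add: mult_monom)
  finally show ?thesis using assms by (simp add: reversal_reflect mult_ac)
qed

lemma reversal_sum: "reversal d (\<Sum>i\<in>I. f i) = (\<Sum>i\<in>I. reversal d (f i))"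
  by (rule poly_eqI) (simp add: coeff_reversal coeff_sum)

definition reversed :: "nat \<Rightarrow> (nat \<Rightarrow> 'a::field poly) \<Rightarrow> nat \<Rightarrow> 'a poly" where
  "reversed l x = (\<lambda>c. reversal l (x c))"

lemma reversed_pvecs: "x \<in> pvecs q (Suc l) \<Longrightarrow> reversed l x \<in> pvecs q (Suc l)"
  by (auto simp: pvecs_def reversed_def coeff_reversal)

lemma reversed_reversed:
  assumes "x \<in> pvecs q (Suc l)"
  shows "reversed l (reversed l x) = x"
proof (rule ext, rule poly_eqI)
  fix c i show "Polynomial.coeff (reversed l (reversed l x) c) i = Polynomial.coeff (x c) i"
    using assms by (cases "i \<le> l") (auto simp: pvecs_def reversed_def coeff_reversal)
qed

lemma reversed_zero: "reversed l 0 = 0"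
  by (simp add: reversed_def fun_eq_iff)

lemma pmul_reversed:
  assumes M: "\<And>r c. r < m \<Longrightarrow> c < q \<Longrightarrow> Polynomial.degree (M r c) \<le> d" and x: "x \<in> pvecs q (Suc l)"
  shows "pmul m q (\<lambda>r c. reversal d (M r c)) (reversed l x) = reversed (d + l) (pmul m q M x)"
proof
  have dx: "Polynomial.degree (x c) \<le> l" for c
    using x by (intro degree_le) (auto simp: pvecs_def)
  fix r
  show "pmul m q (\<lambda>r c. reversal d (M r c)) (reversed l x) r = reversed (d + l) (pmul m q M x) r"
  proof (cases "r < m")
    case True
    then show ?thesis using M dx by (simp add: pmul_def reversed_def reversal_sum reversal_mult)
  qed (simp add: pmul_def reversed_def)
qed

text \<open>Reversing a vector with a fixed positive number of coefficients is an involution, and it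
  carries multiplication by \<open>M\<close> to multiplication by its reversal. Both conditions
  therefore transfer.\<close>

lemma (in balanced) balanced_reversal: "balanced (\<lambda>r c. reversal d (M r c)) m n d k t"
proof unfold_locales
  let ?F' = "pmul m q (\<lambda>r c. reversal d (M r c))"
  show "surjective_mult m q d (\<lambda>r c. reversal d (M r c)) k"
    unfolding surjective_mult_def
  proof
    fix y :: "nat \<Rightarrow> 'a poly" assume y: "y \<in> pvecs m (d + k)"
    have k: "k = Suc (k - 1)" using k0 by simp
    have y': "y \<in> pvecs m (Suc (d + (k - 1)))" using y k0 by simp
    have "reversed (d + (k - 1)) y \<in> pvecs m (d + k)" using reversed_pvecs[OF y'] k0 by simp
    then obtain x where x: "x \<in> pvecs q k" "F x = reversed (d + (k - 1)) y"
      using surj unfolding surjective_mult_def by metis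
    have x': "x \<in> pvecs q (Suc (k - 1))" using x k0 by simp
    have "?F' (reversed (k - 1) x) = y"
      using pmul_reversed[where M = M, OF degM x'] x(2) reversed_reversed[OF y'] by simp
    moreover have "reversed (k - 1) x \<in> pvecs q k" using reversed_pvecs[OF x'] k0 by simp
    ultimately show "\<exists>x\<in>pvecs q k. ?F' x = y" by blast
  qed
  show "injective_mult m q (\<lambda>r c. reversal d (M r c)) (k - 1)"
    unfolding injective_mult_def
  proof (intro ballI impI)
    fix x :: "nat \<Rightarrow> 'a poly" assume x: "x \<in> pvecs q (k - 1)" and 0: "?F' x = 0"
    show "x = 0"
    \<comment> \<open>K coefficients are reversed at degree K - 1, so the empty case K = 0 is
      treated apart.\<close>
    proof (cases "k - 1")
      case 0
      then show ?thesis using x by (auto simp: pvecs_def fun_eq_iff poly_eq_iff)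
    next
      case (Suc l)
      have x': "x \<in> pvecs q (Suc l)" using x Suc by simp
      have rx: "reversed l x \<in> pvecs q (Suc l)" using reversed_pvecs[OF x'] .
      have "reversed (d + l) (F (reversed l x)) = 0"
        using pmul_reversed[where M = M, OF degM rx] reversed_reversed[OF x'] 0 by simp
      moreover have "F (reversed l x) \<in> pvecs m (Suc (d + l))"
        using pmul_pvecs[where M = M, OF degM rx] by simp
      ultimately have "F (reversed l x) = 0" using reversed_reversed reversed_zero by metis
      then have "reversed l x = 0" using inj rx Suc by (simp add: injective_mult_def)
      then show ?thesis using reversed_reversed[OF x'] reversed_zero by metis
    qed
  qed
qed (use m0 k0 tn nk degree_reversal in auto)

lemma pmul_cong:
  "(\<And>r c. r < m \<Longrightarrow> c < q \<Longrightarrow> M r c = M' r c) \<Longrightarrow> pmul m q M = pmul m q M'"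
  by (auto simp: pmul_def fun_eq_iff)

lemma balanced_cong:
  assumes "balanced M m n d k t" "\<And>r c. r < m \<Longrightarrow> c < m + n \<Longrightarrow> M r c = M' r c"
  shows "balanced M' m n d k t"
proof -
  interpret balanced M m n d k t by (rule assms(1))
  have e: "pmul m q M' = F" using pmul_cong[of m q M M'] assms(2) by simp
  show ?thesis
    by unfold_locales
      (use degM m0 k0 tn nk surj inj assms(2) in \<open>auto simp: surjective_mult_def injective_mult_def e\<close>)
qed

lemma completed_mat_exists:
  fixes A :: "'a::field poly mat"
  assumes "A \<in> carrier_mat m (m + n)" "balanced (\<lambda>r c. A $$ (r, c)) m n d k t"
  shows "\<exists>N X Y. completed_mat A m n d k t N X Y"
  using balanced.completion_exists[OF assms(2)] assms(1)
  by (auto simp: completed_mat_def completed_mat_axioms_def)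

lemma eigenstructure_balanced:
  fixes A :: "'a::field_gcd poly mat"
  assumes A: "A \<in> carrier_mat m (m + n)" and b: "balanced (\<lambda>r c. A $$ (r, c)) m n d k t"
  shows "complete_eigenstructure d A = ({#}, {#}, {#}, replicate_mset t (k - 1) + replicate_mset (n - t) k)"
proof -
  obtain N X Y where c: "completed_mat A m n d k t N X Y" using completed_mat_exists[OF A b] by blast
  have "balanced (\<lambda>r c. map_mat (reversal d) A $$ (r, c)) m n d k t"
    by (rule balanced_cong[OF balanced.balanced_reversal[OF b]]) (use A in simp)
  moreover have "map_mat (reversal d) A \<in> carrier_mat m (m + n)" using A by simp
  ultimately obtain N' X' Y' where c': "completed_mat (map_mat (reversal d) A) m n d k t N' X' Y'"
    using completed_mat_exists by blast
  show ?thesis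
    unfolding complete_eigenstructure_def infinite_elementary_divisors_def
      finite_elementary_divisors_empty[OF c] finite_elementary_divisors_empty[OF c']
      completed_mat.left_minimal_indices_eq[OF c] completed_mat.right_minimal_indices_eq[OF c]
    by simp
qed

section \<open>A matrix with the generic eigenstructure\<close>

text \<open>Place \<open>breakpoint 0, \<dots>, breakpoint n\<close> in the interval \<open>[0, m d]\<close>, with gaps \<open>k - 1\<close> and \<open>k\<close>, and cut the
  interval into \<open>m\<close> blocks of length \<open>d\<close>. Columns are the \<open>m - 1\<close> inner block ends and the \<open>n + 1\<close> breakpoints,
  at position \<open>p\<close> say, rows are the blocks, and the entry of the row of a block with end \<open>e\<close> is \<open>\<lambda>^(e - p)\<close>
  in the columns incident to it (each breakpoint is assigned to one block). Multiplication then splits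
  into independent systems, one for every window of \<open>K\<close> consecutive integers: it is onto iff each window
  meeting \<open>[0, m d]\<close> contains a breakpoint, and injective iff none contains two.\<close>

locale witness =
  fixes m n d k t :: nat
  assumes m0: "0 < m" and d0: "0 < d" and k0: "0 < k" and tn: "t < n" and nk: "n * k = m * d + t"
begin

text \<open>Partial sums of the gaps, of which the first t have length k - 1 and the others k. The
  total n k - t is exactly m d.\<close>

definition breakpoint :: "nat \<Rightarrow> nat" where
  "breakpoint j = j * k - min j t"

text \<open>The minimum matters for the right end m d, a breakpoint that would otherwise fall into a
  block beyond the last one.\<close>

definition block :: "nat \<Rightarrow> nat" where
  "block j = min (m - 1) (breakpoint j div d)"

text \<open>Column c < m - 1 is the inner block end (c + 1) d. It is the end of block c, giving the
  entry 1, and lies d before the end of block c + 1, giving \<lambda>^d. Later columns are the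
  breakpoints with index c - (m - 1).\<close>

definition W :: "nat \<Rightarrow> nat \<Rightarrow> 'a::field poly" where
  "W r c = (if c < m - 1 then if r = c then 1 else if r = Suc c then Polynomial.monom 1 d else 0
     else if r = block (c - (m - 1)) then Polynomial.monom 1 (Suc r * d - breakpoint (c - (m - 1))) else 0)"

lemma breakpoint_0 [simp]: "breakpoint 0 = 0"
  by (simp add: breakpoint_def)

lemma breakpoint_Suc: "breakpoint (Suc j) = breakpoint j + (if j < t then k - 1 else k)"
proof -
  have "min j t \<le> j * k" using k0 by (metis le_trans min.cobounded1 mult.right_neutral mult_le_mono2 Suc_leI One_nat_def)
  then show ?thesis using k0 by (auto simp: breakpoint_def min_def)
qed

lemma breakpoint_n: "breakpoint n = m * d"
  using tn nk by (simp add: breakpoint_def min_def)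

lemma breakpoint_mono: "i \<le> j \<Longrightarrow> breakpoint i \<le> breakpoint j"
  by (induction j rule: nat_induct) (auto simp: breakpoint_Suc le_Suc_eq)

lemma breakpoint_gap: "i < j \<Longrightarrow> breakpoint i + (k - 1) \<le> breakpoint j"
  using breakpoint_mono[of "Suc i" j] by (auto simp: breakpoint_Suc split: if_splits)

lemma breakpoint_le: "j \<le> n \<Longrightarrow> breakpoint j \<le> m * d"
  using breakpoint_mono[of j n] breakpoint_n by simp

lemma block_less: "block j < m"
  using m0 by (simp add: block_def)

lemma block_bounds:
  assumes "j \<le> n"
  shows "block j * d \<le> breakpoint j" "breakpoint j \<le> Suc (block j) * d"
proof -
  have "breakpoint j div d * d \<le> breakpoint j" by simp
  moreover have "block j * d \<le> breakpoint j div d * d" by (intro mult_le_mono1) (simp add: block_def)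
  ultimately show "block j * d \<le> breakpoint j" by linarith
  show "breakpoint j \<le> Suc (block j) * d"
  proof (cases "breakpoint j div d < m - 1")
    case True
    have "breakpoint j < Suc (breakpoint j div d) * d"
      using d0 by (metis dividend_less_div_times mult_Suc add.commute)
    then show ?thesis using True by (simp add: block_def)
  next
    case False
    then have "Suc (block j) = m" using m0 by (simp add: block_def min_def)
    then show ?thesis using breakpoint_le[OF assms] by simp
  qed
qed

lemma degree_W: "r < m \<Longrightarrow> c < m + n \<Longrightarrow> Polynomial.degree (W r c :: 'a::field poly) \<le> d"
proof -
  assume "r < m" "c < m + n"
  moreover define j where "j = c - (m - 1)"
  moreover have "Suc r * d - breakpoint j \<le> d" if "r = block j"
  proof -
    have "j \<le> n" using \<open>c < m + n\<close> m0 unfolding j_def by linarith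
    then show ?thesis using that block_bounds(1)[of j] by simp
  qed
  ultimately show ?thesis by (auto simp: W_def simp del: One_nat_def intro!: order_trans[OF degree_monom_le])
qed

lemma pmul_monvec: "c < q \<Longrightarrow> pmul m q M (monvec c i) = (\<lambda>r. if r < m then M r c * Polynomial.monom 1 i else 0)"
  by (auto simp: pmul_def monvec_def fun_eq_iff if_distrib[of "\<lambda>x. _ * x"] cong: if_cong)

abbreviation "F \<equiv> pmul m (m + n) (W :: nat \<Rightarrow> nat \<Rightarrow> 'a::field poly)"

lemma F_interior: "c < m - 1 \<Longrightarrow> F (monvec c i) = monvec c i + (monvec (Suc c) (i + d) :: nat \<Rightarrow> 'a::field poly)"
  by (subst pmul_monvec) (auto simp: W_def monvec_def fun_eq_iff mult_monom add.commute)

lemma F_break: "j \<le> n \<Longrightarrow> F (monvec (m - 1 + j) i) =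
    (monvec (block j) (Suc (block j) * d - breakpoint j + i) :: nat \<Rightarrow> 'a::field poly)"
  using m0 block_less[of j] by (subst pmul_monvec) (auto simp: W_def monvec_def fun_eq_iff mult_monom)

text \<open>Assign to \<lambda>^s in row r the integer (r + 1) d - s. The two terms produced by an
  interior column have the same integer, so modulo the image a monomial can be moved to a
  neighbouring row with only a change of sign. The hypotheses say that breakpoint j lies in the
  window of k integers starting there; once the monomial reaches row \<open>block j\<close>, the
  column of that breakpoint produces it.\<close>

lemma monvec_in_image:
  assumes "j \<le> n" "r < m" "s < d + k" "Suc r * d \<le> breakpoint j + s" "breakpoint j + s < Suc r * d + k"
  shows "monvec r s \<in> pmul m (m + n) (W :: nat \<Rightarrow> nat \<Rightarrow> 'a::field poly) ` pvecs (m + n) k"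
  using assms(2-)
proof (induction "if r \<le> block j then block j - r else r - block j" arbitrary: r s rule: less_induct)
  case less
  note b = block_bounds[OF assms(1)]
  let ?I = "pmul m (m + n) (W :: nat \<Rightarrow> nat \<Rightarrow> 'a poly) ` pvecs (m + n) k"
  have sub: "pvs.subspace ?I"
    by (intro pvs2.linear_subspace_image linear_pmul subspace_pvecs)
  consider "r = block j" | "r < block j" | "block j < r" by linarith
  then show ?case
  proof cases
    case 1
    \<comment> \<open>The distance from the window start to the breakpoint; it is below k, as the
      argument space demands.\<close>
    define i where "i = breakpoint j + s - Suc r * d"
    have "Suc (block j) * d - breakpoint j + i = s" using less.prems b 1 by (simp add: i_def)
    then have "monvec r s = F (monvec (m - 1 + j) i :: nat \<Rightarrow> 'a poly)" using F_break[OF assms(1)] 1 by metis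
    moreover have "monvec (m - 1 + j) i \<in> pvecs (m + n) k"
      using less.prems assms(1) m0 by (intro monvec_pvecs) (auto simp: i_def)
    ultimately show ?thesis by (metis image_eqI)
  next
    case 2
    have "Suc r * d \<le> block j * d" using 2 by (intro mult_le_mono1) simp
    \<comment> \<open>The breakpoint lies at or beyond the end of block r, so the window bound
      leaves s < k and column r may be used with exponent s.\<close>
    then have s: "s < k" using b less.prems by linarith
    have r: "r < m - 1" using 2 block_less[of j] by linarith
    have "monvec (Suc r) (s + d) \<in> ?I"
      by (rule less.hyps) (use less.prems 2 r s in \<open>auto simp: add.commute\<close>)
    moreover have "F (monvec r s) \<in> ?I" by (intro imageI monvec_pvecs) (use s r in auto)
    ultimately have "F (monvec r s) - monvec (Suc r) (s + d) \<in> ?I" by (intro pvs.subspace_diff[OF sub])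
    then show ?thesis by (simp add: F_interior[OF r])
  next
    case 3
    then obtain r' where r': "r = Suc r'" by (cases r) auto
    have "Suc (block j) * d \<le> r * d" using 3 by (intro mult_le_mono1) simp
    \<comment> \<open>Here the breakpoint lies at or before the start of block r, so the exponent
      can drop by d on passing to the previous row.\<close>
    then have s: "d \<le> s" using b less.prems by simp
    have rm: "r' < m - 1" using less.prems r' by simp
    have "monvec r' (s - d) \<in> ?I"
      by (rule less.hyps) (use less.prems 3 r' s in \<open>auto split: if_splits\<close>)
    moreover have "F (monvec r' (s - d)) \<in> ?I"
      by (intro imageI monvec_pvecs) (use less.prems s rm in auto)
    ultimately have "F (monvec r' (s - d)) - monvec r' (s - d) \<in> ?I" by (intro pvs.subspace_diff[OF sub])
    then show ?thesis using s by (simp add: F_interior[OF rm] r')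
  qed
qed

text \<open>Take the first breakpoint not before the window. Its predecessor is before the window
  and gaps are at most k, so it is inside; for index 0 the bound s < d + k does the same.\<close>

lemma breakpoint_in_window:
  assumes "r < m" "s < d + k"
  obtains j where "j \<le> n" "Suc r * d \<le> breakpoint j + s" "breakpoint j + s < Suc r * d + k"
proof -
  define P where "P = (\<lambda>j. Suc r * d \<le> breakpoint j + s)"
  define j where "j = (LEAST j. P j)"
  have "Suc r * d \<le> m * d" using assms by (intro mult_le_mono1) simp
  then have Pn: "P n" by (simp add: P_def breakpoint_n)
  then have "P j" "j \<le> n" unfolding j_def by (rule LeastI, rule Least_le)
  moreover have "breakpoint j + s < Suc r * d + k"
  proof (cases j)
    case 0
    then show ?thesis using assms by simp
  next
    case (Suc i)
    then have "\<not> P i" using not_less_Least[of i P] unfolding j_def by auto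
    then show ?thesis using Suc k0 by (auto simp: P_def breakpoint_Suc)
  qed
  ultimately show ?thesis using that by (simp add: P_def)
qed

lemma surjective_W: "surjective_mult m (m + n) d (W :: nat \<Rightarrow> nat \<Rightarrow> 'a::field poly) k"
  unfolding surjective_mult_def
proof
  let ?I = "pmul m (m + n) (W :: nat \<Rightarrow> nat \<Rightarrow> 'a poly) ` pvecs (m + n) k"
  have sub: "pvs.subspace ?I"
    by (intro pvs2.linear_subspace_image linear_pmul subspace_pvecs)
  fix y :: "nat \<Rightarrow> 'a poly" assume "y \<in> pvecs m (d + k)"
  then have "y = (\<Sum>(r,s)\<in>{..<m}\<times>{..<d + k}. pscale (Polynomial.coeff (y r) s) (monvec r s))"
    by (rule pvecs_expand)
  also have "\<dots> \<in> ?I"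
  proof (rule pvs.subspace_sum[OF sub])
    fix p assume "p \<in> {..<m} \<times> {..<d + k}"
    then obtain r s where p: "p = (r, s)" and rs: "r < m" "s < d + k" by auto
    obtain j where "j \<le> n" "Suc r * d \<le> breakpoint j + s" "breakpoint j + s < Suc r * d + k"
      using breakpoint_in_window[OF rs] .
    then have "monvec r s \<in> ?I" using monvec_in_image rs by blast
    then show "(case p of (r, s) \<Rightarrow> pscale (Polynomial.coeff (y r) s) (monvec r s)) \<in> ?I"
      unfolding p prod.case by (rule pvs.subspace_scale[OF sub])
  qed
  finally have "y \<in> ?I" .
  then show "\<exists>x\<in>pvecs (m + n) k. F x = y" by (metis imageE)
qed

lemma W_break: "W r (m - 1 + j) = (if r = block j then Polynomial.monom 1 (Suc r * d - breakpoint j) else 0)"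
  by (simp add: W_def)

text \<open>This combination of the rows eliminates the block-end columns.\<close>

lemma column_sum:
  assumes "c < m + n"
  shows "(\<Sum>r<m. (- 1) ^ r * Polynomial.monom 1 ((m - Suc r) * d) * W r c) =
    (if c < m - 1 then 0
     else (- 1) ^ block (c - (m - 1)) * Polynomial.monom 1 (m * d - breakpoint (c - (m - 1))) :: 'a::field poly)"
    (is "(\<Sum>r<m. ?f r) = _")
proof (cases "c < m - 1")
  case True
  have e: "(m - Suc c) * d = (m - Suc (Suc c)) * d + d"
    using True by (metis Suc_diff_Suc add.commute less_diff_conv mult_Suc plus_1_eq_Suc)
  have "(\<Sum>r<m. ?f r) = (\<Sum>r\<in>{c, Suc c}. ?f r)"
    using True by (intro sum.mono_neutral_right) (auto simp: W_def)
  also have "\<dots> = 0" using True by (simp add: W_def e mult_monom)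
  finally show ?thesis using True by simp
next
  case False
  define j where "j = c - (m - 1)"
  have j: "j \<le> n" and c: "c = m - 1 + j" using assms False m0 by (auto simp: j_def)
  have "(\<Sum>r<m. ?f r) = (\<Sum>r\<in>{block j}. ?f r)"
    unfolding c W_break using block_less[of j] by (intro sum.mono_neutral_right) auto
  also have "\<dots> = (- 1) ^ block j * Polynomial.monom 1 ((m - Suc (block j)) * d + (Suc (block j) * d - breakpoint j))"
    unfolding c W_break by (simp add: mult_monom mult.assoc)
  also have "(m - Suc (block j)) * d + (Suc (block j) * d - breakpoint j) = m * d - breakpoint j"
  proof -
    have "(m - Suc (block j)) * d + Suc (block j) * d = m * d"
      using block_less[of j] by (metis Suc_leI distrib_right le_add_diff_inverse2)
    then show ?thesis using block_bounds(2)[OF j] by linarith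
  qed
  finally show ?thesis using False unfolding j_def by simp
qed

text \<open>The alternating row combination leaves a vanishing sum of the breakpoint components,
  each multiplied by a sign and \<lambda>^(m d - p) for its position p. Positions differ by at least
  k - 1 and each component has at most k - 1 coefficients, so the terms occupy disjoint exponents
  and vanish separately.\<close>

lemma injective_W: "injective_mult m (m + n) (W :: nat \<Rightarrow> nat \<Rightarrow> 'a::field poly) (k - 1)"
  unfolding injective_mult_def
proof (intro ballI impI)
  fix x :: "nat \<Rightarrow> 'a poly" assume x: "x \<in> pvecs (m + n) (k - 1)" and F0: "F x = 0"
  have row: "(\<Sum>c<m + n. W r c * x c) = 0" if "r < m" for r
    using fun_cong[OF F0, of r] that by (simp add: pmul_def)
  have "0 = (\<Sum>r<m. (- 1) ^ r * Polynomial.monom 1 ((m - Suc r) * d) * (\<Sum>c<m + n. W r c * x c))"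
    by (simp add: row)
  also have "\<dots> = (\<Sum>c<m + n. (\<Sum>r<m. (- 1) ^ r * Polynomial.monom 1 ((m - Suc r) * d) * W r c) * x c)"
    by (simp add: sum_distrib_left sum_distrib_right mult.assoc) (rule sum.swap)
  finally have tel: "(\<Sum>c<m + n. (\<Sum>r<m. (- 1) ^ r * Polynomial.monom 1 ((m - Suc r) * d) * W r c) * x c) = 0" ..
  have breaks: "x (m - 1 + j) = 0" if j: "j \<le> n" for j
  proof (rule poly_eqI)
    fix i
    show "Polynomial.coeff (x (m - 1 + j)) i = Polynomial.coeff 0 i"
    proof (cases "i < k - 1")
      case False
      then show ?thesis using x by (simp add: pvecs_def)
    next
      case i: True
      \<comment> \<open>The exponent at which coefficient i of the component of breakpoint j lands;
        no other component reaches it.\<close>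
      define l where "l = m * d - breakpoint j + i"
      have sgn: "Polynomial.coeff ((- 1) ^ a * p) l = (- 1) ^ a * Polynomial.coeff p l" for a and p :: "'a poly"
        by (cases "even a") auto
      have "0 = (\<Sum>c<m + n. Polynomial.coeff ((\<Sum>r<m. (- 1) ^ r * Polynomial.monom 1 ((m - Suc r) * d) * W r c) * x c) l)"
        using arg_cong[OF tel, of "\<lambda>p. Polynomial.coeff p l"] by (simp add: coeff_sum)
      also have "\<dots> = (\<Sum>c<m + n. if c = m - 1 + j then (- 1) ^ block j * Polynomial.coeff (x c) i else 0)"
      proof (intro sum.cong refl)
        fix c assume "c \<in> {..<m + n}"
        then have c: "c < m + n" by simp
        show "Polynomial.coeff ((\<Sum>r<m. (- 1) ^ r * Polynomial.monom 1 ((m - Suc r) * d) * W r c) * x c) l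
          = (if c = m - 1 + j then (- 1) ^ block j * Polynomial.coeff (x c) i else 0)"
        proof (cases "c < m - 1")
          case True
          then have "c \<noteq> m - 1 + j" by linarith
          then show ?thesis using True by (simp add: column_sum[OF c] del: One_nat_def)
        next
          case False
          define j' where "j' = c - (m - 1)"
          have cj: "c = m - 1 + j'" and j': "j' \<le> n" using False c m0 by (auto simp: j'_def)
          have le: "breakpoint j \<le> m * d" "breakpoint j' \<le> m * d" using breakpoint_le j j' by auto
          have "Polynomial.coeff ((\<Sum>r<m. (- 1) ^ r * Polynomial.monom 1 ((m - Suc r) * d) * W r c) * x c) l
            = (- 1) ^ block j' * (if m * d - breakpoint j' \<le> l then Polynomial.coeff (x c) (l - (m * d - breakpoint j')) else 0)"
            using False by (simp only: column_sum[OF c] j'_def[symmetric] if_False) (simp add: mult.assoc sgn coeff_monom_mult)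
          also have "\<dots> = (if c = m - 1 + j then (- 1) ^ block j * Polynomial.coeff (x c) i else 0)"
          proof -
            consider "j' = j" | "j' < j" | "j < j'" by linarith
            then show ?thesis
            proof cases
              case 1
              then show ?thesis by (simp add: cj l_def)
            next
              case 2
              then have "\<not> m * d - breakpoint j' \<le> l" using breakpoint_gap[OF 2] le i by (simp add: l_def)
              then show ?thesis using 2 by (simp add: cj)
            next
              case 3
              then have "k - 1 \<le> l - (m * d - breakpoint j')" using breakpoint_gap[OF 3] le i by (simp add: l_def)
              then have "Polynomial.coeff (x c) (l - (m * d - breakpoint j')) = 0" using x by (simp add: pvecs_def)
              then show ?thesis using 3 by (simp add: cj)
            qed
          qed
          finally show ?thesis .
        qed
      qed
      also have "\<dots> = (- 1) ^ block j * Polynomial.coeff (x (m - 1 + j)) i" using j m0 by simp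
      finally show ?thesis by simp
    qed
  qed
  \<comment> \<open>With the breakpoint components gone, row 0 reads x_0 = 0 and row c + 1 reads
    x_(c+1) + \<lambda>^d x_c = 0.\<close>
  have "x c = 0" if "c < m - 1" for c
    using that
  proof (induction c)
    case 0
    have "(\<Sum>c<m + n. W 0 c * x c) = (\<Sum>c<m + n. if c = 0 then x 0 else 0)"
    proof (intro sum.cong refl)
      fix c assume "c \<in> {..<m + n}"
      then show "W 0 c * x c = (if c = 0 then x 0 else 0)"
        using 0 breaks[of "c - (m - 1)"] by (cases "c < m - 1") (auto simp: W_def)
    qed
    then show ?case using row[of 0] m0 by simp
  next
    case (Suc c)
    have "(\<Sum>i<m + n. W (Suc c) i * x i) = (\<Sum>i<m + n. if i = Suc c then x (Suc c) else 0)"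
    proof (intro sum.cong refl)
      fix i assume "i \<in> {..<m + n}"
      then show "W (Suc c) i * x i = (if i = Suc c then x (Suc c) else 0)"
        using Suc breaks[of "i - (m - 1)"] by (cases "i < m - 1") (auto simp: W_def)
    qed
    moreover have "Suc c < m" "Suc c < m + n" using Suc.prems by linarith+
    ultimately show ?case using row[of "Suc c"] by simp
  qed
  moreover have "x c = 0" if "m - 1 \<le> c" for c
  proof (cases "c < m + n")
    case True
    then show ?thesis using breaks[of "c - (m - 1)"] that by simp
  qed (use x in \<open>simp add: pvecs_def\<close>)
  ultimately have "x c = 0" for c by (meson not_less)
  then show "x = 0" by (simp add: fun_eq_iff)
qed

end

section \<open>Genericity\<close>

definition monomial_value :: "(nat \<Rightarrow>\<^sub>0 nat) \<Rightarrow> real vec \<Rightarrow> real" where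
  "monomial_value e x = (\<Prod>i\<in>Poly_Mapping.keys e. (x $ i) ^ Poly_Mapping.lookup e i)"

lemma mpoly_eval_superset:
  assumes "finite S" "Poly_Mapping.keys f \<subseteq> S"
  shows "mpoly_eval f x = (\<Sum>e\<in>S. Poly_Mapping.lookup f e * monomial_value e x)"
  unfolding mpoly_eval_def monomial_value_def
  by (rule sum.mono_neutral_left) (use assms in \<open>auto simp: in_keys_iff\<close>)

lemma mpoly_eval_add: "mpoly_eval (f + g) x = mpoly_eval f x + mpoly_eval g x"
proof -
  let ?S = "Poly_Mapping.keys f \<union> Poly_Mapping.keys g"
  have "mpoly_eval (f + g) x = (\<Sum>e\<in>?S. Poly_Mapping.lookup (f + g) e * monomial_value e x)"
    by (rule mpoly_eval_superset) (simp_all add: Poly_Mapping.keys_add)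
  also have "\<dots> = (\<Sum>e\<in>?S. Poly_Mapping.lookup f e * monomial_value e x) + (\<Sum>e\<in>?S. Poly_Mapping.lookup g e * monomial_value e x)"
    by (simp add: lookup_add distrib_right sum.distrib)
  also have "\<dots> = mpoly_eval f x + mpoly_eval g x"
    by (simp add: mpoly_eval_superset[of ?S f] mpoly_eval_superset[of ?S g])
  finally show ?thesis .
qed

lemma mpoly_eval_single: "mpoly_eval (Poly_Mapping.single e c) x = c * monomial_value e x"
  by (subst mpoly_eval_superset[of "{e}"]) auto

lemma monomial_value_superset:
  assumes "finite S" "Poly_Mapping.keys e \<subseteq> S"
  shows "monomial_value e x = (\<Prod>i\<in>S. (x $ i) ^ Poly_Mapping.lookup e i)"
  unfolding monomial_value_def
  by (rule prod.mono_neutral_left) (use assms in \<open>auto simp: in_keys_iff\<close>)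

lemma monomial_value_add: "monomial_value (a + b) x = monomial_value a x * monomial_value b x"
proof -
  let ?S = "Poly_Mapping.keys a \<union> Poly_Mapping.keys b"
  have "monomial_value (a + b) x = (\<Prod>i\<in>?S. (x $ i) ^ Poly_Mapping.lookup (a + b) i)"
    by (rule monomial_value_superset) (simp_all add: Poly_Mapping.keys_add)
  then show ?thesis
    by (simp add: lookup_add power_add prod.distrib monomial_value_superset[of ?S a] monomial_value_superset[of ?S b])
qed

text \<open>Represented functions are closed under sums and products, so determinants can be treated
  as functions without building the polynomial that represents them.\<close>

definition polynomial_function :: "nat \<Rightarrow> (real vec \<Rightarrow> real) \<Rightarrow> bool" where
  "polynomial_function p g \<longleftrightarrow> (\<exists>f\<in>mpolys p. \<forall>x\<in>carrier_vec p. mpoly_eval f x = g x)"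

lemma polynomial_function_monomial:
  assumes "Poly_Mapping.keys e \<subseteq> {..<p}"
  shows "polynomial_function p (\<lambda>x. c * monomial_value e x)"
  unfolding polynomial_function_def
  by (rule bexI[of _ "Poly_Mapping.single e c"]) (use assms in \<open>auto simp: mpoly_eval_single mpolys_def split: if_splits\<close>)

lemma polynomial_function_const: "polynomial_function p (\<lambda>_. c)"
  using polynomial_function_monomial[of 0 p c] by (simp add: monomial_value_def)

lemma polynomial_function_coord: "i < p \<Longrightarrow> polynomial_function p (\<lambda>x. x $ i)"
  using polynomial_function_monomial[of "Poly_Mapping.single i 1" p 1] by (simp add: monomial_value_def)

lemma polynomial_function_add:
  assumes "polynomial_function p g" "polynomial_function p h"
  shows "polynomial_function p (\<lambda>x. g x + h x)"
proof -
  obtain f f' where f: "f \<in> mpolys p" "\<forall>x\<in>carrier_vec p. mpoly_eval f x = g x"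
    "f' \<in> mpolys p" "\<forall>x\<in>carrier_vec p. mpoly_eval f' x = h x"
    using assms by (auto simp: polynomial_function_def)
  then have "f + f' \<in> mpolys p" using Poly_Mapping.keys_add[of f f'] unfolding mpolys_def by blast
  then show ?thesis unfolding polynomial_function_def using f by (auto simp: mpoly_eval_add intro!: bexI[of _ "f + f'"])
qed

lemma polynomial_function_sum:
  "(\<And>i. i \<in> I \<Longrightarrow> polynomial_function p (g i)) \<Longrightarrow> polynomial_function p (\<lambda>x. \<Sum>i\<in>I. g i x)"
  by (induction I rule: infinite_finite_induct) (auto simp: polynomial_function_const polynomial_function_add)

lemma polynomial_function_cong:
  "polynomial_function p g \<Longrightarrow> (\<And>x. x \<in> carrier_vec p \<Longrightarrow> g x = h x) \<Longrightarrow> polynomial_function p h"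
  by (auto simp: polynomial_function_def)

lemma polynomial_function_mult:
  assumes "polynomial_function p g" "polynomial_function p h"
  shows "polynomial_function p (\<lambda>x. g x * h x)"
proof -
  obtain f f' where f: "f \<in> mpolys p" "\<forall>x\<in>carrier_vec p. mpoly_eval f x = g x"
    "f' \<in> mpolys p" "\<forall>x\<in>carrier_vec p. mpoly_eval f' x = h x"
    using assms by (auto simp: polynomial_function_def)
  have "polynomial_function p (\<lambda>x. \<Sum>e\<in>Poly_Mapping.keys f. \<Sum>e'\<in>Poly_Mapping.keys f'.
      (Poly_Mapping.lookup f e * Poly_Mapping.lookup f' e') * monomial_value (e + e') x)"
  proof (intro polynomial_function_sum polynomial_function_monomial)
    fix e e' assume "e \<in> Poly_Mapping.keys f" "e' \<in> Poly_Mapping.keys f'"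
    then show "Poly_Mapping.keys (e + e') \<subseteq> {..<p}"
      using f(1,3) Poly_Mapping.keys_add[of e e'] by (fastforce simp: mpolys_def)
  qed
  moreover have "(\<Sum>e\<in>Poly_Mapping.keys f. \<Sum>e'\<in>Poly_Mapping.keys f'.
      (Poly_Mapping.lookup f e * Poly_Mapping.lookup f' e') * monomial_value (e + e') x) = g x * h x"
    if "x \<in> carrier_vec p" for x
  proof -
    have "g x * h x = mpoly_eval f x * mpoly_eval f' x" using f that by simp
    then show ?thesis
      unfolding mpoly_eval_def monomial_value_def[symmetric] sum_product monomial_value_add
      by (simp add: mult_ac)
  qed
  ultimately show ?thesis by (rule polynomial_function_cong)
qed

text \<open>Common interface to the real and the complex case: \<open>Q\<close> is a ring of
  functions on real coordinate space with values in the coefficient field, and each of its members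
  has a real algebraic zero set.\<close>

locale coordinate_functions =
  fixes p :: nat and Q :: "(real vec \<Rightarrow> 'a::field) \<Rightarrow> bool"
  assumes Q_const: "\<And>c. Q (\<lambda>_. c)"
    and Q_add: "\<And>f g. Q f \<Longrightarrow> Q g \<Longrightarrow> Q (\<lambda>x. f x + g x)"
    and Q_mult: "\<And>f g. Q f \<Longrightarrow> Q g \<Longrightarrow> Q (\<lambda>x. f x * g x)"
    and Q_zeros: "\<And>f. Q f \<Longrightarrow> algebraic_set p {x \<in> carrier_vec p. f x = 0}"
begin

lemma Q_sum: "(\<And>i. i \<in> I \<Longrightarrow> Q (g i)) \<Longrightarrow> Q (\<lambda>x. \<Sum>i\<in>I. g i x)"
  by (induction I rule: infinite_finite_induct) (auto simp: Q_const Q_add)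

lemma Q_prod: "(\<And>i. i \<in> I \<Longrightarrow> Q (g i)) \<Longrightarrow> Q (\<lambda>x. \<Prod>i\<in>I. g i x)"
  by (induction I rule: infinite_finite_induct) (auto simp: Q_const Q_mult)

lemma Q_det:
  assumes "\<And>i j. i < N \<Longrightarrow> j < N \<Longrightarrow> Q (\<lambda>x. A x i j)"
  shows "Q (\<lambda>x. Determinant.det (mat N N (\<lambda>(i, j). A x i j)))"
proof -
  have "Q (\<lambda>x. \<Sum>\<pi>\<in>{\<pi>. \<pi> permutes {0..<N}}. signof \<pi> * (\<Prod>i\<in>{0..<N}. A x i (\<pi> i)))"
  proof (intro Q_sum Q_mult Q_const Q_prod assms)
    fix \<pi> i assume "\<pi> \<in> {\<pi>. \<pi> permutes {0..<N}}" "i \<in> {0..<N}"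
    then show "i < N" "\<pi> i < N" using permutes_in_image[of \<pi> "{0..<N}" i] by auto
  qed
  moreover have "Determinant.det (mat N N (\<lambda>(i, j). A x i j)) =
    (\<Sum>\<pi>\<in>{\<pi>. \<pi> permutes {0..<N}}. signof \<pi> * (\<Prod>i\<in>{0..<N}. A x i (\<pi> i)))" for x
  proof -
    have "(\<Prod>i\<in>{0..<N}. mat N N (\<lambda>(i, j). A x i j) $$ (i, \<pi> i)) = (\<Prod>i\<in>{0..<N}. A x i (\<pi> i))"
      if "\<pi> permutes {0..<N}" for \<pi>
      by (rule prod.cong) (use permutes_in_image[OF that] in auto)
    then show ?thesis by (subst det_def'[of _ N]) (auto intro!: sum.cong)
  qed
  ultimately show ?thesis by simp
qed

lemma generic_set_nonzero:
  assumes "Q f" "base \<in> carrier_vec p" "f base \<noteq> 0" "S \<subseteq> carrier_vec p"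
    and "\<And>x. x \<in> carrier_vec p \<Longrightarrow> f x \<noteq> 0 \<Longrightarrow> x \<in> S"
  shows "generic_set p S"
  unfolding generic_set_def
  by (intro conjI exI[of _ "{x \<in> carrier_vec p. f x = 0}"]) (use assms Q_zeros in auto)

end

section \<open>Surjectivity and injectivity as open conditions\<close>

lemma split_index_bound: "l < m * D \<Longrightarrow> l div D < m \<and> l mod D < D" for l m D :: nat
  by (metis less_mult_imp_div_less mod_less_divisor mult_0_right not_less_zero gr0I)

lemma split_index: "r < m \<Longrightarrow> s < D \<Longrightarrow> r * D + s < m * D \<and> (r * D + s) div D = r \<and> (r * D + s) mod D = s"
  for r s m D :: nat
  by (simp add: mult.commute) (metis add.commute add_less_mono1 less_le_trans mult.commute mult_Suc mult_le_mono1 Suc_leI)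

lemma sum_split_index:
  fixes f :: "nat \<Rightarrow> nat \<Rightarrow> 'b::comm_monoid_add"
  shows "(\<Sum>l<m * D. f (l div D) (l mod D)) = (\<Sum>(r,s)\<in>{..<m}\<times>{..<D}. f r s)"
  by (rule sum.reindex_bij_witness[of _ "\<lambda>(r,s). r * D + s" "\<lambda>l. (l div D, l mod D)"])
    (auto dest: split_index_bound simp: split_index)

lemma coeff_pmul:
  assumes "r < m"
  shows "Polynomial.coeff (pmul m q M u r) s = (\<Sum>c<q. \<Sum>i\<le>s. Polynomial.coeff (M r c) i * Polynomial.coeff (u c) (s - i))"
  using assms by (simp add: pmul_def coeff_sum coeff_mult)

context coordinate_functions
begin

context
  fixes M :: "real vec \<Rightarrow> nat \<Rightarrow> nat \<Rightarrow> 'a poly" and m q d :: nat and base :: "real vec"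
  assumes degM: "\<And>x r c. x \<in> carrier_vec p \<Longrightarrow> r < m \<Longrightarrow> c < q \<Longrightarrow> Polynomial.degree (M x r c) \<le> d"
    and QM: "\<And>r c i. r < m \<Longrightarrow> c < q \<Longrightarrow> Q (\<lambda>x. Polynomial.coeff (M x r c) i)"
    and base: "base \<in> carrier_vec p"
begin

lemma Q_pmul: "r < m \<Longrightarrow> Q (\<lambda>x. Polynomial.coeff (pmul m q (M x) u r) s)"
  unfolding coeff_pmul by (intro Q_sum Q_mult Q_const QM) auto

text \<open>At \<open>base\<close> the matrix whose determinant is taken is the identity, here and for injectivity.\<close>

lemma surjective_mult_open:
  assumes "surjective_mult m q d (M base) K"
  obtains f where "Q f" "f base \<noteq> 0"
    "\<And>x. x \<in> carrier_vec p \<Longrightarrow> f x \<noteq> 0 \<Longrightarrow> surjective_mult m q d (M x) K"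
proof -
  define D where "D = d + K"
  define N where "N = m * D"
  \<comment> \<open>Preimages under the base matrix of all monomial vectors of the target. They stay
    fixed while x varies; wherever the determinant is nonzero, their images under the matrix at x
    still span the target.\<close>
  have "\<exists>u\<in>pvecs q K. pmul m q (M base) u = monvec (l div D) (l mod D)" if "l < N" for l
    using assms split_index_bound[of l m D] that unfolding surjective_mult_def N_def D_def
    by (meson monvec_pvecs)
  then obtain u where u: "\<And>l. l < N \<Longrightarrow> u l \<in> pvecs q K"
    "\<And>l. l < N \<Longrightarrow> pmul m q (M base) (u l) = monvec (l div D) (l mod D)" by metis
  define T where "T x i j = Polynomial.coeff (pmul m q (M x) (u j) (i div D)) (i mod D)" for x i j
  define A where "A x = mat N N (\<lambda>(i, j). T x i j)" for x
  define f where "f x = Determinant.det (A x)" for x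
  have "Q f" unfolding f_def A_def T_def
    by (intro Q_det Q_pmul) (auto simp: N_def dest: split_index_bound)
  moreover have "f base \<noteq> 0"
  proof -
    have "A base = 1\<^sub>m N"
    proof (rule eq_matI)
      fix i j assume "i < dim_row (1\<^sub>m N)" "j < dim_col (1\<^sub>m N)"
      then have "i < N" "j < N" by auto
      moreover have "i = j" if "i div D = j div D" "i mod D = j mod D" using that by (metis div_mult_mod_eq)
      ultimately show "A base $$ (i, j) = 1\<^sub>m N $$ (i, j)"
        by (auto simp: A_def T_def u monvec_def)
    qed (auto simp: A_def)
    then show ?thesis by (simp add: f_def)
  qed
  moreover have "surjective_mult m q d (M x) K" if x: "x \<in> carrier_vec p" "f x \<noteq> 0" for x
    unfolding surjective_mult_def
  proof
    fix y :: "nat \<Rightarrow> 'a poly" assume y: "y \<in> pvecs m (d + K)"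
    have cA: "A x \<in> carrier_mat N N" by (simp add: A_def)
    then have "A x \<in> Units (ring_mat TYPE('a) N ())" using x(2) det_non_zero_imp_unit[OF cA] by (simp add: f_def)
    then obtain B where B: "B \<in> carrier_mat N N" "A x * B = 1\<^sub>m N"
      by (auto simp: Units_def ring_mat_def)
    define yv where "yv = vec N (\<lambda>l. Polynomial.coeff (y (l div D)) (l mod D))"
    define z where "z = B *\<^sub>v yv"
    have z: "z \<in> carrier_vec N" using B by (simp add: z_def yv_def)
    have "A x *\<^sub>v z = (A x * B) *\<^sub>v yv" unfolding z_def
      by (rule assoc_mult_mat_vec[symmetric, OF cA B(1)]) (simp add: yv_def)
    then have Az: "A x *\<^sub>v z = yv" using B by (simp add: yv_def)
    define w where "w = (\<Sum>j<N. pscale (z $ j) (u j))"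
    have w: "w \<in> pvecs q K" unfolding w_def
      by (intro pvs.subspace_sum[OF subspace_pvecs] pvs.subspace_scale[OF subspace_pvecs] u) auto
    interpret P: Vector_Spaces.linear pscale pscale "pmul m q (M x)" by (rule linear_pmul)
    have "pmul m q (M x) w r = y r" for r
    proof (rule poly_eqI)
      fix s
      have Fw: "pmul m q (M x) w \<in> pvecs m (d + K)" by (rule pmul_pvecs[OF degM[OF x(1)] w])
      show "Polynomial.coeff (pmul m q (M x) w r) s = Polynomial.coeff (y r) s"
      proof (cases "r < m \<and> s < D")
        case True
        define l where "l = r * D + s"
        have l: "l < N" "l div D = r" "l mod D = s" using split_index[of r m s D] True by (auto simp: l_def N_def)
        have "Polynomial.coeff (pmul m q (M x) w r) s = (\<Sum>j<N. z $ j * T x l j)"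
          unfolding w_def P.sum P.scale sum_fun_apply coeff_sum T_def by (simp add: l)
        also have "\<dots> = (A x *\<^sub>v z) $ l"
          using l z by (simp add: A_def scalar_prod_def mult.commute lessThan_atLeast0)
        also have "\<dots> = Polynomial.coeff (y r) s" unfolding Az using l by (simp add: yv_def)
        finally show ?thesis .
      next
        case False
        then show ?thesis using y Fw by (auto simp: pvecs_def D_def not_less)
      qed
    qed
    then have "pmul m q (M x) w = y" by (rule ext)
    then show "\<exists>x'\<in>pvecs q K. pmul m q (M x) x' = y" using w by blast
  qed
  ultimately show ?thesis by (rule that)
qed

lemma injective_mult_open:
  assumes "injective_mult m q (M base) K"
  obtains f where "Q f" "f base \<noteq> 0"
    "\<And>x. x \<in> carrier_vec p \<Longrightarrow> f x \<noteq> 0 \<Longrightarrow> injective_mult m q (M x) K"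
proof -
  define D where "D = d + K"
  define N where "N = q * K"
  interpret P0: Vector_Spaces.linear pscale pscale "pmul m q (M base)" by (rule linear_pmul)
  have sp: "pvs.span (pvecs q K) = (pvecs q K :: (nat \<Rightarrow> 'a poly) set)"
    by (simp add: subspace_pvecs)
  \<comment> \<open>A linear left inverse \<open>g\<close> of the base map stays fixed while x
    varies. If the composite of \<open>g\<close> with the map at x is invertible, the map at x is
    injective.\<close>
  have "inj_on (pmul m q (M base)) (pvs.span (pvecs q K))"
    unfolding sp P0.inj_on_iff_eq_0[OF subspace_pvecs] using assms by (simp add: injective_mult_def)
  from pvs2.linear_inj_on_left_inverse[OF linear_pmul this] obtain g where
    g: "Vector_Spaces.linear pscale pscale g" "\<And>x. x \<in> pvecs q K \<Longrightarrow> g (pmul m q (M base) x) = x"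
    unfolding sp by blast
  interpret g: Vector_Spaces.linear pscale pscale g by (rule g(1))
  \<comment> \<open>Coordinates of \<open>g y\<close>, written out in the coefficients of
    \<open>y\<close> so that membership of the matrix entries in \<open>Q\<close> can be read
    off.\<close>
  define L where "L y l = (\<Sum>e\<in>{..<m}\<times>{..<D}. Polynomial.coeff (y (fst e)) (snd e) * Polynomial.coeff (g (monvec (fst e) (snd e)) (l div K)) (l mod K))"
    for y :: "nat \<Rightarrow> 'a poly" and l
  have Lg: "L y l = Polynomial.coeff (g y (l div K)) (l mod K)" if y: "y \<in> pvecs m D" for y l
  proof -
    have "g y = g (\<Sum>(r,s)\<in>{..<m}\<times>{..<D}. pscale (Polynomial.coeff (y r) s) (monvec r s))"
      using pvecs_expand[OF y] by simp
    also have "\<dots> = (\<Sum>(r,s)\<in>{..<m}\<times>{..<D}. pscale (Polynomial.coeff (y r) s) (g (monvec r s)))"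
      by (simp add: g.sum g.scale case_prod_beta)
    finally show ?thesis by (simp add: L_def sum_fun_apply coeff_sum case_prod_beta)
  qed
  define T where "T x i j = L (pmul m q (M x) (monvec (j div K) (j mod K))) i" for x i j
  define A where "A x = mat N N (\<lambda>(i, j). T x i j)" for x
  define f where "f x = Determinant.det (A x)" for x
  have "Q f" unfolding f_def A_def T_def L_def
    by (intro Q_det Q_sum Q_mult Q_const Q_pmul) auto
  moreover have "f base \<noteq> 0"
  proof -
    have "A base = 1\<^sub>m N"
    proof (rule eq_matI)
      fix i j assume "i < dim_row (1\<^sub>m N)" "j < dim_col (1\<^sub>m N)"
      then have ij: "i < N" "j < N" by auto
      have mj: "monvec (j div K) (j mod K) \<in> (pvecs q K :: (nat \<Rightarrow> 'a poly) set)"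
        using split_index_bound[of j q K] ij by (intro monvec_pvecs) (auto simp: N_def)
      have "pmul m q (M base) (monvec (j div K) (j mod K)) \<in> pvecs m D"
        unfolding D_def by (rule pmul_pvecs[OF degM[OF base] mj])
      then have "T base i j = Polynomial.coeff (monvec (j div K) (j mod K) (i div K)) (i mod K)"
        unfolding T_def by (simp add: Lg g(2)[OF mj])
      moreover have "i = j" if "i div K = j div K" "i mod K = j mod K" using that by (metis div_mult_mod_eq)
      ultimately show "A base $$ (i, j) = 1\<^sub>m N $$ (i, j)"
        using ij by (auto simp: A_def monvec_def)
    qed (auto simp: A_def)
    then show ?thesis by (simp add: f_def)
  qed
  moreover have "injective_mult m q (M x) K" if x: "x \<in> carrier_vec p" "f x \<noteq> 0" for x
    unfolding injective_mult_def
  proof (intro ballI impI)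
    fix z :: "nat \<Rightarrow> 'a poly" assume z: "z \<in> pvecs q K" and 0: "pmul m q (M x) z = 0"
    interpret P: Vector_Spaces.linear pscale pscale "pmul m q (M x)" by (rule linear_pmul)
    have cA: "A x \<in> carrier_mat N N" by (simp add: A_def)
    define zv where "zv = vec N (\<lambda>l. Polynomial.coeff (z (l div K)) (l mod K))"
    have ze: "z = (\<Sum>l<N. pscale (Polynomial.coeff (z (l div K)) (l mod K)) (monvec (l div K) (l mod K)))"
      unfolding N_def sum_split_index[of "\<lambda>c i. pscale (Polynomial.coeff (z c) i) (monvec c i)"]
      by (rule pvecs_expand[OF z])
    have "A x *\<^sub>v zv = 0\<^sub>v N"
    proof (rule eq_vecI)
      fix i assume "i < dim_vec (0\<^sub>v N :: 'a vec)"
      then have i: "i < N" by simp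
      have "(A x *\<^sub>v zv) $ i = (\<Sum>l<N. T x i l * Polynomial.coeff (z (l div K)) (l mod K))"
        using i by (simp add: A_def scalar_prod_def zv_def lessThan_atLeast0)
      also have "\<dots> = (\<Sum>e\<in>{..<m}\<times>{..<D}. (\<Sum>l<N. Polynomial.coeff (z (l div K)) (l mod K) *
          Polynomial.coeff (pmul m q (M x) (monvec (l div K) (l mod K)) (fst e)) (snd e)) *
          Polynomial.coeff (g (monvec (fst e) (snd e)) (i div K)) (i mod K))"
        unfolding T_def L_def sum_distrib_right
        by (subst sum.swap) (intro sum.cong refl, simp add: mult_ac)
      also have "\<dots> = L (pmul m q (M x) z) i"
      proof -
        have "Polynomial.coeff (pmul m q (M x) z r) s = (\<Sum>l<N. Polynomial.coeff (z (l div K)) (l mod K) *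
          Polynomial.coeff (pmul m q (M x) (monvec (l div K) (l mod K)) r) s)" for r s
          by (subst ze) (simp only: P.sum P.scale sum_fun_apply coeff_sum pscale_apply coeff_smult)
        then show ?thesis by (simp add: L_def)
      qed
      also have "\<dots> = 0" unfolding 0 L_def by simp
      finally show "(A x *\<^sub>v zv) $ i = 0\<^sub>v N $ i" using i by simp
    qed (simp add: A_def)
    then have "zv = 0\<^sub>v N"
      using det_0_iff_vec_prod_zero[OF cA] x(2) unfolding f_def zv_def by (metis vec_carrier)
    have "Polynomial.coeff (z c) i = 0" if "c < q" "i < K" for c i
    proof -
      have "Polynomial.coeff (z c) i = zv $ (c * K + i)"
        using split_index[OF that] by (simp add: zv_def N_def)
      then show ?thesis using \<open>zv = 0\<^sub>v N\<close> split_index[OF that] by (simp add: N_def)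
    qed
    then have "Polynomial.coeff (z c) i = 0" for c i
      using z by (cases "c < q \<and> i < K") (auto simp: pvecs_def not_less)
    then show "z = 0" by (simp add: fun_eq_iff poly_eq_iff)
  qed
  ultimately show ?thesis by (rule that)
qed

lemma generic_surjective_injective:
  assumes "surjective_mult m q d (M base) K" "injective_mult m q (M base) K'" "S \<subseteq> carrier_vec p"
    and "\<And>x. x \<in> carrier_vec p \<Longrightarrow> surjective_mult m q d (M x) K \<Longrightarrow> injective_mult m q (M x) K' \<Longrightarrow> x \<in> S"
  shows "generic_set p S"
proof -
  obtain f where f: "Q f" "f base \<noteq> 0"
    "\<And>x. x \<in> carrier_vec p \<Longrightarrow> f x \<noteq> 0 \<Longrightarrow> surjective_mult m q d (M x) K"
    using surjective_mult_open[OF assms(1)] by blast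
  obtain g where g: "Q g" "g base \<noteq> 0"
    "\<And>x. x \<in> carrier_vec p \<Longrightarrow> g x \<noteq> 0 \<Longrightarrow> injective_mult m q (M x) K'"
    using injective_mult_open[OF assms(2)] by blast
  show ?thesis
    by (rule generic_set_nonzero[OF Q_mult[OF f(1) g(1)] base _ assms(3)]) (use f g assms(4) in auto)
qed

end

end

section \<open>Real and complex coordinates\<close>

lemma algebraic_set_polynomial_function:
  assumes "finite I" "\<And>i. i \<in> I \<Longrightarrow> polynomial_function p (g i)"
  shows "algebraic_set p {x \<in> carrier_vec p. \<forall>i\<in>I. g i x = 0}"
proof -
  obtain f where f: "\<And>i. i \<in> I \<Longrightarrow> f i \<in> mpolys p" "\<And>i x. i \<in> I \<Longrightarrow> x \<in> carrier_vec p \<Longrightarrow> mpoly_eval (f i) x = g i x"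
    using assms(2) unfolding polynomial_function_def by metis
  show ?thesis unfolding algebraic_set_def
    by (rule exI[of _ "f ` I"]) (use f assms(1) in auto)
qed

lemma real_coordinate_functions: "coordinate_functions p (polynomial_function p)"
proof
  fix f assume "polynomial_function p f"
  then show "algebraic_set p {x \<in> carrier_vec p. f x = 0}"
    using algebraic_set_polynomial_function[of "{()}" p "\<lambda>_. f"] by simp
qed (auto intro: polynomial_function_const polynomial_function_add polynomial_function_mult)

text \<open>Algebraic sets are real here, so one complex equation is recorded as two real ones, for
  the real and the imaginary part.\<close>

definition complex_polynomial_function :: "nat \<Rightarrow> (real vec \<Rightarrow> complex) \<Rightarrow> bool" where
  "complex_polynomial_function p f \<longleftrightarrow>
     polynomial_function p (\<lambda>x. Re (f x)) \<and> polynomial_function p (\<lambda>x. Im (f x))"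

lemma complex_coordinate_functions: "coordinate_functions p (complex_polynomial_function p)"
proof
  fix f assume f: "complex_polynomial_function p f"
  have "algebraic_set p {x \<in> carrier_vec p. \<forall>h\<in>{Re, Im}. h (f x) = 0}"
    by (rule algebraic_set_polynomial_function)
      (use f in \<open>auto simp: complex_polynomial_function_def\<close>)
  then show "algebraic_set p {x \<in> carrier_vec p. f x = 0}" by (simp add: complex_eq_iff)
next
  fix f g assume fg: "complex_polynomial_function p f" "complex_polynomial_function p g"
  then show "complex_polynomial_function p (\<lambda>x. f x + g x)"
    by (auto simp: complex_polynomial_function_def intro: polynomial_function_add)
  have "polynomial_function p (\<lambda>x. Re (f x) * Re (g x) + (- 1) * (Im (f x) * Im (g x)))"
    "polynomial_function p (\<lambda>x. Re (f x) * Im (g x) + Im (f x) * Re (g x))"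
    using fg unfolding complex_polynomial_function_def
    by (intro polynomial_function_add polynomial_function_mult polynomial_function_const; blast)+
  then show "complex_polynomial_function p (\<lambda>x. f x * g x)"
    by (simp add: complex_polynomial_function_def)
qed (auto simp: complex_polynomial_function_def intro: polynomial_function_const)

section \<open>From the two conditions to the three generic sets\<close>

lemma balanced_minimal_bases:
  fixes A :: "'a::field poly mat"
  assumes A: "A \<in> polymats d m (m + n)" and b: "balanced (\<lambda>r c. A $$ (r, c)) m n d k t"
  shows "A \<in> minimal_bases_full_leading d m (m + n)" "A \<in> minimal_bases_dual_degree d m (m + n) k"
proof -
  have "A \<in> carrier_mat m (m + n)" using A by (simp add: polymats_def)
  then obtain N X Y where "completed_mat A m n d k t N X Y" using completed_mat_exists[OF _ b] by blast
  then interpret completed_mat A m n d k t N X Y .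
  show "A \<in> minimal_bases_full_leading d m (m + n)" "A \<in> minimal_bases_dual_degree d m (m + n) k"
    using A minimal_basis_mat_A full_row_rank_leading dual_minimal_bases_exists dual_minimal_bases_degree
    by (auto simp: minimal_bases_full_leading_def minimal_bases_dual_degree_def)
qed

lemma balanced_eigenstructure_only_right:
  fixes A :: "'a::field_gcd poly mat"
  assumes A: "A \<in> polymats d m (m + n)" and b: "balanced (\<lambda>r c. A $$ (r, c)) m n d k t"
  shows "A \<in> eigenstructure_only_right d m (m + n) (\<lambda>j. if j = k - 1 then t else if j = k then n - t else 0)"
proof -
  have "0 < k" using b by (simp add: balanced_def)
  moreover have "complete_eigenstructure d A = ({#}, {#}, {#}, replicate_mset t (k - 1) + replicate_mset (n - t) k)"
    using eigenstructure_balanced[OF _ b] A by (simp add: polymats_def)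
  ultimately show ?thesis using A by (auto simp: eigenstructure_only_right_def)
qed

text \<open>For any coordinate bijection whose inverse has matrix coefficients in \<open>Q\<close>;
  the base point is the coordinate vector of the explicit matrix \<open>W\<close>.\<close>

lemma (in witness) generic_set_balanced:
  fixes coords :: "'a::field poly mat \<Rightarrow> real vec"
  assumes cf: "coordinate_functions p Q"
    and bij: "bij_betw coords (polymats d m (m + n)) (carrier_vec p)"
    and Q: "\<And>r c i. r < m \<Longrightarrow> c < m + n \<Longrightarrow>
      Q (\<lambda>x. Polynomial.coeff (the_inv_into (polymats d m (m + n)) coords x $$ (r, c)) i)"
    and S: "S \<subseteq> polymats d m (m + n)"
    and balS: "\<And>A. A \<in> polymats d m (m + n) \<Longrightarrow> balanced (\<lambda>r c. A $$ (r, c)) m n d k t \<Longrightarrow> A \<in> S"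
  shows "generic_set p (coords ` S)"
proof -
  interpret coordinate_functions p Q by (rule cf)
  let ?P = "polymats d m (m + n) :: 'a poly mat set"
  define dec where "dec = the_inv_into ?P coords"
  have inj: "inj_on coords ?P" and img: "coords ` ?P = carrier_vec p" using bij by (auto simp: bij_betw_def)
  have dec: "dec x \<in> ?P" "coords (dec x) = x" if "x \<in> carrier_vec p" for x
  proof -
    have "x \<in> coords ` ?P" using that img by simp
    then show "dec x \<in> ?P" "coords (dec x) = x"
      unfolding dec_def by (auto intro: the_inv_into_into[OF inj] f_the_inv_into_f[OF inj])
  qed
  define A0 where "A0 = mat m (m + n) (\<lambda>(r, c). W r c :: 'a poly)"
  have A0: "A0 \<in> ?P" using degree_W by (auto simp: A0_def polymats_def)
  have dec0: "dec (coords A0) = A0" unfolding dec_def by (rule the_inv_into_f_f[OF inj A0])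
  have F0: "pmul m (m + n) (\<lambda>r c. dec (coords A0) $$ (r, c)) = pmul m (m + n) W"
    unfolding dec0 by (rule pmul_cong) (simp add: A0_def)
  show ?thesis
  proof (rule generic_surjective_injective[where M = "\<lambda>x r c. dec x $$ (r, c)" and m = m and q = "m + n" and d = d
        and base = "coords A0" and K = k and K' = "k - 1"])
    show "Polynomial.degree (dec x $$ (r, c)) \<le> d" if "x \<in> carrier_vec p" "r < m" "c < m + n" for x r c
      using dec(1)[OF that(1)] that by (simp add: polymats_def)
    show "Q (\<lambda>x. Polynomial.coeff (dec x $$ (r, c)) i)" if "r < m" "c < m + n" for r c i
      using Q[OF that] by (simp add: dec_def)
    show "coords A0 \<in> carrier_vec p" using A0 img by blast
    show "surjective_mult m (m + n) d (\<lambda>r c. dec (coords A0) $$ (r, c)) k"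
      using surjective_W unfolding surjective_mult_def F0 .
    show "injective_mult m (m + n) (\<lambda>r c. dec (coords A0) $$ (r, c)) (k - 1)"
      using injective_W unfolding injective_mult_def F0 .
    show "coords ` S \<subseteq> carrier_vec p" using S img by blast
    fix x assume x: "x \<in> carrier_vec p" and sm: "surjective_mult m (m + n) d (\<lambda>r c. dec x $$ (r, c)) k"
      and im: "injective_mult m (m + n) (\<lambda>r c. dec x $$ (r, c)) (k - 1)"
    have "balanced (\<lambda>r c. dec x $$ (r, c)) m n d k t"
      by unfold_locales (use dec(1)[OF x] m0 k0 tn nk sm im in \<open>auto simp: polymats_def\<close>)
    then have "dec x \<in> S" by (rule balS[OF dec(1)[OF x]])
    then show "x \<in> coords ` S" using dec(2)[OF x] by (metis image_eqI)
  qed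
qed

lemma polymats_inverse_coeff:
  fixes coords :: "'a::zero poly mat \<Rightarrow> 'b vec"
  assumes bij: "bij_betw coords (polymats d m q) (carrier_vec p)" and x: "x \<in> carrier_vec p"
    and rc: "r < m" "c < q"
  defines "A \<equiv> the_inv_into (polymats d m q) coords x"
  shows "coords A = x"
    and "i \<le> d \<Longrightarrow> Polynomial.coeff (A $$ (r, c)) i = coeff_vec d m q A $ (i * (m * q) + r * q + c)"
    and "d < i \<Longrightarrow> Polynomial.coeff (A $$ (r, c)) i = 0"
proof -
  have inj: "inj_on coords (polymats d m q)" and img: "coords ` polymats d m q = carrier_vec p"
    using bij by (auto simp: bij_betw_def)
  show "coords A = x" unfolding A_def by (rule f_the_inv_into_f[OF inj]) (simp add: img x)
  have A: "A \<in> polymats d m q" unfolding A_def by (rule the_inv_into_into[OF inj]) (simp_all add: img x)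
  show "Polynomial.coeff (A $$ (r, c)) i = coeff_vec d m q A $ (i * (m * q) + r * q + c)" if "i \<le> d"
    by (rule coeff_vec_index(2)[OF that rc, symmetric]) (use A in \<open>simp add: polymats_def\<close>)
  have "Polynomial.degree (A $$ (r, c)) \<le> d" using A rc by (simp add: polymats_def)
  then show "d < i \<Longrightarrow> Polynomial.coeff (A $$ (r, c)) i = 0" by (simp add: coeff_eq_0)
qed

lemma (in witness) generic_real_balanced:
  assumes S: "S \<subseteq> polymats d m (m + n)"
    and balS: "\<And>A. A \<in> polymats d m (m + n) \<Longrightarrow> balanced (\<lambda>r c. A $$ (r, c)) m n d k t \<Longrightarrow> A \<in> S"
  shows "generic_real d m (m + n) S"
proof -
  let ?p = "(d + 1) * m * (m + n)"
  have bij: "bij_betw (real_coords d m (m + n)) (polymats d m (m + n)) (carrier_vec ?p)"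
    using m0 by (intro real_coords_bij) auto
  have "generic_set ?p (real_coords d m (m + n) ` S)"
  proof (rule generic_set_balanced[OF real_coordinate_functions bij _ S balS])
    fix r c i assume rc: "r < m" "c < m + n"
    note co = polymats_inverse_coeff[OF bij _ rc]
    show "polynomial_function ?p (\<lambda>x. Polynomial.coeff (the_inv_into (polymats d m (m + n)) (real_coords d m (m + n)) x $$ (r, c)) i)"
    proof (cases "i \<le> d")
      case True
      have "i * (m * (m + n)) + r * (m + n) + c < ?p"
        by (rule coeff_vec_index(1)[OF True rc, of "0\<^sub>m m (m + n) :: real poly mat"]) simp
      then have "polynomial_function ?p (\<lambda>x. x $ (i * (m * (m + n)) + r * (m + n) + c))"
        by (rule polynomial_function_coord)
      then show ?thesis
        by (rule polynomial_function_cong) (use co(1,2) True in \<open>simp add: real_coords_def\<close>)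
    next
      case False
      show ?thesis
        by (rule polynomial_function_cong[OF polynomial_function_const[of _ 0]]) (use co(3) False in simp)
    qed
  qed
  then show ?thesis using S by (simp add: generic_real_def)
qed

lemma (in witness) generic_complex_balanced:
  assumes S: "S \<subseteq> polymats d m (m + n)"
    and balS: "\<And>A. A \<in> polymats d m (m + n) \<Longrightarrow> balanced (\<lambda>r c. A $$ (r, c)) m n d k t \<Longrightarrow> A \<in> S"
  shows "generic_complex d m (m + n) S"
proof -
  let ?p = "2 * (d + 1) * m * (m + n)"
  define l where "l = (d + 1) * m * (m + n)"
  have p: "?p = l + l" unfolding l_def by (simp only: mult_2 distrib_right)
  have bij: "bij_betw (complex_coords d m (m + n)) (polymats d m (m + n)) (carrier_vec ?p)"
    using m0 by (intro complex_coords_bij) auto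
  have "generic_set ?p (complex_coords d m (m + n) ` S)"
  proof (rule generic_set_balanced[OF complex_coordinate_functions bij _ S balS])
    fix r c i assume rc: "r < m" "c < m + n"
    note co = polymats_inverse_coeff[OF bij _ rc]
    let ?A = "\<lambda>x. the_inv_into (polymats d m (m + n)) (complex_coords d m (m + n)) x"
    show "complex_polynomial_function ?p (\<lambda>x. Polynomial.coeff (?A x $$ (r, c)) i)"
    proof (cases "i \<le> d")
      case True
      define e where "e = i * (m * (m + n)) + r * (m + n) + c"
      have e: "e < l" unfolding e_def l_def
        by (rule coeff_vec_index(1)[OF True rc, of "0\<^sub>m m (m + n) :: real poly mat"]) simp
      have dv: "dim_vec (coeff_vec d m (m + n) B) = l" for B :: "complex poly mat"
        by (simp only: coeff_vec_def dim_vec l_def)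
      have re: "x $ e = Re (Polynomial.coeff (?A x $$ (r, c)) i)"
        and im: "x $ (l + e) = Im (Polynomial.coeff (?A x $$ (r, c)) i)" if x: "x \<in> carrier_vec ?p" for x
      proof -
        have x_eq: "complex_coords d m (m + n) (?A x) = x" by (rule co(1)[OF x])
        have "coeff_vec d m (m + n) (?A x) $ e = Polynomial.coeff (?A x $$ (r, c)) i"
          using co(2)[OF x True] by (simp add: e_def)
        then have "complex_coords d m (m + n) (?A x) $ e = Re (Polynomial.coeff (?A x $$ (r, c)) i)"
          "complex_coords d m (m + n) (?A x) $ (l + e) = Im (Polynomial.coeff (?A x $$ (r, c)) i)"
          using e by (simp_all add: complex_coords_def dv)
        then show "x $ e = Re (Polynomial.coeff (?A x $$ (r, c)) i)"
          "x $ (l + e) = Im (Polynomial.coeff (?A x $$ (r, c)) i)"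
          unfolding x_eq .
      qed
      have "polynomial_function ?p (\<lambda>x. x $ e)" "polynomial_function ?p (\<lambda>x. x $ (l + e))"
        using e p by (auto intro!: polynomial_function_coord)
      then show ?thesis unfolding complex_polynomial_function_def
        by (intro conjI) (erule polynomial_function_cong, erule re, erule polynomial_function_cong, erule im)
    next
      case False
      have "complex_polynomial_function ?p (\<lambda>_. 0)"
        by (simp add: complex_polynomial_function_def polynomial_function_const)
      then show ?thesis unfolding complex_polynomial_function_def
        using False co(3) by (auto elim!: polynomial_function_cong)
    qed
  qed
  then show ?thesis using S by (simp add: generic_complex_def)
qed

lemma subset_polymats:
  "eigenstructure_only_right d r q \<alpha> \<subseteq> polymats d r q"
  "minimal_bases_full_leading d r q \<subseteq> polymats d r q"
  "minimal_bases_dual_degree d r q k \<subseteq> polymats d r q"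
  by (auto simp: eigenstructure_only_right_def minimal_bases_full_leading_def minimal_bases_dual_degree_def)

theorem corollary5p2:
  fixes m n d k' t :: nat
  assumes "m > 0" and "n > 0" and "d > 0"
    and "int k' = \<lceil>real (m * d) / real n\<rceil>"
    and "int t = int n * int k' - int m * int d"
  defines "\<alpha> \<equiv> \<lambda>j. if j = k' - 1 then t else if j = k' then n - t else 0"
  shows "t < n
    \<and> generic_real d m (m + n) (eigenstructure_only_right d m (m + n) \<alpha>)
    \<and> generic_real d m (m + n) (minimal_bases_full_leading d m (m + n))
    \<and> generic_real d m (m + n) (minimal_bases_dual_degree d m (m + n) k')
    \<and> generic_complex d m (m + n) (eigenstructure_only_right d m (m + n) \<alpha>)
    \<and> generic_complex d m (m + n) (minimal_bases_full_leading d m (m + n))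
    \<and> generic_complex d m (m + n) (minimal_bases_dual_degree d m (m + n) k')"
proof -
  have nk: "n * k' = m * d + t" using assms(5) by (metis add_diff_cancel_left' diff_add_cancel of_nat_add of_nat_eq_iff of_nat_mult add.commute)
  \<comment> \<open>A ceiling exceeds its argument by less than 1; multiplied by n this is t <
    n.\<close>
  have "real k' < real (m * d) / real n + 1" using assms(4) by linarith
  then have "real n * real k' < real (m * d) + real n" using assms(2) by (simp add: field_simps)
  then have "n * k' < m * d + n" by (metis of_nat_add of_nat_less_iff of_nat_mult)
  then have tn: "t < n" using nk by simp
  \<comment> \<open>k' = 0 would force m d + t = 0, although m and d are positive.\<close>
  have k0: "0 < k'" using nk assms(1,3) by (cases k') auto
  interpret witness m n d k' t by unfold_locales (use assms(1,3) tn nk k0 in auto)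
  show ?thesis
    unfolding \<alpha>_def
    by (intro conjI tn generic_real_balanced generic_complex_balanced subset_polymats
        balanced_eigenstructure_only_right balanced_minimal_bases)
qed

end
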